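(* Let $n\ge 2$, let $\Omega\subset\mathbb{R}^n$ be an open set, let $p\in(1,\infty)$, $p'=\frac{p}{p-1}$, and $s\in(0,1)$. Let $(F^k)_k\subset L^p_{\rm loc}(\Omega;\mathbb{R}^n)$, $F^\infty\in L^p_{\rm loc}(\Omega;\mathbb{R}^n)$, $(w^k)_k\subset H^{s,p'}(\mathbb{R}^n)$, and $w^\infty\in H^{s,p'}(\mathbb{R}^n)$ satisfy, as $k\to\infty$, \begin{align*} &F^k\to F^\infty &&\text{weakly in } L^p_{\rm loc}(\Omega;\mathbb{R}^n),\\ &\nabla^sw^k\to\nabla^sw^\infty &&\text{weakly in } L^{p'}_{\rm loc}(\Omega;\mathbb{R}^n). \end{align*} Assume that, as $k\to\infty$, $$\operatorname{div}F^k\to\operatorname{div}F^\infty\quad\text{strongly in } W^{-1,p}_{\rm loc}(\Omega).$$ Then, as $k\to\infty$, $$F^k\cdot\nabla^sw^k\to F^\infty\cdot\nabla^sw^\infty\quad\text{weakly* in }\mathcal{D}'(\Omega),$$ that is, $\int_\Omega\varphi\,F^k\cdot\nabla^sw^k\,{\rm d}x\to\int_\Omega\varphi\,F^\infty\cdot\nabla^sw^\infty\,{\rm d}x$ for every $\varphi\in C_c^\infty(\Omega)$.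
   Context: Notation. For open sets $A,B\subseteq\mathbb{R}^n$, $A\Subset B$ means that there is a compact set $K$ with $A\subset K\subset B$. $\mathcal{D}'(\Omega)$ is the space of distributions on $\Omega$. Classical spaces and divergence. For $q\in(1,\infty)$ with conjugate exponent $q'=\frac{q}{q-1}$ and an open set $U\subseteq\mathbb{R}^n$, $W^{1,q}_0(U)$ is the closure of $C_c^\infty(U)$ in the $W^{1,q}(\mathbb{R}^n)$ norm, $W^{-1,q}(U)=(W^{1,q'}_0(U))'$, and $$W^{-1,q}_{\rm loc}(\Omega)=\{f\in\mathcal{D}'(\Omega): f\in W^{-1,q}(\Omega')\text{ for all open sets }\Omega'\Subset\Omega\}.$$ For $F\in L^p_{\rm loc}(\Omega;\mathbb{R}^n)$, $\operatorname{div}F=\sum_{j=1}^n\partial_jF_j\in W^{-1,p}_{\rm loc}(\Omega)$ is the distributional divergence. Riesz fractional gradient. Set $\mu_{n,s}=\frac{2^s\Gamma(\frac{n+s+1}{2})}{\pi^{n/2}\Gamma(\frac{1-s}{2})}$, with $\Gamma$ the Gamma function. For $\psi\in C_c^\infty(\mathbb{R}^n)$, $$\nabla^s\psi(x)=\mu_{n,s}\int_{\mathbb{R}^n}\frac{(\psi(y)-\psi(x))(y-x)}{|y-x|^{n+s+1}}\,{\rm d}y\in\mathbb{R}^n,\qquad x\in\mathbb{R}^n$$ (the integral converges for every $x$). Fractional Sobolev space. For $q\in(1,\infty)$, $H^{s,q}(\mathbb{R}^n)$ is the closure (completion, realized inside $L^q(\mathbb{R}^n)$) of $C_c^\infty(\mathbb{R}^n)$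 in the norm $\|\psi\|_{H^{s,q}(\mathbb{R}^n)}=(\|\psi\|_{L^q(\mathbb{R}^n)}^q+\|\nabla^s\psi\|^q_{L^q(\mathbb{R}^n;\mathbb{R}^n)})^{1/q}$. The operator $\nabla^s$ is extended by continuity to a bounded operator $H^{s,q}(\mathbb{R}^n)\to L^q(\mathbb{R}^n;\mathbb{R}^n)$. Local convergence. Weak convergence in $L^{q}_{\rm loc}(\Omega;\mathbb{R}^n)$ means weak convergence in $L^{q}(\Omega';\mathbb{R}^n)$ for every open $\Omega'\Subset\Omega$; strong convergence in $W^{-1,p}_{\rm loc}(\Omega)$ means norm convergence in $W^{-1,p}(\Omega')$ for every open $\Omega'\Subset\Omega$. *)

theory Defs
  imports "HOL-Analysis.Analysis"
begin

definition compactly_in :: "'a::topological_space set \<Rightarrow> 'a set \<Rightarrow> bool" where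
  "compactly_in A B \<longleftrightarrow> (\<exists>K. compact K \<and> A \<subseteq> K \<and> K \<subseteq> B)"

definition conj_exp :: "real \<Rightarrow> real" where
  "conj_exp q = q / (q - 1)"


subsection \<open>Test functions and distributions\<close>

definition partial :: "'n::finite \<Rightarrow> (real^'n \<Rightarrow> real) \<Rightarrow> real^'n \<Rightarrow> real" where
  "partial j f x = frechet_derivative f (at x) (axis j 1)"

text \<open>A multi-index is given by a list of coordinates, one entry per differentiation.\<close>

definition partials :: "'n::finite list \<Rightarrow> (real^'n \<Rightarrow> real) \<Rightarrow> real^'n \<Rightarrow> real" where
  "partials js f = foldr partial js f"

definition test_functions :: "(real^'n::finite) set \<Rightarrow> (real^'n \<Rightarrow> real) set" where
  "test_functions U = {\<phi>. (\<forall>js x. partials js \<phi> differentiable (at x)) \<and>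
     compact (closure {x. \<phi> x \<noteq> 0}) \<and> closure {x. \<phi> x \<noteq> 0} \<subseteq> U}"

text \<open>A distribution is a functional on functions of which only the restriction to the
  test functions on \<open>U\<close> matters; continuity is expressed by the seminorm estimates.\<close>

definition distributions :: "(real^'n::finite) set \<Rightarrow> ((real^'n \<Rightarrow> real) \<Rightarrow> real) set" where
  "distributions U = {T.
     (\<forall>\<phi>\<in>test_functions U. \<forall>\<psi>\<in>test_functions U. T (\<lambda>x. \<phi> x + \<psi> x) = T \<phi> + T \<psi>) \<and>
     (\<forall>c. \<forall>\<phi>\<in>test_functions U. T (\<lambda>x. c * \<phi> x) = c * T \<phi>) \<and>
     (\<forall>K. compact K \<and> K \<subseteq> U \<longrightarrow>
        (\<exists>C N. \<forall>\<phi>\<in>test_functions U. {x. \<phi> x \<noteq> 0} \<subseteq> K \<longrightarrow>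
           \<bar>T \<phi>\<bar> \<le> C * (\<Sum>js\<in>{js. length js \<le> N}. SUP x. \<bar>partials js \<phi> x\<bar>)))}"

definition distr_of :: "(real^'n::finite) set \<Rightarrow> (real^'n \<Rightarrow> real) \<Rightarrow> (real^'n \<Rightarrow> real) \<Rightarrow> real" where
  "distr_of U f \<phi> = (LINT x|lebesgue_on U. \<phi> x * f x)"

definition distr_partial ::
    "'n::finite \<Rightarrow> ((real^'n \<Rightarrow> real) \<Rightarrow> real) \<Rightarrow> (real^'n \<Rightarrow> real) \<Rightarrow> real" where
  "distr_partial j T \<phi> = - T (partial j \<phi>)"

definition distr_div ::
    "(real^'n::finite) set \<Rightarrow> (real^'n \<Rightarrow> real^'n) \<Rightarrow> (real^'n \<Rightarrow> real) \<Rightarrow> real" where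
  "distr_div U F \<phi> = (\<Sum>j\<in>UNIV. distr_partial j (distr_of U (\<lambda>x. F x $ j)) \<phi>)"

definition weak_star_conv_distr :: "(real^'n::finite) set \<Rightarrow>
    (nat \<Rightarrow> (real^'n \<Rightarrow> real) \<Rightarrow> real) \<Rightarrow> ((real^'n \<Rightarrow> real) \<Rightarrow> real) \<Rightarrow> bool" where
  "weak_star_conv_distr U T Tinf \<longleftrightarrow>
     (\<forall>k. T k \<in> distributions U) \<and> Tinf \<in> distributions U \<and>
     (\<forall>\<phi>\<in>test_functions U. (\<lambda>k. T k \<phi>) \<longlonglongrightarrow> Tinf \<phi>)"


subsection \<open>Duals of spaces of functions\<close>

text \<open>\<open>V\<close> is a linear space of functions with seminorm \<open>N\<close>. Functions are not identified
  when they agree almost everywhere: as \<open>N\<close> vanishes on almost everywhere vanishing functions,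
  boundedness makes a functional insensitive to the choice of representative.\<close>

definition dual_space :: "('x \<Rightarrow> 'b::real_vector) set \<Rightarrow> (('x \<Rightarrow> 'b) \<Rightarrow> real) \<Rightarrow>
    (('x \<Rightarrow> 'b) \<Rightarrow> real) set" where
  "dual_space V N = {l.
     (\<forall>f\<in>V. \<forall>g\<in>V. l (\<lambda>x. f x + g x) = l f + l g) \<and>
     (\<forall>c. \<forall>f\<in>V. l (\<lambda>x. c *\<^sub>R f x) = c * l f) \<and>
     (\<exists>C. \<forall>f\<in>V. \<bar>l f\<bar> \<le> C * N f)}"

definition dual_norm :: "('x \<Rightarrow> 'b::real_vector) set \<Rightarrow> (('x \<Rightarrow> 'b) \<Rightarrow> real) \<Rightarrow>
    (('x \<Rightarrow> 'b) \<Rightarrow> real) \<Rightarrow> real" where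
  "dual_norm V N l = (SUP f\<in>{f\<in>V. N f \<le> 1}. \<bar>l f\<bar>)"


subsection \<open>Lebesgue spaces\<close>

definition Lq :: "real \<Rightarrow> 'a::euclidean_space set \<Rightarrow> ('a \<Rightarrow> 'b::euclidean_space) set" where
  "Lq q U = {f. f \<in> borel_measurable (lebesgue_on U) \<and>
     integrable (lebesgue_on U) (\<lambda>x. norm (f x) powr q)}"

definition Lq_norm ::
    "real \<Rightarrow> 'a::euclidean_space set \<Rightarrow> ('a \<Rightarrow> 'b::euclidean_space) \<Rightarrow> real" where
  "Lq_norm q U f = (LINT x|lebesgue_on U. norm (f x) powr q) powr (1 / q)"

definition Lq_loc :: "real \<Rightarrow> 'a::euclidean_space set \<Rightarrow> ('a \<Rightarrow> 'b::euclidean_space) set" where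
  "Lq_loc q U = {f. \<forall>U'. open U' \<and> compactly_in U' U \<longrightarrow> f \<in> Lq q U'}"

definition weak_conv_Lq :: "real \<Rightarrow> 'a::euclidean_space set \<Rightarrow>
    (nat \<Rightarrow> 'a \<Rightarrow> 'b::euclidean_space) \<Rightarrow> ('a \<Rightarrow> 'b) \<Rightarrow> bool" where
  "weak_conv_Lq q U f finf \<longleftrightarrow>
     (\<forall>k. f k \<in> Lq q U) \<and> finf \<in> Lq q U \<and>
     (\<forall>l\<in>dual_space (Lq q U) (Lq_norm q U). (\<lambda>k. l (f k)) \<longlonglongrightarrow> l finf)"

definition weak_conv_Lq_loc :: "real \<Rightarrow> 'a::euclidean_space set \<Rightarrow>
    (nat \<Rightarrow> 'a \<Rightarrow> 'b::euclidean_space) \<Rightarrow> ('a \<Rightarrow> 'b) \<Rightarrow> bool" where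
  "weak_conv_Lq_loc q U f finf \<longleftrightarrow>
     (\<forall>U'. open U' \<and> compactly_in U' U \<longrightarrow> weak_conv_Lq q U' f finf)"


subsection \<open>Sobolev spaces of order one and minus one\<close>

definition has_weak_grad :: "(real^'n::finite \<Rightarrow> real) \<Rightarrow> (real^'n \<Rightarrow> real^'n) \<Rightarrow> bool" where
  "has_weak_grad u g \<longleftrightarrow> g \<in> Lq_loc 1 UNIV \<and>
     (\<forall>j. \<forall>\<phi>\<in>test_functions UNIV.
        distr_partial j (distr_of UNIV u) \<phi> = distr_of UNIV (\<lambda>x. g x $ j) \<phi>)"

text \<open>Unique up to a null set.\<close>

definition weak_grad :: "(real^'n::finite \<Rightarrow> real) \<Rightarrow> real^'n \<Rightarrow> real^'n" where
  "weak_grad u = (SOME g. has_weak_grad u g)"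

definition W1 :: "real \<Rightarrow> (real^'n::finite \<Rightarrow> real) set" where
  "W1 q = {u \<in> Lq q UNIV. \<exists>g\<in>Lq q UNIV. has_weak_grad u g}"

definition W1_norm :: "real \<Rightarrow> (real^'n::finite \<Rightarrow> real) \<Rightarrow> real" where
  "W1_norm q u =
     (Lq_norm q UNIV u powr q + Lq_norm q UNIV (weak_grad u) powr q) powr (1 / q)"

definition W1_0 :: "real \<Rightarrow> (real^'n::finite) set \<Rightarrow> (real^'n \<Rightarrow> real) set" where
  "W1_0 q U = {u \<in> W1 q. \<exists>\<phi>. (\<forall>k::nat. \<phi> k \<in> test_functions U) \<and>
     (\<lambda>k. W1_norm q (\<lambda>x. \<phi> k x - u x)) \<longlonglongrightarrow> 0}"

definition Wm1 :: "real \<Rightarrow> (real^'n::finite) set \<Rightarrow> ((real^'n \<Rightarrow> real) \<Rightarrow> real) set" where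
  "Wm1 q U = dual_space (W1_0 (conj_exp q) U) (W1_norm (conj_exp q))"

definition Wm1_norm ::
    "real \<Rightarrow> (real^'n::finite) set \<Rightarrow> ((real^'n \<Rightarrow> real) \<Rightarrow> real) \<Rightarrow> real" where
  "Wm1_norm q U S = dual_norm (W1_0 (conj_exp q) U) (W1_norm (conj_exp q)) S"

text \<open>A distribution is identified with the element of \<open>Wm1 q U\<close> that extends it, which is
  unique by density of the test functions.\<close>

definition Wm1_extends :: "real \<Rightarrow> (real^'n::finite) set \<Rightarrow>
    ((real^'n \<Rightarrow> real) \<Rightarrow> real) \<Rightarrow> ((real^'n \<Rightarrow> real) \<Rightarrow> real) \<Rightarrow> bool" where
  "Wm1_extends q U T S \<longleftrightarrow> S \<in> Wm1 q U \<and> (\<forall>\<phi>\<in>test_functions U. S \<phi> = T \<phi>)"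

definition Wm1_loc :: "real \<Rightarrow> (real^'n::finite) set \<Rightarrow> ((real^'n \<Rightarrow> real) \<Rightarrow> real) set" where
  "Wm1_loc q U = {T \<in> distributions U.
     \<forall>U'. open U' \<and> compactly_in U' U \<longrightarrow> (\<exists>S. Wm1_extends q U' T S)}"

definition strong_conv_Wm1_loc :: "real \<Rightarrow> (real^'n::finite) set \<Rightarrow>
    (nat \<Rightarrow> (real^'n \<Rightarrow> real) \<Rightarrow> real) \<Rightarrow> ((real^'n \<Rightarrow> real) \<Rightarrow> real) \<Rightarrow> bool" where
  "strong_conv_Wm1_loc q U T Tinf \<longleftrightarrow>
     (\<forall>k. T k \<in> Wm1_loc q U) \<and> Tinf \<in> Wm1_loc q U \<and>
     (\<forall>U'. open U' \<and> compactly_in U' U \<longrightarrow>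
        (\<exists>S Sinf. (\<forall>k. Wm1_extends q U' (T k) (S k)) \<and> Wm1_extends q U' Tinf Sinf \<and>
           (\<lambda>k. Wm1_norm q U' (\<lambda>u. S k u - Sinf u)) \<longlonglongrightarrow> 0))"


subsection \<open>The Riesz fractional gradient and its Sobolev space\<close>

definition riesz_const :: "'n::finite itself \<Rightarrow> real \<Rightarrow> real" where
  "riesz_const _ s =
     2 powr s * Gamma ((real CARD('n) + s + 1) / 2) /
     (pi powr (real CARD('n) / 2) * Gamma ((1 - s) / 2))"

definition frac_grad_smooth ::
    "real \<Rightarrow> (real^'n::finite \<Rightarrow> real) \<Rightarrow> real^'n \<Rightarrow> real^'n" where
  "frac_grad_smooth s \<psi> x = riesz_const TYPE('n) s *\<^sub>R
     (LINT y|lebesgue. ((\<psi> y - \<psi> x) / norm (y - x) powr (real CARD('n) + s + 1)) *\<^sub>R (y - x))"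

definition Hsq_norm_smooth :: "real \<Rightarrow> real \<Rightarrow> (real^'n::finite \<Rightarrow> real) \<Rightarrow> real" where
  "Hsq_norm_smooth s q \<psi> =
     (Lq_norm q UNIV \<psi> powr q + Lq_norm q UNIV (frac_grad_smooth s \<psi>) powr q) powr (1 / q)"

definition Hsq_approx ::
    "real \<Rightarrow> real \<Rightarrow> (nat \<Rightarrow> real^'n::finite \<Rightarrow> real) \<Rightarrow> (real^'n \<Rightarrow> real) \<Rightarrow> bool" where
  "Hsq_approx s q \<psi> u \<longleftrightarrow> (\<forall>k. \<psi> k \<in> test_functions UNIV) \<and>
     (\<forall>e>0. \<exists>M. \<forall>k\<ge>M. \<forall>m\<ge>M. Hsq_norm_smooth s q (\<lambda>x. \<psi> k x - \<psi> m x) < e) \<and>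
     (\<lambda>k. Lq_norm q UNIV (\<lambda>x. \<psi> k x - u x)) \<longlonglongrightarrow> 0"

text \<open>The completion realised inside \<open>Lq q UNIV\<close>: limits of Cauchy sequences of test functions.\<close>

definition Hsq :: "real \<Rightarrow> real \<Rightarrow> (real^'n::finite \<Rightarrow> real) set" where
  "Hsq s q = {u \<in> Lq q UNIV. \<exists>\<psi>. Hsq_approx s q \<psi> u}"

text \<open>Extension by continuity; unique up to a null set, since the operator on test functions
  is closable in \<open>Lq q UNIV\<close>.\<close>

definition frac_grad ::
    "real \<Rightarrow> real \<Rightarrow> (real^'n::finite \<Rightarrow> real) \<Rightarrow> real^'n \<Rightarrow> real^'n" where
  "frac_grad s q u = (SOME V. V \<in> Lq q UNIV \<and> (\<exists>\<psi>. Hsq_approx s q \<psi> u \<and>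
     (\<lambda>k. Lq_norm q UNIV (\<lambda>x. frac_grad_smooth s (\<psi> k) x - V x)) \<longlonglongrightarrow> 0))"

end

theory Submission
  imports Defs "HOL-Computational_Algebra.Polynomial"
begin

text \<open>The fractional gradient of a test function is the gradient of a Riesz potential. If \<open>\<bar>h\<bar>\<^sup>2\<close> is replaced
  by \<open>\<bar>h\<bar>\<^sup>2 + e\<close> in the kernel, the potential becomes smooth, and its gradient tends boundedly to the
  fractional gradient as \<open>e\<close> tends to \<open>0\<close>. Hence on every ball the fractional gradient of any element
  of the Sobolev space is a limit in \<open>L\<^sup>q\<close> of gradients of smooth functions; no bound on these functions
  themselves is needed.
  On a ball, write the weakly vanishing differences as \<open>f\<^sub>k\<close> and, up to a strongly vanishing error,
  \<open>\<nabla>u\<^sub>k\<close> with \<open>u\<^sub>k\<close> of mean zero. Then \<open>u\<^sub>k\<close> tends to \<open>0\<close> strongly, and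
  \<open>\<integral> \<theta> f\<^sub>k \<cdot> \<nabla>u\<^sub>k = - \<langle>div f\<^sub>k, \<theta> u\<^sub>k\<rangle> - \<integral> u\<^sub>k f\<^sub>k \<cdot> \<nabla>\<theta>\<close> tends to \<open>0\<close>, as \<open>\<theta> u\<^sub>k\<close> is a test function
  bounded in the Sobolev norm. A general test function is an average of test functions
  supported in small balls.\<close>

subsection \<open>Integral inequalities\<close>

text \<open>The obstacle is nonlocality: the potentials behind the fractional gradients depend on
  values far away, and only local weak convergence of the gradients is assumed. Localisation still
  works because a gradient remains a gradient on a ball, and subtracting the mean removes what the
  gradient does not control. The strong convergence of the mean-free potentials is a statement of
  Poincare-Rellich type. On a ball it follows from writing a function minus its mean as an average
  of its gradient along segments between points of the ball; convexity keeps the segments inside.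
  The approximants are smooth because an element of \<open>Wm1\<close> is tied to the divergence
  only through its values on test functions, and with \<open>u_k\<close> smooth the product
  \<open>\<theta> u_k\<close> is one of them. The norm bounds come from uniform boundedness, as weak
  convergence is given by testing with all functionals. The regularised kernel has two features that
  the singular one lacks: its potential is differentiable at the origin, and it is integrable over
  the whole space, so that the term with the constant \<open>\<psi> x\<close> can be split
  off.\<close>

lemma powr_add_le:
  fixes a b q :: real
  assumes "0 \<le> a" "0 \<le> b" "0 \<le> q"
  shows "(a + b) powr q \<le> 2 powr q * (a powr q + b powr q)"
proof -
  have "(a + b) powr q \<le> (2 * max a b) powr q"
    using assms by (intro powr_mono2) auto
  also have "\<dots> = 2 powr q * max a b powr q"
    using assms by (simp add: powr_mult)
  also have "max a b powr q \<le> a powr q + b powr q"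
    by (auto simp: max_def)
  finally show ?thesis by simp
qed

lemma norm_add_powr_le:
  fixes a b :: "'a::real_normed_vector"
  assumes "0 \<le> q"
  shows "norm (a + b) powr q \<le> 2 powr q * (norm a powr q + norm b powr q)"
proof -
  have "norm (a + b) powr q \<le> (norm a + norm b) powr q"
    using assms by (intro powr_mono2 norm_triangle_ineq) auto
  then show ?thesis using powr_add_le[of "norm a" "norm b" q] assms by simp
qed

lemma Holder_real:
  fixes a b :: "'a \<Rightarrow> real"
  assumes pq: "1 < p" "1 < q" "1 / p + 1 / q = 1"
    and [measurable]: "a \<in> borel_measurable M" "b \<in> borel_measurable M"
    and nn: "\<And>x. 0 \<le> a x" "\<And>x. 0 \<le> b x"
    and ia: "integrable M (\<lambda>x. a x powr p)" and ib: "integrable M (\<lambda>x. b x powr q)"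
  shows "integrable M (\<lambda>x. a x * b x)"
    and "(LINT x|M. a x * b x) \<le> (LINT x|M. a x powr p) powr (1/p) * (LINT x|M. b x powr q) powr (1/q)"
proof -
  have young: "a x * b x \<le> a x powr p / p + b x powr q / q" for x
    using Youngs_inequality[OF pq] nn by blast
  show int: "integrable M (\<lambda>x. a x * b x)"
  proof (rule Bochner_Integration.integrable_bound)
    show "integrable M (\<lambda>x. a x powr p / p + b x powr q / q)" using ia ib by auto
    show "AE x in M. norm (a x * b x) \<le> norm (a x powr p / p + b x powr q / q)"
      using young nn by (intro AE_I2) (smt (verit) mult_nonneg_nonneg real_norm_def)
  qed simp
  define A where "A = (LINT x|M. a x powr p) powr (1/p)"
  define B where "B = (LINT x|M. b x powr q) powr (1/q)"
  have A: "A powr p = (LINT x|M. a x powr p)" "A \<ge> 0"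
    using pq by (auto simp: A_def powr_powr intro!: Bochner_Integration.integral_nonneg)
  have B: "B powr q = (LINT x|M. b x powr q)" "B \<ge> 0"
    using pq by (auto simp: B_def powr_powr intro!: Bochner_Integration.integral_nonneg)
  \<comment> \<open>Normalising by \<open>A + e\<close> and \<open>B + e\<close> instead of
    \<open>A\<close> and \<open>B\<close> covers vanishing norms as well. Young's inequality for the
    normalised functions yields at most \<open>1/p + 1/q = 1\<close>; then \<open>e\<close> tends to
    0.\<close>
  have main: "(LINT x|M. a x * b x) \<le> (A + e) * (B + e)" if "e > 0" for e
  proof -
    have pos: "A + e > 0" "B + e > 0" using A B that by auto
    have "(LINT x|M. a x * b x) = (A + e) * (B + e) * (LINT x|M. (a x / (A+e)) * (b x / (B+e)))"
      using pos by simp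
    also have "(LINT x|M. (a x / (A+e)) * (b x / (B+e))) \<le>
        (LINT x|M. a x powr p / ((A+e) powr p * p) + b x powr q / ((B+e) powr q * q))"
    proof (rule integral_mono)
      show "integrable M (\<lambda>x. (a x / (A+e)) * (b x / (B+e)))" using int by simp
      show "integrable M (\<lambda>x. a x powr p / ((A+e) powr p * p) + b x powr q / ((B+e) powr q * q))"
        using ia ib by auto
      show "(a x / (A+e)) * (b x / (B+e)) \<le> a x powr p / ((A+e) powr p * p) + b x powr q / ((B+e) powr q * q)" for x
        using Youngs_inequality[OF pq, of "a x / (A+e)" "b x / (B+e)"] nn pos
        by (simp add: powr_divide)
    qed
    also have "\<dots> = A powr p / (A+e) powr p / p + B powr q / (B+e) powr q / q"
      using ia ib by (simp add: A B)
    also have "\<dots> \<le> 1 / p + 1 / q"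
      using pq pos A(2) B(2) that
      by (intro add_mono divide_right_mono) (auto simp: divide_le_eq_1 intro!: powr_mono2)
    finally show ?thesis using pos pq by (simp add: mult_left_le)
  qed
  have "((\<lambda>e. (A + e) * (B + e)) \<longlongrightarrow> (A + 0) * (B + 0)) (at_right 0)"
    by (intro tendsto_intros)
  moreover have "\<forall>\<^sub>F e in at_right 0. (LINT x|M. a x * b x) \<le> (A + e) * (B + e)"
    using main by (auto simp: eventually_at_filter)
  ultimately have "(LINT x|M. a x * b x) \<le> (A + 0) * (B + 0)"
    using tendsto_lowerbound trivial_limit_at_right_real by blast
  then show "(LINT x|M. a x * b x) \<le> (LINT x|M. a x powr p) powr (1/p) * (LINT x|M. b x powr q) powr (1/q)"
    by (simp add: A_def B_def)
qed

lemma Holder_inner: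
  fixes f g :: "'a \<Rightarrow> 'b::euclidean_space"
  assumes pq: "1 < p" "1 < q" "1 / p + 1 / q = 1"
    and [measurable]: "f \<in> borel_measurable M" "g \<in> borel_measurable M"
    and "integrable M (\<lambda>x. norm (f x) powr p)" "integrable M (\<lambda>x. norm (g x) powr q)"
  shows "integrable M (\<lambda>x. f x \<bullet> g x)"
    and "\<bar>LINT x|M. f x \<bullet> g x\<bar> \<le>
      (LINT x|M. norm (f x) powr p) powr (1/p) * (LINT x|M. norm (g x) powr q) powr (1/q)"
proof -
  note H = Holder_real[OF pq, of "\<lambda>x. norm (f x)" M "\<lambda>x. norm (g x)"]
  have 1: "integrable M (\<lambda>x. norm (f x) * norm (g x))"
    using assms by (intro H) auto
  show 2: "integrable M (\<lambda>x. f x \<bullet> g x)"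
    by (rule Bochner_Integration.integrable_bound[OF 1]) (auto simp: Cauchy_Schwarz_ineq2)
  have "\<bar>LINT x|M. f x \<bullet> g x\<bar> \<le> (LINT x|M. \<bar>f x \<bullet> g x\<bar>)"
    using integral_norm_bound[of M "\<lambda>x. f x \<bullet> g x"] by simp
  also have "\<dots> \<le> (LINT x|M. norm (f x) * norm (g x))"
    using 2 by (intro Bochner_Integration.integral_mono[OF _ 1]) (auto simp: Cauchy_Schwarz_ineq2)
  finally have "\<bar>LINT x|M. f x \<bullet> g x\<bar> \<le> (LINT x|M. norm (f x) * norm (g x))" .
  then show "\<bar>LINT x|M. f x \<bullet> g x\<bar> \<le>
      (LINT x|M. norm (f x) powr p) powr (1/p) * (LINT x|M. norm (g x) powr q) powr (1/q)"
    using H(2) assms by force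
qed

text \<open>Jensen's inequality for the power \<open>q\<close>, read off from Hoelder's inequality
  against the constant 1. The exponent \<open>q - 1\<close> of the total mass is
  \<open>q / p\<close> for the conjugate exponent \<open>p\<close>.\<close>

lemma norm_integral_powr_le:
  fixes f :: "'a \<Rightarrow> 'b::euclidean_space"
  assumes q: "1 < q" and fin: "finite_measure M"
    and [measurable]: "f \<in> borel_measurable M" and i: "integrable M (\<lambda>x. norm (f x) powr q)"
  shows "integrable M f"
    and "norm (LINT x|M. f x) powr q \<le> measure M (space M) powr (q - 1) * (LINT x|M. norm (f x) powr q)"
proof -
  define p where "p = q / (q - 1)"
  have pq: "1 < p" "1 / p + 1 / q = 1" using q by (auto simp: p_def field_simps)
  interpret finite_measure M by (rule fin)
  note H = Holder_real[OF pq(1) q pq(2), of "\<lambda>_. 1" M "\<lambda>x. norm (f x)"]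
  have "integrable M (\<lambda>x. norm (f x))" using H(1) i by simp
  then show "integrable M f" by (simp add: integrable_norm_iff)
  have "norm (LINT x|M. f x) \<le> (LINT x|M. norm (f x))" by simp
  also have "\<dots> \<le> measure M (space M) powr (1/p) * (LINT x|M. norm (f x) powr q) powr (1/q)"
    using H(2) i by simp
  finally have "norm (LINT x|M. f x) powr q \<le> (measure M (space M) powr (1/p) * (LINT x|M. norm (f x) powr q) powr (1/q)) powr q"
    using q by (intro powr_mono2) auto
  also have "\<dots> = measure M (space M) powr (q/p) * (LINT x|M. norm (f x) powr q)"
    using q by (simp add: powr_mult powr_powr Bochner_Integration.integral_nonneg)
  also have "q / p = q - 1" using q by (simp add: p_def)
  finally show "norm (LINT x|M. f x) powr q \<le> measure M (space M) powr (q - 1) * (LINT x|M. norm (f x) powr q)" .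
qed

text \<open>A quasi-triangle inequality for the \<open>q\<close>-th powers of the norms. Only
  boundedness and smallness are ever extracted from it, so the factor \<open>2 powr q\<close> is
  harmless.\<close>

lemma integrable_norm_powr_add:
  fixes f g :: "'a \<Rightarrow> 'b::euclidean_space"
  assumes "0 \<le> q" and [measurable]: "f \<in> borel_measurable M" "g \<in> borel_measurable M"
    and "integrable M (\<lambda>x. norm (f x) powr q)" "integrable M (\<lambda>x. norm (g x) powr q)"
  shows "integrable M (\<lambda>x. norm (f x + g x) powr q)"
    and "(LINT x|M. norm (f x + g x) powr q) \<le>
      2 powr q * ((LINT x|M. norm (f x) powr q) + (LINT x|M. norm (g x) powr q))"
proof -
  have i: "integrable M (\<lambda>x. 2 powr q * (norm (f x) powr q + norm (g x) powr q))"
    using assms by auto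
  show j: "integrable M (\<lambda>x. norm (f x + g x) powr q)"
    by (rule Bochner_Integration.integrable_bound[OF i]) (use norm_add_powr_le[OF assms(1)] in auto)
  have "(LINT x|M. norm (f x + g x) powr q) \<le> (LINT x|M. 2 powr q * (norm (f x) powr q + norm (g x) powr q))"
    by (rule integral_mono[OF j i]) (use norm_add_powr_le[OF assms(1)] in auto)
  then show "(LINT x|M. norm (f x + g x) powr q) \<le>
      2 powr q * ((LINT x|M. norm (f x) powr q) + (LINT x|M. norm (g x) powr q))"
    using assms by simp
qed

lemma integrable_norm_powr_diff:
  fixes f g :: "'a \<Rightarrow> 'b::euclidean_space"
  assumes "0 \<le> q" "f \<in> borel_measurable M" "g \<in> borel_measurable M"
    and "integrable M (\<lambda>x. norm (f x) powr q)" "integrable M (\<lambda>x. norm (g x) powr q)"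
  shows "integrable M (\<lambda>x. norm (f x - g x) powr q)"
    and "(LINT x|M. norm (f x - g x) powr q) \<le>
      2 powr q * ((LINT x|M. norm (f x) powr q) + (LINT x|M. norm (g x) powr q))"
  using integrable_norm_powr_add[of q f M "\<lambda>x. - g x"] assms by auto


subsection \<open>Uniform boundedness\<close>

text \<open>Gliding hump: the functional is a series of signed multiples of the \<open>l (\<kappa> j)\<close>, where the
  sign of each term is chosen so that its value at \<open>f (\<kappa> j)\<close> does not cancel.\<close>

primrec hump :: "(nat \<Rightarrow> 'v \<Rightarrow> real) \<Rightarrow> (nat \<Rightarrow> 'v) \<Rightarrow> nat \<Rightarrow> 'v \<Rightarrow> real" where
  "hump l f 0 = (\<lambda>_. 0)"
| "hump l f (Suc j) =
    (\<lambda>v. hump l f j v + (if hump l f j (f j) * l j (f j) \<ge> 0 then 1 else -1) * (1/3)^j * l j v)"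

text \<open>The norming functionals are data, one for each member of the sequence. If the values of
  \<open>N\<close> were unbounded, a signed geometric series of these functionals would define an
  element of the dual space that is unbounded along a subsequence.\<close>

lemma uniform_boundedness_dual_space:
  fixes f :: "nat \<Rightarrow> 'x \<Rightarrow> 'b::real_vector"
  assumes N: "\<And>v. v \<in> V \<Longrightarrow> 0 \<le> N v"
    and f: "\<And>k. f k \<in> V"
    and add: "\<And>v w. v \<in> V \<Longrightarrow> w \<in> V \<Longrightarrow> (\<lambda>x. v x + w x) \<in> V"
    and scale: "\<And>v c. v \<in> V \<Longrightarrow> (\<lambda>x. c *\<^sub>R v x) \<in> V"
    and l: "\<And>k. l k \<in> dual_space V N" "\<And>k v. v \<in> V \<Longrightarrow> \<bar>l k v\<bar> \<le> N v" "\<And>k. l k (f k) = N (f k)"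
    and bdd: "\<And>l. l \<in> dual_space V N \<Longrightarrow> bounded (range (\<lambda>k. l (f k)))"
  shows "\<exists>C. \<forall>k. N (f k) \<le> C"
proof (rule ccontr)
  assume "\<not> ?thesis"
  \<comment> \<open>The growth has to beat the weights \<open>(1/3)^j\<close> of the series:
    \<open>(4/3)^j\<close> is unbounded.\<close>
  then have "\<forall>j. \<exists>k. N (f k) > 4^j" by (metis linorder_not_le)
  then obtain \<kappa> :: "nat \<Rightarrow> nat" where \<kappa>: "\<And>j. N (f (\<kappa> j)) > 4^j" by metis
  define L where "L = hump (\<lambda>j. l (\<kappa> j)) (\<lambda>j. f (\<kappa> j))"
  have L0: "L 0 v = 0" for v by (simp add: L_def)
  have step: "\<bar>L (Suc j) v - L j v\<bar> \<le> (1/3)^j * N v" if "v \<in> V" for j v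
    using l(2)[OF that, of "\<kappa> j"] by (simp add: L_def abs_mult)
  \<comment> \<open>By the choice of the sign, the old partial sum and the new term do not have
    opposite signs at \<open>f (\<kappa> j)\<close>, so their absolute values add.\<close>
  have big: "\<bar>L (Suc j) (f (\<kappa> j))\<bar> \<ge> (1/3)^j * N (f (\<kappa> j))" for j
    using l(3)[of "\<kappa> j"] N[OF f[of "\<kappa> j"]] \<kappa>[of j]
    by (auto simp: L_def abs_if zero_le_mult_iff mult_less_0_iff not_le)
       (smt (verit) mult_nonneg_nonneg zero_le_power divide_nonneg_nonneg mult_neg_pos)+
  \<comment> \<open>The constant 3/2 is the sum of the geometric series of ratio 1/3; the factor
    \<open>1 - (1/3)^m\<close> is the exact partial sum and makes the induction close.\<close>
  have tail: "\<bar>L (j + m) v - L j v\<bar> \<le> (3/2) * (1/3)^j * N v * (1 - (1/3)^m)" if "v \<in> V" for j m v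
  proof (induction m)
    case (Suc m)
    have "\<bar>L (j + Suc m) v - L j v\<bar> \<le> \<bar>L (j + m) v - L j v\<bar> + (1/3)^(j+m) * N v"
      using step[OF that, of "j + m"] by simp
    also have "\<dots> \<le> (3/2) * (1/3)^j * N v * (1 - (1/3)^m) + (1/3)^(j+m) * N v"
      using Suc by simp
    also have "\<dots> = (3/2) * (1/3)^j * N v * (1 - (1/3)^Suc m)"
      by (simp add: power_add field_simps)
    finally show ?case .
  qed simp
  have tail': "\<bar>L (j + m) v - L j v\<bar> \<le> (3/2) * (1/3)^j * N v" if "v \<in> V" for j m v
  proof -
    have "(3/2) * (1/3)^j * N v * (1 - (1/3)^m) \<le> (3/2) * (1/3)^j * N v * 1"
      using N[OF that] by (intro mult_left_mono) auto
    then show ?thesis using tail[OF that, of j m] by linarith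
  qed
  have conv: "convergent (\<lambda>m. L m v)" if v: "v \<in> V" for v
  proof -
    have "summable (\<lambda>j. L (Suc j) v - L j v)"
    proof (rule summable_comparison_test')
      show "summable (\<lambda>j. (1/3)^j * N v)"
        by (intro summable_mult2 summable_geometric) simp
    qed (use step[OF v] in auto)
    moreover have "(\<Sum>i<n. L (Suc i) v - L i v) = L n v" for n
      using sum_lessThan_telescope[of "\<lambda>i. L i v" n] L0 by simp
    ultimately show ?thesis by (simp add: summable_iff_convergent del: sum_subtractf)
  qed
  define \<Lambda> where "\<Lambda> = (\<lambda>v. lim (\<lambda>m. L m v))"
  have lim: "(\<lambda>m. L m v) \<longlonglongrightarrow> \<Lambda> v" if "v \<in> V" for v
    using conv[OF that] by (simp add: \<Lambda>_def convergent_LIMSEQ_iff)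
  have near: "\<bar>\<Lambda> v - L j v\<bar> \<le> (3/2) * (1/3)^j * N v" if v: "v \<in> V" for v j
  proof -
    have "(\<lambda>m. \<bar>L (j + m) v - L j v\<bar>) \<longlonglongrightarrow> \<bar>\<Lambda> v - L j v\<bar>"
      using LIMSEQ_ignore_initial_segment[OF lim[OF v], of j]
      by (intro tendsto_intros) (simp add: add.commute)
    then show ?thesis using tail'[OF v] by (intro Lim_bounded) auto
  qed
  have Ladd: "L j (\<lambda>x. v x + w x) = L j v + L j w" if "v \<in> V" "w \<in> V" for j v w
  proof (induction j)
    case (Suc j)
    have "l (\<kappa> j) (\<lambda>x. v x + w x) = l (\<kappa> j) v + l (\<kappa> j) w"
      using l(1)[of "\<kappa> j"] that by (auto simp: dual_space_def)
    then show ?case using Suc by (simp add: L_def algebra_simps)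
  qed (simp add: L0)
  have Lscale: "L j (\<lambda>x. c *\<^sub>R v x) = c * L j v" if "v \<in> V" for j v c
  proof (induction j)
    case (Suc j)
    have "l (\<kappa> j) (\<lambda>x. c *\<^sub>R v x) = c * l (\<kappa> j) v"
      using l(1)[of "\<kappa> j"] that by (auto simp: dual_space_def)
    then show ?case using Suc by (simp add: L_def algebra_simps)
  qed (simp add: L0)
  have "\<Lambda> \<in> dual_space V N"
  proof -
    have "\<Lambda> (\<lambda>x. v x + w x) = \<Lambda> v + \<Lambda> w" if "v \<in> V" "w \<in> V" for v w
      using lim[OF add[OF that]] tendsto_add[OF lim[OF that(1)] lim[OF that(2)]]
      by (simp add: Ladd[OF that] LIMSEQ_unique)
    moreover have "\<Lambda> (\<lambda>x. c *\<^sub>R v x) = c * \<Lambda> v" if "v \<in> V" for v c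
      using lim[OF scale[OF that, of c]] tendsto_mult[OF tendsto_const[of c] lim[OF that]]
      unfolding Lscale[OF that] by (rule LIMSEQ_unique)
    moreover have "\<bar>\<Lambda> v\<bar> \<le> (3/2) * N v" if "v \<in> V" for v
      using near[OF that, of 0] L0 by simp
    ultimately show ?thesis unfolding dual_space_def by blast
  qed
  then obtain B where B: "\<And>k. \<bar>\<Lambda> (f k)\<bar> \<le> B"
    using bdd unfolding bounded_iff by (metis rangeI real_norm_def)
  \<comment> \<open>All terms after index \<open>j\<close> together weigh at most
    \<open>(3/2) * (1/3)^Suc j\<close>, half of the weight of term \<open>j\<close>; so at least
    half of that term survives in the limit functional.\<close>
  have le: "(1/2) * (4/3)^j \<le> B" for j
  proof -
    have "(1/3)^j * N (f (\<kappa> j)) \<le> \<bar>\<Lambda> (f (\<kappa> j))\<bar> + (3/2) * (1/3)^Suc j * N (f (\<kappa> j))"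
      using big[of j] near[OF f, of "\<kappa> j" "Suc j"] by linarith
    then have "(1/2) * ((1/3)^j * N (f (\<kappa> j))) \<le> B" using B[of "\<kappa> j"] by simp
    moreover have "(1/3)^j * 4^j \<le> (1/3)^j * N (f (\<kappa> j))"
      using \<kappa>[of j] by (intro mult_left_mono) auto
    ultimately show ?thesis by (simp add: power_mult_distrib[symmetric])
  qed
  obtain j where "2 * B < (4/3 :: real)^j"
    using real_arch_pow[of "4/3" "2 * B"] by auto
  with le[of j] show False by linarith
qed

subsection \<open>Smooth functions\<close>

definition smooth_fun :: "(real^'n::finite \<Rightarrow> real) \<Rightarrow> bool" where
  "smooth_fun f \<longleftrightarrow> (\<forall>js x. partials js f differentiable (at x))"

definition grad :: "(real^'n::finite \<Rightarrow> real) \<Rightarrow> real^'n \<Rightarrow> real^'n" where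
  "grad f x = (\<chi> j. partial j f x)"

lemma grad_nth [simp]: "grad f x $ j = partial j f x"
  by (simp add: grad_def)

lemma partial_eqI: "(f has_derivative f') (at x) \<Longrightarrow> partial j f x = f' (axis j 1)"
  unfolding partial_def by (metis frechet_derivative_at)

lemma has_derivative_grad:
  assumes "f differentiable (at x)"
  shows "(f has_derivative (\<lambda>h. grad f x \<bullet> h)) (at x)"
proof -
  let ?D = "frechet_derivative f (at x)"
  have D: "(f has_derivative ?D) (at x)" using assms frechet_derivative_works by blast
  then have lin: "linear ?D" by (simp add: has_derivative_linear)
  have "?D = (\<lambda>h. grad f x \<bullet> h)"
  proof
    fix h
    have "?D h = ?D (\<Sum>j\<in>UNIV. (h $ j) *\<^sub>R axis j 1)"
      using basis_expansion[of h] by (simp add: scalar_mult_eq_scaleR)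
    also have "\<dots> = (\<Sum>j\<in>UNIV. h $ j * ?D (axis j 1))"
      using lin by (simp add: linear_sum linear_scale)
    also have "\<dots> = grad f x \<bullet> h"
      by (simp add: inner_vec_def partial_def mult.commute)
    finally show "?D h = grad f x \<bullet> h" .
  qed
  then show ?thesis using D by simp
qed

lemma partials_snoc: "partials (js @ [j]) f = partials js (partial j f)"
  by (simp add: partials_def)

text \<open>By induction on the list, every iterated partial derivative of \<open>f\<close> stays in
  \<open>S\<close>. Smoothness of products, bump functions and correlations is proved by naming an
  invariant class, without formulas for higher derivatives.\<close>

lemma smooth_fun_coinduct:
  assumes "f \<in> S" and "\<And>g x. g \<in> S \<Longrightarrow> g differentiable (at x)"
    and "\<And>g j. g \<in> S \<Longrightarrow> partial j g \<in> S"
  shows "smooth_fun f"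
proof -
  have "partials js f \<in> S" for js
    using assms(1,3) by (induction js) (auto simp: partials_def)
  then show ?thesis using assms(2) by (auto simp: smooth_fun_def)
qed

lemma smooth_fun_differentiable: "smooth_fun f \<Longrightarrow> f differentiable (at x)"
  unfolding smooth_fun_def by (metis foldr.simps(1) id_apply partials_def)

lemma smooth_fun_partial: "smooth_fun f \<Longrightarrow> smooth_fun (partial j f)"
  unfolding smooth_fun_def by (metis partials_snoc)

lemma smooth_fun_continuous: "smooth_fun f \<Longrightarrow> continuous_on S f"
  by (meson continuous_at_imp_continuous_on differentiable_imp_continuous_within smooth_fun_differentiable)

lemma smooth_fun_continuous_grad: "smooth_fun f \<Longrightarrow> continuous_on S (grad f)"
  unfolding grad_def by (intro continuous_on_vec_lambda smooth_fun_continuous smooth_fun_partial)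

lemma smooth_fun_has_derivative: "smooth_fun f \<Longrightarrow> (f has_derivative (\<lambda>h. grad f x \<bullet> h)) (at x)"
  by (intro has_derivative_grad smooth_fun_differentiable)

lemma partial_const: "partial j (\<lambda>_. c) = (\<lambda>_. 0)"
  by (rule ext) (rule partial_eqI[OF has_derivative_const])

lemma smooth_fun_const [simp]: "smooth_fun (\<lambda>_. c)"
  by (rule smooth_fun_coinduct[of _ "range (\<lambda>c _. c)"]) (auto simp: partial_const)

lemma partial_add:
  assumes "f differentiable (at x)" "g differentiable (at x)"
  shows "partial j (\<lambda>x. f x + g x) x = partial j f x + partial j g x"
  using partial_eqI[OF has_derivative_add[OF assms[THEN has_derivative_grad]]]
  by (simp add: inner_axis)

lemma partial_mult:
  assumes "f differentiable (at x)" "g differentiable (at x)"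
  shows "partial j (\<lambda>x. f x * g x) x = partial j f x * g x + f x * partial j g x"
  using partial_eqI[OF has_derivative_mult[OF assms[THEN has_derivative_grad]]]
  by (simp add: inner_axis)

text \<open>The Leibniz rule leads from a product to a sum of products, and further differentiation
  does not leave the span of products. This is the invariant class for
  \<open>smooth_fun_coinduct\<close>.\<close>

inductive_set product_span :: "(real^'n::finite \<Rightarrow> real) set" where
  mult: "smooth_fun f \<Longrightarrow> smooth_fun g \<Longrightarrow> (\<lambda>x. f x * g x) \<in> product_span"
| add: "f \<in> product_span \<Longrightarrow> g \<in> product_span \<Longrightarrow> (\<lambda>x. f x + g x) \<in> product_span"

lemma product_span_differentiable: "f \<in> product_span \<Longrightarrow> f differentiable (at x)"
proof (induction rule: product_span.induct)
  case (mult f g)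
  then show ?case by (rule differentiable_mult[OF smooth_fun_differentiable smooth_fun_differentiable])
qed (rule differentiable_add)

lemma product_span_smooth_fun:
  assumes "f \<in> product_span"
  shows "smooth_fun f"
proof (rule smooth_fun_coinduct[OF assms product_span_differentiable])
  fix g :: "real^'n \<Rightarrow> real" and j
  assume "g \<in> product_span"
  then show "partial j g \<in> product_span"
  proof induction
    case (mult f g)
    then have "partial j (\<lambda>x. f x * g x) = (\<lambda>x. partial j f x * g x + f x * partial j g x)"
      by (intro ext partial_mult smooth_fun_differentiable)
    then show ?case using mult by (auto intro!: product_span.intros smooth_fun_partial)
  next
    case (add f g)
    then have "partial j (\<lambda>x. f x + g x) = (\<lambda>x. partial j f x + partial j g x)"
      by (intro ext partial_add product_span_differentiable)
    then show ?case using add by (auto intro!: product_span.intros)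
  qed
qed auto

lemma smooth_fun_mult: "smooth_fun f \<Longrightarrow> smooth_fun g \<Longrightarrow> smooth_fun (\<lambda>x. f x * g x)"
  by (rule product_span_smooth_fun[OF product_span.mult])

text \<open>Each summand is read as its product with the constant 1, which places it in
  \<open>product_span\<close>.\<close>

lemma smooth_fun_add: "smooth_fun f \<Longrightarrow> smooth_fun g \<Longrightarrow> smooth_fun (\<lambda>x. f x + g x)"
  using product_span_smooth_fun[OF product_span.add[OF
      product_span.mult[of f "\<lambda>_. 1", OF _ smooth_fun_const] product_span.mult[of g "\<lambda>_. 1", OF _ smooth_fun_const]]]
  by simp

lemma smooth_fun_cmult: "smooth_fun f \<Longrightarrow> smooth_fun (\<lambda>x. c * f x)"
  by (intro smooth_fun_mult) auto

lemma smooth_fun_diff: "smooth_fun f \<Longrightarrow> smooth_fun g \<Longrightarrow> smooth_fun (\<lambda>x. f x - g x)"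
  using smooth_fun_add[of f "\<lambda>x. (-1) * g x"] smooth_fun_cmult[of g "-1"] by simp

lemma smooth_fun_prod: "(\<And>i. i \<in> I \<Longrightarrow> smooth_fun (f i)) \<Longrightarrow> smooth_fun (\<lambda>x. \<Prod>i\<in>I. f i x)"
  by (induction I rule: infinite_finite_induct) (auto intro: smooth_fun_mult)

lemma grad_add:
  assumes "smooth_fun f" "smooth_fun g"
  shows "grad (\<lambda>x. f x + g x) x = grad f x + grad g x"
  using assms by (simp add: vec_eq_iff partial_add smooth_fun_differentiable)

lemma grad_mult:
  assumes "smooth_fun f" "smooth_fun g"
  shows "grad (\<lambda>x. f x * g x) x = g x *\<^sub>R grad f x + f x *\<^sub>R grad g x"
  using assms by (simp add: vec_eq_iff partial_mult smooth_fun_differentiable)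

lemma grad_const: "grad (\<lambda>_. c) x = 0"
  by (simp add: vec_eq_iff partial_const)

lemma grad_cmult:
  assumes "smooth_fun f"
  shows "grad (\<lambda>x. c * f x) x = c *\<^sub>R grad f x"
  using grad_mult[OF smooth_fun_const assms, of c x] by (simp add: grad_const)

lemma grad_diff:
  assumes "smooth_fun f" "smooth_fun g"
  shows "grad (\<lambda>x. f x - g x) x = grad f x - grad g x"
  using grad_add[OF assms(1) smooth_fun_cmult[OF assms(2), of "-1"], of x] grad_cmult[OF assms(2), of "-1" x]
  by simp

lemma has_derivative_translate:
  assumes "smooth_fun f"
  shows "((\<lambda>x. f (x + c)) has_derivative (\<lambda>h. grad f (x + c) \<bullet> h)) (at x)"
proof -
  have "((\<lambda>x. x + c) has_derivative (\<lambda>h. h)) (at x)" by (auto intro!: derivative_eq_intros)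
  from has_derivative_compose[OF this smooth_fun_has_derivative[OF assms]] show ?thesis .
qed

lemma partial_translate:
  assumes "smooth_fun f"
  shows "partial j (\<lambda>x. f (x + c)) x = partial j f (x + c)"
  using partial_eqI[OF has_derivative_translate[OF assms]] by (simp add: inner_axis)

lemma smooth_fun_translate:
  fixes f :: "real^'n::finite \<Rightarrow> real"
  assumes "smooth_fun f"
  shows "smooth_fun (\<lambda>x. f (x + c))"
proof (rule smooth_fun_coinduct[of _ "{(\<lambda>x. f (x + c)) |f. smooth_fun f}"])
  fix g :: "real^'n \<Rightarrow> real" and x j
  assume "g \<in> {(\<lambda>x. f (x + c)) |f. smooth_fun f}"
  then obtain f where f: "g = (\<lambda>x. f (x + c))" "smooth_fun f" by blast
  show "g differentiable (at x)"
    unfolding f differentiable_def using has_derivative_translate[OF f(2)] by blast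
  have "partial j g = (\<lambda>x. partial j f (x + c))"
    unfolding f by (intro ext partial_translate f)
  then show "partial j g \<in> {(\<lambda>x. f (x + c)) |f. smooth_fun f}"
    using smooth_fun_partial[OF f(2)] by blast
qed (use assms in auto)


subsection \<open>Bump functions\<close>

text \<open>The classical flat function \<open>exp (- 1 / t)\<close>, with a polynomial factor in
  \<open>1 / t\<close> so that the family is closed under differentiation, also at the
  origin.\<close>

definition flat :: "real poly \<Rightarrow> real \<Rightarrow> real" where
  "flat P t = (if t > 0 then poly P (1 / t) * exp (- 1 / t) else 0)"

text \<open>With \<open>u = 1 / t\<close>, the derivative of \<open>P(u) exp(-u)\<close> in
  \<open>t\<close> is \<open>u^2 (P(u) - P'(u)) exp(-u)\<close>, because \<open>u\<close> has
  derivative \<open>- u^2\<close>.\<close>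

definition flat_deriv :: "real poly \<Rightarrow> real poly" where
  "flat_deriv P = [:0, 0, 1:] * (P - pderiv P)"

text \<open>The power \<open>u ^ k\<close> is carried along for the induction on the polynomial:
  \<open>pCons a P\<close> splits into the constant \<open>a\<close> and \<open>u\<close> times
  \<open>P\<close>, which raises \<open>k\<close> by one.\<close>

lemma poly_times_exp_tendsto_0:
  fixes P :: "real poly"
  shows "((\<lambda>u. u ^ k * poly P u * exp (- u)) \<longlongrightarrow> 0) at_top"
proof (induction P arbitrary: k)
  case (pCons a P)
  have "((\<lambda>u::real. a * (u ^ k / exp u) + u ^ Suc k * poly P u * exp (- u)) \<longlongrightarrow> a * 0 + 0) at_top"
    by (intro tendsto_intros tendsto_power_div_exp_0 pCons.IH)
  then show ?case by (simp add: algebra_simps exp_minus field_simps)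
qed simp

lemma has_real_derivative_flat: "(flat P has_real_derivative flat (flat_deriv P) t) (at t)"
proof -
  consider "t > 0" | "t < 0" | "t = 0" by linarith
  then show ?thesis
  proof cases
    case 1
    have "((\<lambda>t. poly P (1 / t) * exp (- 1 / t)) has_real_derivative flat (flat_deriv P) t) (at t)"
      using 1 by (auto intro!: derivative_eq_intros DERIV_chain2[OF poly_DERIV]
          simp: flat_def flat_deriv_def field_simps power2_eq_square)
    then show ?thesis
      by (rule has_field_derivative_transform_within_open[of _ _ _ "{0<..}"]) (use 1 in \<open>auto simp: flat_def\<close>)
  next
    case 2
    have "((\<lambda>_. 0) has_real_derivative flat (flat_deriv P) t) (at t)"
      using 2 by (auto simp: flat_def)
    then show ?thesis
      by (rule has_field_derivative_transform_within_open[of _ _ _ "{..<0}"]) (use 2 in \<open>auto simp: flat_def\<close>)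
  next
    case 3
    \<comment> \<open>In the variable \<open>u = 1 / h\<close> the difference quotient is
      \<open>u * poly P u * exp (- u)\<close>, and \<open>u\<close> tends to infinity as
      \<open>h\<close> decreases to 0.\<close>
    have "((\<lambda>h. flat P h / h) \<longlongrightarrow> 0) (at_right 0)"
    proof -
      have "filterlim (\<lambda>h::real. 1 / h) at_top (at_right 0)"
        by (simp add: filterlim_inverse_at_top_right inverse_eq_divide[symmetric])
      then have "((\<lambda>h. (1/h) ^ 1 * poly P (1/h) * exp (- (1/h))) \<longlongrightarrow> 0) (at_right 0)"
        by (rule filterlim_compose[OF poly_times_exp_tendsto_0])
      then show ?thesis
        by (rule Lim_transform_eventually) (auto simp: eventually_at_filter flat_def)
    qed
    moreover have "((\<lambda>h. flat P h / h) \<longlongrightarrow> 0) (at_left 0)"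
      by (rule Lim_transform_eventually[of "\<lambda>_. 0"]) (auto simp: eventually_at_filter flat_def)
    ultimately have "((\<lambda>h. flat P h / h) \<longlongrightarrow> 0) (at 0)"
      by (simp add: filterlim_at_split)
    then show ?thesis unfolding 3 has_field_derivative_iff by (simp add: flat_def)
  qed
qed

lemma smooth_fun_flat:
  fixes i :: "'n::finite"
  shows "smooth_fun (\<lambda>x :: real^'n. flat P (a * x $ i + b))"
proof -
  \<comment> \<open>Constant multiples belong to the class because a partial derivative produces the
    inner factor \<open>a\<close>, or 0 in the other coordinates.\<close>
  define S where "S = {(\<lambda>x :: real^'n. c * flat P (a * x $ i + b)) |c P. True}"
  have deriv: "((\<lambda>x :: real^'n. c * flat P (a * x $ i + b)) has_derivative
      (\<lambda>h. c * (flat (flat_deriv P) (a * x $ i + b) * (a * h $ i)))) (at x)" for c P x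
  proof -
    have "((\<lambda>x :: real^'n. flat P (a * x $ i + b)) has_derivative
      (\<lambda>h. flat (flat_deriv P) (a * x $ i + b) * (a * h $ i))) (at x)"
      by (rule has_derivative_compose[of _ _ _ _ "flat P", OF _ has_real_derivative_flat[unfolded has_field_derivative_def]])
         (auto intro!: derivative_eq_intros bounded_linear_imp_has_derivative bounded_linear_vec_nth)
    then show ?thesis by (rule has_derivative_mult_right)
  qed
  show ?thesis
  proof (rule smooth_fun_coinduct[of _ S])
    show "(\<lambda>x. flat P (a * x $ i + b)) \<in> S"
      unfolding S_def by (rule CollectI, rule exI[of _ 1]) auto
    fix g :: "real^'n \<Rightarrow> real" and x j
    assume "g \<in> S"
    then obtain c P where g: "g = (\<lambda>x. c * flat P (a * x $ i + b))" unfolding S_def by blast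
    show "g differentiable (at x)" unfolding g differentiable_def using deriv by blast
    have "partial j g = (\<lambda>x. (c * a * axis j 1 $ i) * flat (flat_deriv P) (a * x $ i + b))"
      unfolding g by (rule ext, subst partial_eqI[OF deriv]) (simp add: algebra_simps)
    then show "partial j g \<in> S" unfolding S_def by blast
  qed
qed

text \<open>The parameter \<open>m\<close> sharpens the bump: \<open>exp (- 1 / (m t))\<close> tends
  to 1 for every \<open>t > 0\<close>, so integrals over boxes are limits of integrals against test
  functions supported in the closed box.\<close>

definition box_bump :: "real \<Rightarrow> real^'n::finite \<Rightarrow> real^'n \<Rightarrow> real^'n \<Rightarrow> real" where
  "box_bump m a b x = (\<Prod>i\<in>UNIV. flat 1 (m * (x $ i - a $ i)) * flat 1 (m * (b $ i - x $ i)))"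

lemma flat_1: "0 \<le> flat 1 t" "flat 1 t \<le> 1" "0 < t \<Longrightarrow> 0 < flat 1 t"
  by (auto simp: flat_def)

lemma box_bump_bounds: "0 \<le> box_bump m a b x" "box_bump m a b x \<le> 1"
  unfolding box_bump_def by (auto intro!: prod_nonneg prod_le_1 mult_le_one simp: flat_1)

lemma box_bump_outside:
  assumes "m > 0" "x \<notin> box a b"
  shows "box_bump m a b x = 0"
proof -
  obtain i where "\<not> (a $ i < x $ i \<and> x $ i < b $ i)"
    using assms by (auto simp: mem_box_cart)
  then have "flat 1 (m * (x $ i - a $ i)) * flat 1 (m * (b $ i - x $ i)) = 0"
    using assms(1) by (auto simp: flat_def zero_less_mult_iff)
  then show ?thesis unfolding box_bump_def by (intro prod_zero) auto
qed

lemma box_bump_inside: "m > 0 \<Longrightarrow> x \<in> box a b \<Longrightarrow> 0 < box_bump m a b x"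
  by (auto simp: box_bump_def mem_box_cart intro!: prod_pos mult_pos_pos flat_1)

lemma smooth_fun_box_bump:
  fixes a b :: "real^'n::finite"
  shows "smooth_fun (box_bump m a b)"
proof -
  have "smooth_fun (\<lambda>x :: real^'n. \<Prod>i\<in>UNIV. flat 1 (m * x $ i + (- m * a $ i)) * flat 1 ((- m) * x $ i + m * b $ i))"
    by (intro smooth_fun_prod smooth_fun_mult smooth_fun_flat)
  then show ?thesis unfolding box_bump_def[abs_def] by (simp add: algebra_simps)
qed

lemma box_bump_tendsto:
  "(\<lambda>m. box_bump (real (Suc m)) a b x) \<longlonglongrightarrow> indicator (box a b) x"
proof (cases "x \<in> box a b")
  case True
  have flat: "(\<lambda>m. flat 1 (real (Suc m) * t)) \<longlonglongrightarrow> 1" if "t > 0" for t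
  proof -
    have "(\<lambda>m. exp (- (1 / t) * inverse (real (Suc m)))) \<longlonglongrightarrow> exp (- (1 / t) * 0)"
      by (intro tendsto_intros LIMSEQ_inverse_real_of_nat)
    moreover have "flat 1 (real (Suc m) * t) = exp (- (1 / t) * inverse (real (Suc m)))" for m
      using that by (simp add: flat_def zero_less_mult_iff field_simps del: of_nat_Suc)
    ultimately show ?thesis by simp
  qed
  have "(\<lambda>m. box_bump (real (Suc m)) a b x) \<longlonglongrightarrow> (\<Prod>i\<in>(UNIV::'a set). 1 * 1)"
    unfolding box_bump_def
    using True by (intro tendsto_intros flat) (auto simp: mem_box_cart)
  then show ?thesis using True by simp
qed (simp add: box_bump_outside)


subsection \<open>Test functions\<close>

lemma test_functions_iff:
  "\<phi> \<in> test_functions U \<longleftrightarrow>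
    smooth_fun \<phi> \<and> compact (closure {x. \<phi> x \<noteq> 0}) \<and> closure {x. \<phi> x \<noteq> 0} \<subseteq> U"
  by (simp add: test_functions_def smooth_fun_def)

text \<open>Together with \<open>test_functionsE\<close> this replaces the closure of the support by
  any compact set outside which the function vanishes.\<close>

lemma test_functionsI:
  assumes "smooth_fun \<phi>" "compact K" "K \<subseteq> U" "\<And>x. x \<notin> K \<Longrightarrow> \<phi> x = 0"
  shows "\<phi> \<in> test_functions U"
proof -
  have "closure {x. \<phi> x \<noteq> 0} \<subseteq> K"
    using assms by (intro closure_minimal) (auto simp: compact_imp_closed)
  moreover from this have "compact (closure {x. \<phi> x \<noteq> 0})"
    using assms(2) by (metis bounded_subset closed_closure compact_eq_bounded_closed)
  ultimately show ?thesis using assms by (auto simp: test_functions_iff)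
qed

lemma test_functionsE:
  assumes "\<phi> \<in> test_functions U"
  obtains K where "smooth_fun \<phi>" "compact K" "K \<subseteq> U" "\<And>x. x \<notin> K \<Longrightarrow> \<phi> x = 0"
proof (rule that[of "closure {x. \<phi> x \<noteq> 0}"])
  show "\<phi> x = 0" if "x \<notin> closure {x. \<phi> x \<noteq> 0}" for x
    using closure_subset[of "{x. \<phi> x \<noteq> 0}"] that by (metis (mono_tags, lifting) mem_Collect_eq subsetD)
qed (use assms in \<open>auto simp: test_functions_iff\<close>)

lemma test_functions_mono: "\<phi> \<in> test_functions U \<Longrightarrow> U \<subseteq> U' \<Longrightarrow> \<phi> \<in> test_functions U'"
  by (auto simp: test_functions_iff)

lemma test_functions_smooth: "\<phi> \<in> test_functions U \<Longrightarrow> smooth_fun \<phi>"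
  by (simp add: test_functions_iff)

lemma partial_eq_0_outside:
  assumes "closed K" "\<And>x. x \<notin> K \<Longrightarrow> f x = 0" "x \<notin> K"
  shows "partial j f x = 0"
proof -
  have "((\<lambda>_. 0 :: real) has_derivative (\<lambda>_. 0)) (at x)" by simp
  then have "(f has_derivative (\<lambda>_. 0)) (at x)"
    by (rule has_derivative_transform_within_open[of _ _ _ _ "- K"]) (use assms in auto)
  from partial_eqI[OF this] show ?thesis .
qed

lemma test_functions_partial:
  assumes "\<phi> \<in> test_functions U"
  shows "partial j \<phi> \<in> test_functions U"
proof -
  obtain K where K: "smooth_fun \<phi>" "compact K" "K \<subseteq> U" "\<And>x. x \<notin> K \<Longrightarrow> \<phi> x = 0"
    by (rule test_functionsE[OF assms]) blast
  show ?thesis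
    using K by (intro test_functionsI[of _ K] smooth_fun_partial partial_eq_0_outside[of K])
      (auto simp: compact_imp_closed)
qed

lemma test_functions_mult:
  assumes "\<phi> \<in> test_functions U" "smooth_fun f"
  shows "(\<lambda>x. \<phi> x * f x) \<in> test_functions U"
proof -
  obtain K where K: "smooth_fun \<phi>" "compact K" "K \<subseteq> U" "\<And>x. x \<notin> K \<Longrightarrow> \<phi> x = 0"
    by (rule test_functionsE[OF assms(1)]) blast
  then show ?thesis using assms(2) by (intro test_functionsI[of _ K] smooth_fun_mult) auto
qed

lemma test_functions_diff:
  assumes "\<phi> \<in> test_functions U" "\<psi> \<in> test_functions U"
  shows "(\<lambda>x. \<phi> x - \<psi> x) \<in> test_functions U"
proof -
  obtain K where K: "smooth_fun \<phi>" "compact K" "K \<subseteq> U" "\<And>x. x \<notin> K \<Longrightarrow> \<phi> x = 0"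
    by (rule test_functionsE[OF assms(1)]) blast
  obtain L where L: "smooth_fun \<psi>" "compact L" "L \<subseteq> U" "\<And>x. x \<notin> L \<Longrightarrow> \<psi> x = 0"
    by (rule test_functionsE[OF assms(2)]) blast
  show ?thesis using K L by (intro test_functionsI[of _ "K \<union> L"] smooth_fun_diff) auto
qed

lemma test_functions_bounded:
  assumes "\<phi> \<in> test_functions U"
  obtains C where "C > 0" "\<And>x. \<bar>\<phi> x\<bar> \<le> C"
proof -
  obtain K where K: "smooth_fun \<phi>" "compact K" "K \<subseteq> U" "\<And>x. x \<notin> K \<Longrightarrow> \<phi> x = 0"
    by (rule test_functionsE[OF assms]) blast
  have "bounded (\<phi> ` K)"
    using K by (intro compact_imp_bounded compact_continuous_image smooth_fun_continuous)
  then obtain C where C: "C > 0" "\<And>x. x \<in> K \<Longrightarrow> \<bar>\<phi> x\<bar> \<le> C"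
    by (auto simp: bounded_pos)
  have "\<bar>\<phi> x\<bar> \<le> C" for x using C K(4)[of x] by (cases "x \<in> K") auto
  with C that show ?thesis by blast
qed

lemma test_functions_grad_bounded:
  assumes "\<phi> \<in> test_functions U"
  obtains C where "C > 0" "\<And>x. norm (grad \<phi> x) \<le> C"
proof -
  obtain K where K: "smooth_fun \<phi>" "compact K" "K \<subseteq> U" "\<And>x. x \<notin> K \<Longrightarrow> \<phi> x = 0"
    by (rule test_functionsE[OF assms]) blast
  have "bounded (grad \<phi> ` K)"
    using K by (intro compact_imp_bounded compact_continuous_image smooth_fun_continuous_grad)
  then obtain C where C: "C > 0" "\<And>x. x \<in> K \<Longrightarrow> norm (grad \<phi> x) \<le> C"
    by (auto simp: bounded_pos)
  have "grad \<phi> x = 0" if "x \<notin> K" for x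
    using partial_eq_0_outside[of K \<phi> x] K that by (simp add: vec_eq_iff compact_imp_closed)
  then have "norm (grad \<phi> x) \<le> C" for x using C by (cases "x \<in> K") auto
  with C that show ?thesis by blast
qed

lemma box_bump_test_function: "m > 0 \<Longrightarrow> cbox a b \<subseteq> U \<Longrightarrow> box_bump m a b \<in> test_functions U"
  by (rule test_functionsI[OF smooth_fun_box_bump compact_cbox])
     (use box_subset_cbox box_bump_outside in blast)+

subsection \<open>Lebesgue integration on Euclidean space\<close>

text \<open>Used for translations, for the reflection \<open>c = -1\<close>, and for the
  contractions of a ball towards one of its points, where the factor
  \<open>\<bar>c\<bar> ^ DIM('a)\<close> is the Jacobian.\<close>

lemma lborel_integral_affine:
  fixes f :: "'a::euclidean_space \<Rightarrow> 'b::{banach, second_countable_topology}"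
  assumes [measurable]: "f \<in> borel_measurable borel" and "c \<noteq> 0"
  shows "(LINT x|lborel. f x) = \<bar>c\<bar> ^ DIM('a) *\<^sub>R (LINT x|lborel. f (t + c *\<^sub>R x))"
    and "integrable lborel (\<lambda>x. f (t + c *\<^sub>R x)) \<longleftrightarrow> integrable lborel f"
proof -
  have L: "lborel = density (distr lborel borel (\<lambda>x. t + c *\<^sub>R x)) (\<lambda>_. ennreal (\<bar>c\<bar> ^ DIM('a)))"
    using lborel_affine[OF assms(2), of t] by (simp add: ennreal_power[symmetric])
  show "(LINT x|lborel. f x) = \<bar>c\<bar> ^ DIM('a) *\<^sub>R (LINT x|lborel. f (t + c *\<^sub>R x))"
    by (subst L) (simp add: integral_density integral_distr)
  have "integrable lborel f \<longleftrightarrow> integrable (density (distr lborel borel (\<lambda>x. t + c *\<^sub>R x)) (\<lambda>_. ennreal (\<bar>c\<bar> ^ DIM('a)))) f"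
    using L by simp
  also have "\<dots> \<longleftrightarrow> integrable lborel (\<lambda>x. f (t + c *\<^sub>R x))"
    using assms(2) integrable_scaleR_right[of "inverse (\<bar>c\<bar> ^ DIM('a))" lborel "\<lambda>x. \<bar>c\<bar> ^ DIM('a) *\<^sub>R f (t + c *\<^sub>R x)"]
    by (auto simp: integrable_density integrable_distr_eq)
  finally show "integrable lborel (\<lambda>x. f (t + c *\<^sub>R x)) \<longleftrightarrow> integrable lborel f" by simp
qed

lemma lborel_integral_translate:
  fixes f :: "'a::euclidean_space \<Rightarrow> 'b::{banach, second_countable_topology}"
  assumes "f \<in> borel_measurable borel"
  shows "(LINT x|lborel. f (x + t)) = (LINT x|lborel. f x)"
    and "integrable lborel (\<lambda>x. f (x + t)) \<longleftrightarrow> integrable lborel f"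
  using lborel_integral_affine[OF assms, of 1 t] by (simp_all add: add.commute)

lemma emeasure_lborel_cball_less_top: "emeasure lborel (cball (c::'a::euclidean_space) r) < top"
  using emeasure_bounded_finite[OF bounded_cball, of c r] by simp

lemma integrable_bounded_support:
  fixes f :: "'a::euclidean_space \<Rightarrow> 'b::{banach, second_countable_topology}"
  assumes "f \<in> borel_measurable borel" "bounded K" "\<And>x. x \<notin> K \<Longrightarrow> f x = 0" "\<And>x. norm (f x) \<le> C"
  shows "integrable lborel f"
proof -
  obtain R where R: "\<And>x. x \<in> K \<Longrightarrow> norm x \<le> R" using assms(2) by (auto simp: bounded_iff)
  then have "f x = 0" if "x \<notin> cball 0 R" for x using assms(3) that R by auto
  then show ?thesis using assms(1,4)
    by (intro integrableI_bounded_set[of "cball 0 R" _ _ C]) (auto simp: emeasure_lborel_cball_less_top)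
qed

lemma borel_measurable_lebesgue_onI:
  "f \<in> borel_measurable borel \<Longrightarrow> f \<in> borel_measurable (lebesgue_on U)"
  by (simp add: measurable_completion measurable_restrict_space1)

lemma integrable_lborel_imp_lebesgue_on:
  fixes f :: "'a::euclidean_space \<Rightarrow> 'b::{banach, second_countable_topology}"
  assumes "integrable lborel f" "U \<in> sets lebesgue"
  shows "integrable (lebesgue_on U) f"
  using assms by (simp add: integrable_restrict_space integrable_completion integrable_mult_indicator)

text \<open>Boxes form an intersection-stable generator of the Borel sets, so a Dynkin argument
  extends the vanishing of the integral to all Borel sets. It is carried out for a Borel
  representative of \<open>h\<close>.\<close>

lemma AE_eq_0_if_integral_box_eq_0:
  fixes h :: "'a::euclidean_space \<Rightarrow> real"
  assumes h: "integrable lebesgue h" and 0: "\<And>a b. (LINT x|lebesgue. indicator (box a b) x * h x) = 0"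
  shows "AE x in lebesgue. h x = 0"
proof -
  have hm: "h \<in> borel_measurable lebesgue" using h by simp
  then obtain h' where h': "h' \<in> borel_measurable lborel" "AE x in lborel. h x = h' x"
    using completion_ex_borel_measurable_real by blast
  have [measurable]: "h' \<in> borel_measurable borel" using h'(1) by simp
  have ae: "AE x in lebesgue. h x = h' x" using h'(2) by (rule AE_completion)
  have "integrable lebesgue h'"
    using h ae hm by (subst integrable_cong_AE[of _ _ h]) (auto simp: measurable_completion elim: eventually_mono)
  then have int: "integrable lborel h'" by (simp add: integrable_completion)
  have box: "(LINT x:box a b|lborel. h' x) = 0" for a b
  proof -
    have "(LINT x:box a b|lborel. h' x) = (LINT x|lebesgue. indicator (box a b) x * h' x)"
      unfolding set_lebesgue_integral_def by (subst integral_completion) auto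
    also have "\<dots> = (LINT x|lebesgue. indicator (box a b) x * h x)"
    proof (rule integral_cong_AE)
      show "(\<lambda>x. indicator (box a b) x * h x) \<in> borel_measurable lebesgue"
        using hm by (intro borel_measurable_times borel_measurable_indicator) auto
    qed (use ae in \<open>auto simp: measurable_completion elim: eventually_mono\<close>)
    finally show ?thesis using 0 by simp
  qed
  \<comment> \<open>The complement step of the Dynkin argument needs the integral over the whole
    space, here exhausted by boxes.\<close>
  have all: "(LINT x|lborel. h' x) = 0"
  proof -
    have "(\<lambda>n. LINT x:box (- real n *\<^sub>R One) (real n *\<^sub>R One)|lborel. h' x) \<longlonglongrightarrow> (LINT x|lborel. h' x)"
      unfolding set_lebesgue_integral_def
    proof (rule integral_dominated_convergence[where w = "\<lambda>x. \<bar>h' x\<bar>"])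
      show "AE x in lborel. (\<lambda>n. indicat_real (box (- real n *\<^sub>R One) (real n *\<^sub>R One)) x *\<^sub>R h' x) \<longlonglongrightarrow> h' x"
      proof (rule AE_I2)
        fix x :: 'a
        have "(\<lambda>n. indicat_real (box (- real n *\<^sub>R One) (real n *\<^sub>R One)) x)
            \<longlonglongrightarrow> indicator (\<Union>n::nat. box (- real n *\<^sub>R One) (real n *\<^sub>R One)) x"
          by (intro LIMSEQ_indicator_incseq) (auto simp: incseq_def box_def)
        then have "(\<lambda>n. indicat_real (box (- real n *\<^sub>R One) (real n *\<^sub>R One)) x) \<longlonglongrightarrow> 1"
          by (simp add: UN_box_eq_UNIV)
        from tendsto_scaleR[OF this tendsto_const[of "h' x"]]
        show "(\<lambda>n. indicat_real (box (- real n *\<^sub>R One) (real n *\<^sub>R One)) x *\<^sub>R h' x) \<longlonglongrightarrow> h' x" by simp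
      qed
    qed (use int in \<open>auto simp: indicator_def\<close>)
    then show ?thesis unfolding box by (simp add: LIMSEQ_const_iff)
  qed
  have "(LINT x:A|lborel. h' x) = 0" if A: "A \<in> sets lborel" for A
  proof -
    have "Int_stable (range (\<lambda>(a, b). box a b :: 'a set))"
      by (auto simp: Int_stable_def box_Int_box)
    moreover have "range (\<lambda>(a, b). box a b :: 'a set) \<subseteq> Pow UNIV" by auto
    moreover have "A \<in> sigma_sets UNIV (range (\<lambda>(a, b). box a b))"
      using A unfolding sets_lborel borel_eq_box by simp
    ultimately show ?thesis
    proof (induction rule: sigma_sets_induct_disjoint)
      case (basic A) then show ?case using box by auto
    next
      case empty then show ?case by (simp add: set_lebesgue_integral_def)
    next
      case (compl A)
      then have [measurable]: "A \<in> sets borel" by (simp add: borel_eq_box)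
      have "(LINT x:UNIV - A|lborel. h' x) = (LINT x|lborel. h' x - indicator A x *\<^sub>R h' x)"
        unfolding set_lebesgue_integral_def by (intro Bochner_Integration.integral_cong) (auto simp: indicator_def)
      also have "\<dots> = (LINT x|lborel. h' x) - (LINT x:A|lborel. h' x)"
        unfolding set_lebesgue_integral_def using int
        by (intro Bochner_Integration.integral_diff integrable_mult_indicator) auto
      finally show ?case using all compl by simp
    next
      case (union F)
      then have [measurable]: "\<And>i. F i \<in> sets borel" by (auto simp: borel_eq_box subset_eq)
      have "set_integrable lborel (\<Union>i. F i) h'"
        unfolding set_integrable_def using int by (intro integrable_mult_indicator) auto
      then show ?case
        using union by (subst lebesgue_integral_countable_add) (auto simp: disjoint_family_on_def)
    qed
  qed
  then have "AE x in lborel. h' x = 0" using int by (intro sigma_finite_measure.density_zero[OF sigma_finite_lborel]) auto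
  then have "AE x in lebesgue. h' x = 0" by (rule AE_completion)
  then show ?thesis using ae by eventually_elim simp
qed

text \<open>The bumps of a box are bounded by 1 and converge to its indicator, so dominated
  convergence transfers the hypothesis from test functions to boxes.\<close>

lemma fundamental_lemma_calculus_of_variations:
  fixes g :: "real^'n::finite \<Rightarrow> real"
  assumes g: "\<And>a b. integrable (lebesgue_on (box a b)) g"
    and 0: "\<And>\<phi>. \<phi> \<in> test_functions UNIV \<Longrightarrow> (LINT x|lebesgue. \<phi> x * g x) = 0"
  shows "AE x in lebesgue. g x = 0"
proof -
  have gi: "integrable lebesgue (\<lambda>x. indicator (box a b) x * g x)" for a b
    using g[of a b] by (simp add: integrable_restrict_space)
  have box0: "(LINT x|lebesgue. indicator (box a b) x * g x) = 0" for a b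
  proof -
    have "(\<lambda>m. LINT x|lebesgue. box_bump (real (Suc m)) a b x * (indicator (box a b) x * g x))
        \<longlonglongrightarrow> (LINT x|lebesgue. indicator (box a b) x * (indicator (box a b) x * g x))"
    proof (rule integral_dominated_convergence[where w = "\<lambda>x. \<bar>indicator (box a b) x * g x\<bar>"])
      have "box_bump (real (Suc m)) a b \<in> borel_measurable lebesgue" for m
        using borel_measurable_continuous_onI[OF smooth_fun_continuous[OF smooth_fun_box_bump]]
        by (intro measurable_completion) simp
      then show "(\<lambda>x. box_bump (real (Suc m)) a b x * (indicator (box a b) x * g x)) \<in> borel_measurable lebesgue" for m
        by (rule borel_measurable_times[OF _ borel_measurable_integrable[OF gi]])
      show "(\<lambda>x. indicat_real (box a b) x * (indicator (box a b) x * g x)) \<in> borel_measurable lebesgue"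
        by (rule borel_measurable_times[OF borel_measurable_indicator borel_measurable_integrable[OF gi]]) simp
      show "AE x in lebesgue. (\<lambda>m. box_bump (real (Suc m)) a b x * (indicator (box a b) x * g x))
          \<longlonglongrightarrow> indicator (box a b) x * (indicator (box a b) x * g x)"
        by (intro AE_I2 tendsto_mult box_bump_tendsto tendsto_const)
      show "AE x in lebesgue. norm (box_bump (real (Suc m)) a b x * (indicator (box a b) x * g x))
          \<le> \<bar>indicator (box a b) x * g x\<bar>" for m
        by (intro AE_I2) (auto simp: abs_mult box_bump_bounds intro!: mult_left_le_one_le)
    qed (use gi in auto)
    moreover have "(LINT x|lebesgue. box_bump (real (Suc m)) a b x * (indicator (box a b) x * g x)) = 0" for m
    proof -
      have "box_bump (real (Suc m)) a b x * (indicator (box a b) x * g x) = box_bump (real (Suc m)) a b x * g x" for x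
        using box_bump_outside[of "real (Suc m)" x a b] by (cases "x \<in> box a b") auto
      then show ?thesis using 0[OF box_bump_test_function[of "real (Suc m)" a b UNIV]] by (simp only: of_nat_0_less_iff zero_less_Suc subset_UNIV simp_thms)
    qed
    ultimately have "(LINT x|lebesgue. indicator (box a b) x * (indicator (box a b) x * g x)) = 0"
      by (simp add: LIMSEQ_const_iff)
    then show ?thesis by (simp add: mult.assoc[symmetric] indicator_inter_arith[symmetric])
  qed
  \<comment> \<open>\<open>g\<close> is integrable only locally, so the box criterion is applied to
    its restriction to one box at a time; the intersection of two boxes is again a box.\<close>
  have AE: "AE x in lebesgue. indicator (box a b) x * g x = 0" for a b
  proof (rule AE_eq_0_if_integral_box_eq_0[OF gi])
    fix c d :: "real^'n"
    obtain a' b' where ab: "box c d \<inter> box a b = box a' b'" using box_Int_box by blast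
    have "(LINT x|lebesgue. indicator (box c d) x * (indicator (box a b) x * g x)) =
      (LINT x|lebesgue. indicator (box a' b') x * g x)"
      by (simp add: mult.assoc[symmetric] indicator_inter_arith[symmetric] ab)
    then show "(LINT x|lebesgue. indicator (box c d) x * (indicator (box a b) x * g x)) = 0"
      using box0 by simp
  qed
  have "AE x in lebesgue. \<forall>n::nat. indicator (box (- real n *\<^sub>R One) (real n *\<^sub>R One)) x * g x = 0"
    by (subst AE_all_countable) (intro allI AE)
  then show ?thesis
  proof eventually_elim
    case (elim x)
    have "x \<in> (\<Union>n::nat. box (- real n *\<^sub>R One) (real n *\<^sub>R One))" by (simp add: UN_box_eq_UNIV)
    then obtain n where "x \<in> box (- real n *\<^sub>R One) (real n *\<^sub>R One)" by blast
    then show ?case using elim[rule_format, of n] by simp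
  qed
qed


subsection \<open>Integration by parts\<close>

lemma Lipschitz_of_grad_bounded:
  assumes "\<And>x. f differentiable (at x)" "\<And>x. norm (grad f x) \<le> B"
  shows "\<bar>f y - f x\<bar> \<le> B * norm (y - x)"
proof -
  have "norm (f y - f x) \<le> B * norm (y - x)"
  proof (rule differentiable_bound[of UNIV f "\<lambda>x h. grad f x \<bullet> h"])
    show "(f has_derivative (\<lambda>h. grad f x \<bullet> h)) (at x within UNIV)" for x
      using has_derivative_grad[OF assms(1)] by simp
    show "onorm (\<lambda>h. grad f x \<bullet> h) \<le> B" for x
    proof (rule onorm_le)
      show "norm (grad f x \<bullet> h) \<le> B * norm h" for h
        using Cauchy_Schwarz_ineq2[of "grad f x" h] mult_right_mono[OF assms(2)[of x], of "norm h"] by simp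
    qed
  qed auto
  then show ?thesis by simp
qed

text \<open>Translation invariance makes the integral of every difference quotient vanish. The
  quotients are bounded by the maximal slope and supported in one ball, hence the limit may be taken
  under the integral.\<close>

lemma integral_partial_eq_0:
  fixes f :: "real^'n::finite \<Rightarrow> real"
  assumes f: "\<And>x. f differentiable (at x)" and c: "continuous_on UNIV (grad f)"
    and 0: "compact K" "\<And>x. x \<notin> K \<Longrightarrow> f x = 0"
  shows "(LINT x|lborel. partial j f x) = 0"
proof -
  define e :: "real^'n" where "e = axis j 1"
  have ne: "norm e = 1" by (simp add: e_def)
  have cf: "continuous_on UNIV f"
    using f by (meson continuous_at_imp_continuous_on differentiable_imp_continuous_within)
  have "bounded (grad f ` K)"
    using 0 c by (intro compact_imp_bounded compact_continuous_image) (auto intro: continuous_on_subset)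
  then obtain B where B: "B > 0" "\<And>x. x \<in> K \<Longrightarrow> norm (grad f x) \<le> B"
    by (auto simp: bounded_pos)
  have "grad f x = 0" if "x \<notin> K" for x
    using partial_eq_0_outside[of K f x] 0 that by (simp add: vec_eq_iff compact_imp_closed)
  then have B': "norm (grad f x) \<le> B" for x using B by (cases "x \<in> K") auto
  obtain R where R: "\<And>x. x \<in> K \<Longrightarrow> norm x \<le> R"
    using compact_imp_bounded[OF 0(1)] by (auto simp: bounded_iff)
  define t where "t n = inverse (real (Suc n))" for n
  have t: "0 < t n" "t n \<le> 1" for n by (auto simp: t_def field_simps)
  have tl: "t \<longlonglongrightarrow> 0" unfolding t_def by (rule LIMSEQ_inverse_real_of_nat)
  have fi: "integrable lborel f"
  proof -
    have "bounded (f ` K)"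
      using 0 cf by (intro compact_imp_bounded compact_continuous_image) (auto intro: continuous_on_subset)
    then obtain C where C: "C > 0" "\<And>x. x \<in> K \<Longrightarrow> \<bar>f x\<bar> \<le> C"
      by (auto simp: bounded_pos)
    have "norm (f x) \<le> C" for x using C 0(2)[of x] by (cases "x \<in> K") auto
    then show ?thesis using 0 cf
      by (intro integrable_bounded_support[of f K C] borel_measurable_continuous_onI compact_imp_bounded)
  qed
  have [measurable]: "f \<in> borel_measurable borel" using cf by (rule borel_measurable_continuous_onI)
  have "(\<lambda>n. LINT x|lborel. (f (x + t n *\<^sub>R e) - f x) / t n) \<longlonglongrightarrow> (LINT x|lborel. partial j f x)"
  proof (rule integral_dominated_convergence[where w = "\<lambda>x. B * indicator (cball 0 (R + 1)) x"])
    have "continuous_on UNIV (\<lambda>x. grad f x $ j)" using c by (intro continuous_intros)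
    then show "partial j f \<in> borel_measurable lborel"
      by (simp add: borel_measurable_continuous_onI)
    show "integrable lborel (\<lambda>x. B * indicat_real (cball (0::real^'n) (R + 1)) x)"
      by (intro integrable_mult_right integrable_real_indicator) (auto simp: emeasure_lborel_cball_less_top)
    show "AE x in lborel. (\<lambda>n. (f (x + t n *\<^sub>R e) - f x) / t n) \<longlonglongrightarrow> partial j f x"
    proof (rule AE_I2)
      fix x
      have "((\<lambda>s. f (x + s *\<^sub>R e)) has_derivative (\<lambda>s. grad f x \<bullet> (s *\<^sub>R e))) (at 0)"
      proof -
        have "((\<lambda>s. x + s *\<^sub>R e) has_derivative (\<lambda>s. s *\<^sub>R e)) (at 0)"
          by (auto intro!: derivative_eq_intros)
        from has_derivative_compose[OF this, of f "\<lambda>h. grad f x \<bullet> h"] has_derivative_grad[OF f, of x]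
        show ?thesis by simp
      qed
      then have "((\<lambda>s. f (x + s *\<^sub>R e)) has_real_derivative partial j f x) (at 0)"
        by (simp add: has_field_derivative_def e_def inner_axis mult.commute[of _ "partial j f x"])
      then have "((\<lambda>s. (f (x + s *\<^sub>R e) - f x) / s) \<longlongrightarrow> partial j f x) (at 0)"
        unfolding has_field_derivative_iff by simp
      moreover have "filterlim t (at 0) sequentially"
        using tl t(1) by (auto simp: filterlim_at intro!: always_eventually) (metis less_irrefl)
      ultimately show "(\<lambda>n. (f (x + t n *\<^sub>R e) - f x) / t n) \<longlonglongrightarrow> partial j f x"
        by (rule filterlim_compose)
    qed
    show "AE x in lborel. norm ((f (x + t n *\<^sub>R e) - f x) / t n) \<le> B * indicator (cball 0 (R + 1)) x" for n
    proof (rule AE_I2)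
      fix x
      show "norm ((f (x + t n *\<^sub>R e) - f x) / t n) \<le> B * indicator (cball 0 (R + 1)) x"
      proof (cases "x \<in> cball 0 (R + 1)")
        case True
        have "\<bar>f (x + t n *\<^sub>R e) - f x\<bar> \<le> B * t n"
          using Lipschitz_of_grad_bounded[OF f B', of "x + t n *\<^sub>R e" x] t[of n] by (simp add: ne)
        then show ?thesis using True t[of n] by (simp add: field_simps)
      next
        case False
        have "norm x - norm (t n *\<^sub>R e) \<le> norm (x + t n *\<^sub>R e)" by (rule norm_diff_ineq)
        then have "x \<notin> K" "x + t n *\<^sub>R e \<notin> K"
          using False R[of x] R[of "x + t n *\<^sub>R e"] t[of n] ne by auto
        then show ?thesis using 0(2) False by simp
      qed
    qed
  qed auto
  moreover have z: "(LINT x|lborel. (f (x + t n *\<^sub>R e) - f x) / t n) = 0" for n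
    using lborel_integral_translate[of f "t n *\<^sub>R e"] fi by simp
  ultimately have "(\<lambda>n::nat. 0) \<longlonglongrightarrow> (LINT x|lborel. partial j f x)" unfolding z by blast
  then show ?thesis by (simp add: LIMSEQ_const_iff)
qed

text \<open>\<open>f\<close> is only asked to be continuously differentiable: besides test
  functions, it will be the regularised Riesz potential kernel, of which just the gradient is
  computed.\<close>

lemma integration_by_parts:
  fixes f :: "real^'n::finite \<Rightarrow> real"
  assumes f: "\<And>x. f differentiable (at x)" "continuous_on UNIV (grad f)"
    and \<phi>: "\<phi> \<in> test_functions UNIV"
  shows "(LINT x|lborel. f x * partial j \<phi> x) = - (LINT x|lborel. partial j f x * \<phi> x)"
proof -
  obtain K where K: "smooth_fun \<phi>" "compact K" "K \<subseteq> UNIV" "\<And>x. x \<notin> K \<Longrightarrow> \<phi> x = 0"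
    by (rule test_functionsE[OF \<phi>]) blast
  have cf: "continuous_on S f" for S
    using f by (meson continuous_at_imp_continuous_on differentiable_imp_continuous_within)
  have cp: "continuous_on S (partial j f)" for S
    using continuous_on_component[OF continuous_on_subset[OF f(2), of S], of j] by simp
  have int: "integrable lborel (\<lambda>x. g x * \<psi> x)"
    if g: "continuous_on UNIV g" and \<psi>: "\<psi> \<in> test_functions UNIV" for g \<psi> :: "real^'n \<Rightarrow> real"
  proof -
    obtain K where K: "smooth_fun \<psi>" "compact K" "K \<subseteq> UNIV" "\<And>x. x \<notin> K \<Longrightarrow> \<psi> x = 0"
      by (rule test_functionsE[OF \<psi>]) blast
    have c: "continuous_on UNIV (\<lambda>x. g x * \<psi> x)"
      by (intro continuous_intros g smooth_fun_continuous K)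
    then have "bounded ((\<lambda>x. g x * \<psi> x) ` K)"
      using K by (intro compact_imp_bounded compact_continuous_image) (auto intro: continuous_on_subset)
    then obtain C where C: "C > 0" "\<And>x. x \<in> K \<Longrightarrow> \<bar>g x * \<psi> x\<bar> \<le> C"
      by (auto simp: bounded_pos)
    have "norm (g x * \<psi> x) \<le> C" for x using C K(4)[of x] by (cases "x \<in> K") auto
    then show ?thesis using K c
      by (intro integrable_bounded_support[of _ K C] borel_measurable_continuous_onI compact_imp_bounded) auto
  qed
  have d: "(\<lambda>x. f x * \<phi> x) differentiable (at x)" for x
    by (intro differentiable_mult f smooth_fun_differentiable K)
  have eq: "partial j (\<lambda>x. f x * \<phi> x) x = partial j f x * \<phi> x + f x * partial j \<phi> x" for x j
    by (intro partial_mult f smooth_fun_differentiable K)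
  have "grad (\<lambda>x. f x * \<phi> x) = (\<lambda>x. \<phi> x *\<^sub>R grad f x + f x *\<^sub>R grad \<phi> x)"
    by (auto simp: vec_eq_iff eq fun_eq_iff)
  then have "continuous_on UNIV (grad (\<lambda>x. f x * \<phi> x))"
    by (auto intro!: continuous_intros f cf smooth_fun_continuous smooth_fun_continuous_grad K)
  from integral_partial_eq_0[OF d this K(2), of j] K(4)
  have "(LINT x|lborel. partial j f x * \<phi> x + f x * partial j \<phi> x) = 0" by (simp add: eq)
  then show ?thesis
    using int[OF cp \<phi>] int[OF cf test_functions_partial[OF \<phi>]] by simp
qed

subsection \<open>Test functions in Sobolev spaces\<close>

lemma compactly_in_UNIV_iff:
  "compactly_in U UNIV \<longleftrightarrow> bounded U" for U :: "'a::heine_borel set"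
proof
  assume "bounded U"
  then show "compactly_in U UNIV"
    unfolding compactly_in_def using compact_closure closure_subset by blast
qed (auto simp: compactly_in_def intro: bounded_subset compact_imp_bounded)

lemma integrable_bounded_scaleR:
  fixes g :: "'a \<Rightarrow> 'b::{banach, second_countable_topology}"
  assumes g: "integrable M g" and f: "f \<in> borel_measurable M" "\<And>x. \<bar>f x\<bar> \<le> C"
  shows "integrable M (\<lambda>x. f x *\<^sub>R g x)"
proof (rule Bochner_Integration.integrable_bound)
  show "integrable M (\<lambda>x. C * norm (g x))" using g by simp
  show "(\<lambda>x. f x *\<^sub>R g x) \<in> borel_measurable M" using f g by simp
  have "C \<ge> 0" using f(2) abs_ge_zero order_trans by blast
  then show "AE x in M. norm (f x *\<^sub>R g x) \<le> norm (C * norm (g x))"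
    using f(2) by (auto simp: abs_mult intro!: mult_right_mono)
qed

lemma lebesgue_on_support:
  fixes f :: "'a::euclidean_space \<Rightarrow> 'b::{banach, second_countable_topology}"
  assumes "U \<in> sets lebesgue" "V \<in> sets lebesgue" "V \<subseteq> U" "\<And>x. x \<in> U - V \<Longrightarrow> f x = 0"
  shows "(LINT x|lebesgue_on U. f x) = (LINT x|lebesgue_on V. f x)"
    and "integrable (lebesgue_on U) f \<longleftrightarrow> integrable (lebesgue_on V) f"
proof -
  have "(\<lambda>x. indicator U x *\<^sub>R f x) = (\<lambda>x. indicator V x *\<^sub>R f x)"
    using assms by (auto simp: indicator_def fun_eq_iff)
  then show "(LINT x|lebesgue_on U. f x) = (LINT x|lebesgue_on V. f x)"
    and "integrable (lebesgue_on U) f \<longleftrightarrow> integrable (lebesgue_on V) f"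
    using assms by (simp_all add: integral_restrict_space integrable_restrict_space)
qed

lemma powr_integral_continuous_support:
  fixes f :: "'a::euclidean_space \<Rightarrow> 'b::euclidean_space"
  assumes f: "continuous_on UNIV f" and K: "compact K" "\<And>x. x \<notin> K \<Longrightarrow> f x = 0" and q: "0 < q"
  shows "integrable lborel (\<lambda>x. norm (f x) powr q)"
    and "U \<in> sets lebesgue \<Longrightarrow> f \<in> Lq q U"
proof -
  have [measurable]: "f \<in> borel_measurable borel" using f by (rule borel_measurable_continuous_onI)
  have "bounded (f ` K)"
    using K f by (intro compact_imp_bounded compact_continuous_image) (auto intro: continuous_on_subset)
  then obtain C where C: "C > 0" "\<And>x. x \<in> K \<Longrightarrow> norm (f x) \<le> C"
    by (auto simp: bounded_pos)
  show *: "integrable lborel (\<lambda>x. norm (f x) powr q)"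
  proof (rule integrable_bounded_support[of _ K "C powr q"])
    show "norm (norm (f x) powr q) \<le> C powr q" for x
      using C K(2)[of x] q by (cases "x \<in> K") (auto intro!: powr_mono2)
  qed (use K in \<open>auto simp: compact_imp_bounded\<close>)
  show "f \<in> Lq q U" if "U \<in> sets lebesgue" unfolding Lq_def
    using integrable_lborel_imp_lebesgue_on[OF * that] by (auto intro!: borel_measurable_lebesgue_onI)
qed

lemma test_functions_Lq:
  assumes \<phi>: "\<phi> \<in> test_functions U" and q: "0 < q"
  shows "integrable lborel (\<lambda>x. \<bar>\<phi> x\<bar> powr q)" "integrable lborel (\<lambda>x. norm (grad \<phi> x) powr q)"
    and "V \<in> sets lebesgue \<Longrightarrow> \<phi> \<in> Lq q V" "V \<in> sets lebesgue \<Longrightarrow> grad \<phi> \<in> Lq q V"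
proof -
  obtain K where K: "smooth_fun \<phi>" "compact K" "K \<subseteq> U" "\<And>x. x \<notin> K \<Longrightarrow> \<phi> x = 0"
    by (rule test_functionsE[OF \<phi>]) blast
  have G: "grad \<phi> x = 0" if "x \<notin> K" for x
    using partial_eq_0_outside[of K \<phi> x] K that by (simp add: vec_eq_iff compact_imp_closed)
  note A = powr_integral_continuous_support[OF smooth_fun_continuous[OF K(1)] K(2) K(4) q]
  note B = powr_integral_continuous_support[OF smooth_fun_continuous_grad[OF K(1)] K(2) G q]
  show "integrable lborel (\<lambda>x. \<bar>\<phi> x\<bar> powr q)" "integrable lborel (\<lambda>x. norm (grad \<phi> x) powr q)"
    "V \<in> sets lebesgue \<Longrightarrow> \<phi> \<in> Lq q V" "V \<in> sets lebesgue \<Longrightarrow> grad \<phi> \<in> Lq q V"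
    using A B by auto
qed

lemma borel_measurable_smooth_fun: "smooth_fun f \<Longrightarrow> f \<in> borel_measurable borel"
  by (intro borel_measurable_continuous_onI smooth_fun_continuous)

lemma borel_measurable_grad: "smooth_fun f \<Longrightarrow> grad f \<in> borel_measurable borel"
  by (intro borel_measurable_continuous_onI smooth_fun_continuous_grad)

lemma has_weak_grad_test:
  assumes \<phi>: "\<phi> \<in> test_functions UNIV"
  shows "has_weak_grad \<phi> (grad \<phi>)"
  unfolding has_weak_grad_def
proof (intro conjI allI ballI)
  show "grad \<phi> \<in> Lq_loc 1 UNIV"
    using test_functions_Lq(4)[OF \<phi>] by (auto simp: Lq_loc_def)
  fix j and \<psi> :: "real^'a \<Rightarrow> real"
  assume \<psi>: "\<psi> \<in> test_functions UNIV"
  note s = test_functions_smooth[OF \<phi>] test_functions_smooth[OF \<psi>]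
  have [measurable]: "\<phi> \<in> borel_measurable borel" "\<psi> \<in> borel_measurable borel"
    "partial j \<phi> \<in> borel_measurable borel" "partial j \<psi> \<in> borel_measurable borel"
    using s by (auto intro: borel_measurable_smooth_fun smooth_fun_partial)
  show "distr_partial j (distr_of UNIV \<phi>) \<psi> = distr_of UNIV (\<lambda>x. grad \<phi> x $ j) \<psi>"
    using integration_by_parts[OF smooth_fun_differentiable smooth_fun_continuous_grad \<psi>, OF s(1) s(1), of j]
    by (simp add: distr_partial_def distr_of_def lebesgue_on_UNIV_eq integral_completion mult.commute)
qed

lemma Lq_loc_1_integrable:
  assumes "g \<in> Lq_loc 1 UNIV"
  shows "integrable (lebesgue_on (box a b)) g"
proof -
  have "g \<in> Lq 1 (box a b)"
    using assms by (auto simp: Lq_loc_def compactly_in_UNIV_iff bounded_box)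
  then have "integrable (lebesgue_on (box a b)) (\<lambda>x. norm (g x))" "g \<in> borel_measurable (lebesgue_on (box a b))"
    by (auto simp: Lq_def)
  then show ?thesis by (simp add: integrable_norm_iff)
qed

lemma integrable_test_times_locally_integrable:
  fixes f :: "real^'n::finite \<Rightarrow> real"
  assumes \<phi>: "\<phi> \<in> test_functions UNIV" and f: "\<And>a b. integrable (lebesgue_on (box a b)) f"
  shows "integrable lebesgue (\<lambda>x. \<phi> x * f x)"
proof -
  obtain K where K: "smooth_fun \<phi>" "compact K" "K \<subseteq> UNIV" "\<And>x. x \<notin> K \<Longrightarrow> \<phi> x = 0"
    by (rule test_functionsE[OF \<phi>]) blast
  obtain C where C: "\<And>x. \<bar>\<phi> x\<bar> \<le> C" using test_functions_bounded[OF \<phi>] by blast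
  obtain a where a: "K \<subseteq> box (-a) a"
    using bounded_subset_box_symmetric[OF compact_imp_bounded[OF K(2)]] by blast
  have "integrable lebesgue (\<lambda>x. \<phi> x *\<^sub>R (indicator (box (-a) a) x *\<^sub>R f x))"
    by (rule integrable_bounded_scaleR[of _ _ _ C])
       (use f[of "-a" a] C K(1) in \<open>auto simp: integrable_restrict_space measurable_completion borel_measurable_smooth_fun\<close>)
  moreover have "(\<lambda>x. \<phi> x *\<^sub>R (indicator (box (-a) a) x *\<^sub>R f x)) = (\<lambda>x. \<phi> x * f x)"
    using a K(4) by (force simp: indicator_def fun_eq_iff)
  ultimately show ?thesis by simp
qed

text \<open>\<open>weak_grad\<close> is a choice among all weak gradients. The fundamental lemma,
  applied to each component of the difference, shows that the choice matters only on a null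
  set.\<close>

lemma has_weak_grad_unique:
  assumes "has_weak_grad u g" "has_weak_grad u g'"
  shows "AE x in lebesgue. g x = g' x"
proof -
  have g: "integrable (lebesgue_on (box a b)) (\<lambda>x. g x $ j)" "integrable (lebesgue_on (box a b)) (\<lambda>x. g' x $ j)" for a b j
    using assms unfolding has_weak_grad_def
    by (blast intro: integrable_bounded_linear[OF bounded_linear_vec_nth] Lq_loc_1_integrable)+
  have "AE x in lebesgue. g x $ j - g' x $ j = 0" for j
  proof (rule fundamental_lemma_calculus_of_variations)
    show "integrable (lebesgue_on (box a b)) (\<lambda>x. g x $ j - g' x $ j)" for a b
      using g by simp
    fix \<phi> :: "real^'a \<Rightarrow> real" assume \<phi>: "\<phi> \<in> test_functions UNIV"
    have "distr_of UNIV (\<lambda>x. g x $ j) \<phi> = distr_of UNIV (\<lambda>x. g' x $ j) \<phi>"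
      using assms \<phi> unfolding has_weak_grad_def by metis
    then show "(LINT x|lebesgue. \<phi> x * (g x $ j - g' x $ j)) = 0"
      using integrable_test_times_locally_integrable[OF \<phi> g(1)] integrable_test_times_locally_integrable[OF \<phi> g(2)]
      by (simp add: distr_of_def lebesgue_on_UNIV_eq algebra_simps)
  qed
  then have "AE x in lebesgue. \<forall>j. g x $ j - g' x $ j = 0" by (simp add: AE_all_countable)
  then show ?thesis by eventually_elim (simp add: vec_eq_iff)
qed

lemma has_weak_grad_weak_grad_test:
  "\<phi> \<in> test_functions UNIV \<Longrightarrow> has_weak_grad \<phi> (weak_grad \<phi>)"
  unfolding weak_grad_def by (rule someI[of "has_weak_grad \<phi>"]) (rule has_weak_grad_test)

lemma Lq_norm_powr: "0 < q \<Longrightarrow> Lq_norm q U f powr q = (LINT x|lebesgue_on U. norm (f x) powr q)"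
  by (simp add: Lq_norm_def powr_powr)

text \<open>Makes the Sobolev norm of a test function computable: the chosen weak gradient agrees
  almost everywhere with the classical one.\<close>

lemma W1_norm_test:
  assumes \<phi>: "\<phi> \<in> test_functions UNIV" and q: "0 < q"
  shows "W1_norm q \<phi> =
    ((LINT x|lborel. \<bar>\<phi> x\<bar> powr q) + (LINT x|lborel. norm (grad \<phi> x) powr q)) powr (1 / q)"
proof -
  have s: "smooth_fun \<phi>" by (rule test_functions_smooth[OF \<phi>])
  have [measurable]: "\<phi> \<in> borel_measurable borel" "grad \<phi> \<in> borel_measurable borel"
    using s by (auto intro: borel_measurable_smooth_fun borel_measurable_grad)
  have ae: "AE x in lebesgue. weak_grad \<phi> x = grad \<phi> x"
    by (rule has_weak_grad_unique[OF has_weak_grad_weak_grad_test[OF \<phi>] has_weak_grad_test[OF \<phi>]])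
  have gm: "grad \<phi> \<in> borel_measurable lebesgue" by (simp add: measurable_completion)
  have wm: "weak_grad \<phi> \<in> borel_measurable lebesgue"
    using gm by (rule borel_measurable_AE) (use ae in \<open>auto elim: eventually_mono\<close>)
  have "(LINT x|lebesgue. norm (weak_grad \<phi> x) powr q) = (LINT x|lebesgue. norm (grad \<phi> x) powr q)"
    by (rule integral_cong_AE) (use ae wm gm in \<open>auto elim: eventually_mono\<close>)
  then show ?thesis using q
    by (simp add: W1_norm_def Lq_norm_powr lebesgue_on_UNIV_eq integral_completion)
qed

lemma W1_norm_zero:
  assumes "0 < q"
  shows "W1_norm q (\<lambda>_ :: real^'n::finite. 0) = 0"
proof -
  have "(\<lambda>_ :: real^'n. 0 :: real) \<in> test_functions UNIV"
    by (rule test_functionsI[of _ "{}"]) auto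
  from W1_norm_test[OF this assms] show ?thesis using assms by (simp add: grad_const)
qed

lemma test_functions_W1_0:
  assumes \<phi>: "\<phi> \<in> test_functions U" and q: "0 < q"
  shows "\<phi> \<in> W1_0 q U"
proof -
  have \<phi>': "\<phi> \<in> test_functions UNIV" using test_functions_mono[OF \<phi>] by blast
  then have "\<phi> \<in> W1 q"
    using has_weak_grad_test[OF \<phi>'] test_functions_Lq(3,4)[OF \<phi>' q, of UNIV]
    by (auto simp: W1_def intro!: bexI[of _ "grad \<phi>"])
  moreover have "(\<lambda>k::nat. W1_norm q (\<lambda>x. \<phi> x - \<phi> x)) \<longlonglongrightarrow> 0"
    by (simp add: W1_norm_zero[OF q])
  ultimately show ?thesis using \<phi> by (auto simp: W1_0_def intro!: exI[of _ "\<lambda>_. \<phi>"])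
qed

text \<open>The dual norm is a supremum of reals, which dominates its members only if they are
  bounded above; the separate bounds for \<open>S\<close> and \<open>S'\<close> provide
  this.\<close>

lemma Wm1_norm_bound:
  assumes S: "S \<in> Wm1 p U" "S' \<in> Wm1 p U" and u: "u \<in> test_functions U" "W1_norm (conj_exp p) u \<le> 1"
    and p: "0 < conj_exp p"
  shows "\<bar>S u - S' u\<bar> \<le> Wm1_norm p U (\<lambda>u. S u - S' u)"
proof -
  let ?V = "W1_0 (conj_exp p) U" and ?N = "W1_norm (conj_exp p)"
  obtain C C' where C: "\<And>f. f \<in> ?V \<Longrightarrow> \<bar>S f\<bar> \<le> C * ?N f" "\<And>f. f \<in> ?V \<Longrightarrow> \<bar>S' f\<bar> \<le> C' * ?N f"
    using S unfolding Wm1_def dual_space_def by blast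
  have N: "?N f \<ge> 0" for f by (simp add: W1_norm_def)
  have "bdd_above ((\<lambda>f. \<bar>S f - S' f\<bar>) ` {f \<in> ?V. ?N f \<le> 1})"
  proof (rule bdd_aboveI2)
    fix f assume f: "f \<in> {f \<in> ?V. ?N f \<le> 1}"
    have "\<bar>S f - S' f\<bar> \<le> C * ?N f + C' * ?N f" using C[of f] f by simp
    also have "\<dots> \<le> \<bar>C\<bar> * 1 + \<bar>C'\<bar> * 1"
      using f N[of f] by (intro add_mono mult_mono) auto
    finally show "\<bar>S f - S' f\<bar> \<le> \<bar>C\<bar> + \<bar>C'\<bar>" by simp
  qed
  then show ?thesis unfolding Wm1_norm_def dual_norm_def
    using u test_functions_W1_0[OF u(1) p] by (intro cSUP_upper) auto
qed

lemma Lq_inner_test_integrable: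
  assumes F: "F \<in> Lq 1 U" and U: "U \<in> sets lebesgue" and u: "u \<in> test_functions V"
  shows "integrable (lebesgue_on U) (\<lambda>x. u x *\<^sub>R F x)"
proof -
  obtain C where C: "\<And>x. \<bar>u x\<bar> \<le> C" using test_functions_bounded[OF u] by blast
  have "integrable (lebesgue_on U) F"
    using F integrable_norm_iff[of F "lebesgue_on U"] by (auto simp: Lq_def)
  then show ?thesis
    by (rule integrable_bounded_scaleR[OF _ _ C])
       (intro borel_measurable_lebesgue_onI borel_measurable_smooth_fun test_functions_smooth[OF u])
qed

text \<open>The divergence is a distribution on \<open>U\<close>, where \<open>F\<close> may be
  integrable only locally. For a test function supported in \<open>V\<close> the pairing involves
  \<open>V\<close> alone, which will be a ball with closure in \<open>U\<close>.\<close>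

lemma distr_div_test:
  fixes u :: "real^'n::finite \<Rightarrow> real"
  assumes F: "F \<in> Lq 1 V" and V: "V \<in> sets lebesgue" "U \<in> sets lebesgue" "V \<subseteq> U"
    and u: "u \<in> test_functions V"
  shows "distr_div U F u = - (LINT x|lebesgue_on V. F x \<bullet> grad u x)"
    and "integrable (lebesgue_on V) (\<lambda>x. F x \<bullet> grad u x)"
proof -
  obtain K where K: "smooth_fun u" "compact K" "K \<subseteq> V" "\<And>x. x \<notin> K \<Longrightarrow> u x = 0"
    by (rule test_functionsE[OF u]) blast
  have G: "partial j u x = 0" if "x \<notin> V" for x j
    using partial_eq_0_outside[of K u x] K that by (auto simp: compact_imp_closed)
  have int: "integrable (lebesgue_on V) (\<lambda>x. partial j u x * F x $ j)" for j
    using integrable_bounded_linear[OF bounded_linear_vec_nth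
        Lq_inner_test_integrable[OF F V(1) test_functions_partial[OF u]], of j j] by simp
  have eq: "F x \<bullet> grad u x = (\<Sum>j\<in>UNIV. partial j u x * F x $ j)" for x
    by (simp add: inner_vec_def mult.commute)
  show "integrable (lebesgue_on V) (\<lambda>x. F x \<bullet> grad u x)"
    unfolding eq using int by auto
  have "distr_div U F u = (\<Sum>j\<in>UNIV. - (LINT x|lebesgue_on U. partial j u x * F x $ j))"
    by (simp add: distr_div_def distr_partial_def distr_of_def)
  also have "\<dots> = (\<Sum>j\<in>UNIV. - (LINT x|lebesgue_on V. partial j u x * F x $ j))"
    using G V by (intro sum.cong arg_cong[of _ _ uminus] lebesgue_on_support(1)) auto
  also have "\<dots> = - (LINT x|lebesgue_on V. F x \<bullet> grad u x)"
    unfolding eq using int by (simp add: sum_negf)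
  finally show "distr_div U F u = - (LINT x|lebesgue_on V. F x \<bullet> grad u x)" .
qed

subsection \<open>The Riesz kernel\<close>

lemma cball_measurable [measurable]: "cball (c::'a::euclidean_space) r \<in> sets borel"
  by simp

text \<open>A radial estimate without polar coordinates: \<open>f\<close> is at most the sum of the
  \<open>c k\<close> times the indicators of the balls of radius \<open>r k\<close>, and the volume
  of such a ball is a constant times \<open>r k ^ DIM('a)\<close>.\<close>

lemma integrable_ball_cover:
  fixes f :: "'a::euclidean_space \<Rightarrow> real"
  assumes [measurable]: "f \<in> borel_measurable borel" and f0: "\<And>x. 0 \<le> f x"
    and c: "\<And>k. 0 \<le> c k" and r: "\<And>k. 0 \<le> r k"
    and cover: "\<And>x. f x \<noteq> 0 \<Longrightarrow> \<exists>k::nat. norm x \<le> r k \<and> f x \<le> c k"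
    and sum: "summable (\<lambda>k. c k * r k ^ DIM('a))"
  shows "integrable lborel f"
proof (rule integrableI_nonneg)
  have "(\<integral>\<^sup>+x. ennreal (f x) \<partial>lborel) \<le> (\<integral>\<^sup>+x. (\<Sum>k. ennreal (c k) * indicator (cball 0 (r k)) x) \<partial>(lborel :: 'a measure))"
  proof (rule nn_integral_mono)
    fix x :: 'a
    show "ennreal (f x) \<le> (\<Sum>k. ennreal (c k) * indicator (cball 0 (r k)) x)"
    proof (cases "f x = 0")
      case False
      then obtain k where k: "norm x \<le> r k" "f x \<le> c k" using cover by blast
      have "ennreal (f x) \<le> (\<Sum>i\<in>{k}. ennreal (c i) * indicator (cball 0 (r i)) x)"
        using k by (simp add: ennreal_leI)
      also have "\<dots> \<le> (\<Sum>k. ennreal (c k) * indicator (cball 0 (r k)) x)"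
        by (rule sum_le_suminf) auto
      finally show ?thesis .
    qed simp
  qed
  also have "\<dots> = (\<Sum>k. \<integral>\<^sup>+x. ennreal (c k) * indicator (cball 0 (r k)) x \<partial>(lborel :: 'a measure))"
    by (rule nn_integral_suminf) (auto intro!: borel_measurable_times_ennreal borel_measurable_indicator)
  also have "\<dots> = (\<Sum>k. ennreal (unit_ball_vol (real DIM('a)) * (c k * r k ^ DIM('a))))"
    using c r by (intro suminf_cong)
      (simp add: nn_integral_cmult_indicator emeasure_cball ennreal_mult[symmetric] unit_ball_vol_nonneg mult_ac)
  also have "\<dots> = ennreal (\<Sum>k. unit_ball_vol (real DIM('a)) * (c k * r k ^ DIM('a)))"
    using c r by (intro suminf_ennreal2 summable_mult sum) (simp add: unit_ball_vol_nonneg)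
  also have "\<dots> < \<infinity>" by simp
  finally show "(\<integral>\<^sup>+x. ennreal (f x) \<partial>lborel) < \<infinity>" .
qed (use f0 in auto)

text \<open>Dyadic shells: where \<open>(1/2)^(k+1) < norm x \<le> (1/2)^k\<close> the function is
  at most \<open>2 powr (a (k+1))\<close>. Against the volumes this gives a geometric series of
  ratio \<open>2 powr (a - n)\<close>, below 1 since \<open>a\<close> is less than the dimension
  \<open>n\<close>.\<close>

lemma integrable_norm_powr_near_0:
  assumes "0 < a" "a < real DIM('a::euclidean_space)"
  shows "integrable lborel (\<lambda>x::'a. indicator (cball 0 1) x * norm x powr - a)"
proof (rule integrable_ball_cover[where r = "\<lambda>k. (1/2)^k" and c = "\<lambda>k. (2 powr a) ^ Suc k"])
  fix x :: 'a assume "indicator (cball 0 1) x * norm x powr - a \<noteq> 0"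
  then have x: "0 < norm x" "norm x \<le> 1" by (auto simp: indicator_def split: if_splits)
  define k where "k = (LEAST k. (1/2) ^ Suc k < norm x)"
  obtain m where "(1/2)^m < norm x" using real_arch_pow_inv[of "norm x" "1/2"] x by auto
  then have "(1/2) ^ Suc m < norm x" using x by (simp add: field_simps)
  then have k: "(1/2) ^ Suc k < norm x" unfolding k_def by (rule LeastI)
  have "norm x \<le> (1/2) ^ k"
  proof (cases k)
    case (Suc i)
    then have "i < (LEAST k. (1/2) ^ Suc k < norm x)" by (simp add: k_def)
    then have "\<not> (1/2) ^ Suc i < norm x" by (rule not_less_Least)
    then show ?thesis using Suc by simp
  qed (use x in simp)
  moreover have "norm x powr - a \<le> ((1/2) ^ Suc k) powr - a"
    using k assms by (intro powr_mono2') auto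
  moreover have "((1/2) ^ Suc k) powr - a = (2 powr a) ^ Suc k"
  proof -
    have "((1/2::real) ^ Suc k) powr - a = (2 powr (- real (Suc k))) powr - a"
    proof -
      have "(1/2::real) ^ Suc k = 2 powr (- real (Suc k))"
        by (simp only: powr_minus powr_realpow[of 2, simplified] power_one_over inverse_eq_divide)
      then show ?thesis by (simp only:)
    qed
    also have "\<dots> = (2 powr a) powr (real (Suc k))" by (simp only: powr_powr) (simp add: algebra_simps)
    finally show ?thesis by (subst (asm) powr_realpow) auto
  qed
  ultimately show "\<exists>k. norm x \<le> (1/2)^k \<and> indicator (cball 0 1) x * norm x powr - a \<le> (2 powr a) ^ Suc k"
    using x by (intro exI[of _ k]) simp
next
  have "summable (\<lambda>k. 2 powr a * (2 powr a * (1/2) ^ DIM('a)) ^ k)"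
  proof (intro summable_mult summable_geometric)
    have "2 powr a * (1/2) ^ DIM('a) = 2 powr (a - real DIM('a))"
      by (simp add: powr_diff powr_realpow power_divide)
    also have "\<dots> < 2 powr 0" using assms by (intro powr_less_mono) auto
    finally show "norm (2 powr a * (1/2) ^ DIM('a) :: real) < 1" by (simp add: abs_mult)
  qed
  then show "summable (\<lambda>k. (2 powr a) ^ Suc k * ((1/2) ^ k) ^ DIM('a))"
    by (simp add: power_mult_distrib power_mult[symmetric] mult_ac)
qed auto

text \<open>The same dyadic argument outwards: on the shell between \<open>2^k\<close> and
  \<open>2^(k+1)\<close> the function is at most \<open>2 powr (- a k)\<close>, and the ratio of the
  series is \<open>2 powr (n - a)\<close>.\<close>

lemma integrable_norm_powr_at_infinity:
  assumes "real DIM('a::euclidean_space) < a"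
  shows "integrable lborel (\<lambda>x::'a. indicator (- cball 0 1) x * norm x powr - a)"
proof (rule integrable_ball_cover[where r = "\<lambda>k. 2 ^ Suc k" and c = "\<lambda>k. (2 powr - a) ^ k"])
  have a: "a > 0" using assms by (smt (verit) of_nat_0_le_iff)
  fix x :: 'a assume "indicator (- cball 0 1) x * norm x powr - a \<noteq> 0"
  then have x: "norm x > 1" by (auto simp: indicator_def split: if_splits)
  define k where "k = (LEAST k. norm x \<le> 2 ^ Suc k)"
  obtain m where m: "norm x < 2^m" using real_arch_pow[of 2 "norm x"] by auto
  have "(2::real)^m \<le> 2 ^ Suc m" by simp
  then have "norm x \<le> 2 ^ Suc m" using m by linarith
  then have k: "norm x \<le> 2 ^ Suc k" unfolding k_def by (rule LeastI)
  have k': "2 ^ k \<le> norm x"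
  proof (cases k)
    case (Suc i)
    then have "i < (LEAST k. norm x \<le> 2 ^ Suc k)" by (simp add: k_def)
    then have "\<not> norm x \<le> 2 ^ Suc i" by (rule not_less_Least)
    then show ?thesis using Suc by simp
  qed (use x in simp)
  have "norm x powr - a \<le> (2 ^ k) powr - a"
    using k' a by (intro powr_mono2') auto
  also have "(2 ^ k :: real) powr - a = (2 powr - a) ^ k"
  proof -
    have "(2 ^ k :: real) powr - a = (2 powr real k) powr - a" by (simp add: powr_realpow)
    also have "\<dots> = (2 powr - a) powr real k" by (simp only: powr_powr) (simp add: algebra_simps)
    finally show ?thesis by (subst (asm) powr_realpow) auto
  qed
  finally show "\<exists>k. norm x \<le> 2 ^ Suc k \<and> indicator (- cball 0 1) x * norm x powr - a \<le> (2 powr - a) ^ k"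
    using x k by (intro exI[of _ k]) simp
next
  have "summable (\<lambda>k. 2 ^ DIM('a) * (2 powr - a * 2 ^ DIM('a)) ^ k)"
  proof (intro summable_mult summable_geometric)
    have "2 powr - a * 2 ^ DIM('a) = 2 powr (real DIM('a) - a)"
      by (simp add: powr_diff powr_realpow powr_minus_divide)
    also have "\<dots> < 2 powr 0" using assms by (intro powr_less_mono) auto
    finally show "norm (2 powr - a * 2 ^ DIM('a) :: real) < 1" by (simp add: abs_mult)
  qed
  then show "summable (\<lambda>k. (2 powr - a) ^ k * (2 ^ Suc k) ^ DIM('a))"
    by (simp add: power_mult_distrib power_mult[symmetric] mult_ac)
qed auto

text \<open>The kernel is of size \<open>norm h powr - (n + s)\<close>. Near 0 a Lipschitz increment
  gains one factor \<open>norm h\<close>, which lowers the exponent to \<open>n + s - 1 < n\<close>;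
  far away a bounded increment suffices, as \<open>n + s > n\<close>.\<close>

definition riesz_majorant :: "real \<Rightarrow> real^'n::finite \<Rightarrow> real" where
  "riesz_majorant s h = indicator (cball 0 1) h * norm h powr - (real CARD('n) + s - 1)
     + indicator (- cball 0 1) h * norm h powr - (real CARD('n) + s)"

lemma integrable_riesz_majorant:
  assumes "CARD('n::finite) \<ge> 2" "0 < s" "s < 1"
  shows "integrable lborel (riesz_majorant s :: real^'n \<Rightarrow> real)"
  unfolding riesz_majorant_def[abs_def] using assms
  by (intro Bochner_Integration.integrable_add integrable_norm_powr_near_0 integrable_norm_powr_at_infinity) auto

lemma riesz_majorant_nonneg: "0 \<le> riesz_majorant s h"
  by (simp add: riesz_majorant_def)

text \<open>For \<open>e = 0\<close> this is the kernel of the fractional gradient; for \<open>e > 0\<close> it is smooth.\<close>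

definition riesz_kernel :: "real \<Rightarrow> real \<Rightarrow> real^'n::finite \<Rightarrow> real^'n" where
  "riesz_kernel s e h = (h \<bullet> h + e) powr - ((real CARD('n) + s + 1) / 2) *\<^sub>R h"

text \<open>Written in the increment \<open>h = y - x\<close> and without the factor
  \<open>riesz_const\<close>, which \<open>frac_grad_smooth_eq\<close> restores for
  \<open>e = 0\<close>.\<close>

definition reg_frac_grad :: "real \<Rightarrow> real \<Rightarrow> (real^'n::finite \<Rightarrow> real) \<Rightarrow> real^'n \<Rightarrow> real^'n" where
  "reg_frac_grad s e \<psi> x = (LINT h|lborel. (\<psi> (x + h) - \<psi> x) *\<^sub>R riesz_kernel s e h)"

lemma borel_measurable_riesz_kernel [measurable]: "riesz_kernel s e \<in> borel_measurable borel"
  unfolding riesz_kernel_def[abs_def] by measurable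

lemma inner_self_powr:
  fixes h :: "'a::real_inner"
  assumes "h \<noteq> 0"
  shows "(h \<bullet> h) powr - (a / 2) = norm h powr - a"
proof -
  have "h \<bullet> h = norm h powr 2" using assms by (simp add: power2_norm_eq_inner[symmetric])
  moreover have "2 * - (a / 2) = - a" by simp
  ultimately show ?thesis by (simp only: powr_powr)
qed

lemma norm_times_powr:
  fixes h :: "'a::real_normed_vector"
  shows "norm h powr a * norm h = norm h powr (a + 1)"
  by (cases "h = 0") (auto simp: powr_add)

text \<open>The exponent is negative, so adding \<open>e\<close> to the base can only decrease the
  kernel. One bound thus serves all \<open>e\<close>, including \<open>e = 0\<close>.\<close>

lemma norm_riesz_kernel_le:
  fixes h :: "real^'n::finite"
  assumes "0 \<le> e" "0 < s"
  shows "norm (riesz_kernel s e h) \<le> norm h powr - (real CARD('n) + s)"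
proof (cases "h = 0")
  case False
  have "norm (riesz_kernel s e h) \<le> (h \<bullet> h) powr - ((real CARD('n) + s + 1) / 2) * norm h"
    unfolding riesz_kernel_def using assms False
    by (auto intro!: mult_right_mono powr_mono2')
  also have "\<dots> = norm h powr - (real CARD('n) + s)"
    unfolding inner_self_powr[OF False] norm_times_powr by simp
  finally show ?thesis .
qed (simp add: riesz_kernel_def)

lemma frac_grad_smooth_eq:
  fixes \<psi> :: "real^'n::finite \<Rightarrow> real"
  assumes \<psi>: "\<psi> \<in> borel_measurable borel"
  shows "frac_grad_smooth s \<psi> x = riesz_const TYPE('n) s *\<^sub>R reg_frac_grad s 0 \<psi> x"
proof -
  note [measurable] = \<psi>
  have eq: "((\<psi> y - \<psi> x) / norm (y - x) powr (real CARD('n) + s + 1)) *\<^sub>R (y - x)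
     = (\<psi> y - \<psi> x) *\<^sub>R riesz_kernel s 0 (y - x)" for y
  proof (cases "y = x")
    case False
    then have "riesz_kernel s 0 (y - x) = norm (y - x) powr - (real CARD('n) + s + 1) *\<^sub>R (y - x)"
      using inner_self_powr[of "y - x"] by (simp add: riesz_kernel_def)
    then show ?thesis by (simp only: powr_minus divide_inverse scaleR_scaleR)
  qed simp
  have "(LINT y|lebesgue. (\<psi> y - \<psi> x) *\<^sub>R riesz_kernel s 0 (y - x))
     = (LINT y|lborel. (\<psi> y - \<psi> x) *\<^sub>R riesz_kernel s 0 (y - x))"
    by (rule integral_completion) simp
  also have "\<dots> = reg_frac_grad s 0 \<psi> x"
    unfolding reg_frac_grad_def
    by (subst lborel_integral_translate(1)[of _ x, symmetric]) (auto simp: add.commute)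
  finally show ?thesis unfolding frac_grad_smooth_def eq by simp
qed

context
  fixes \<psi> :: "real^'n::finite \<Rightarrow> real" and s :: real
  assumes \<psi>: "\<psi> \<in> test_functions UNIV" and n: "CARD('n) \<ge> 2" and s: "0 < s" "s < 1"
begin

lemma borel_measurable_test_function [measurable]: "\<psi> \<in> borel_measurable borel"
  using \<psi> by (intro borel_measurable_smooth_fun test_functions_smooth)

text \<open>Increments with \<open>norm h \<le> 1\<close> are controlled by the slope
  \<open>L\<close>, the others by twice the maximum \<open>A\<close>. The constant depends neither
  on \<open>x\<close> nor on \<open>e\<close>, which gives both the uniform bound and the passage to
  \<open>e = 0\<close>.\<close>

lemma reg_frac_grad_majorant:
  obtains C where "0 < C"
    "\<And>x h e. 0 \<le> e \<Longrightarrow> norm ((\<psi> (x + h) - \<psi> x) *\<^sub>R riesz_kernel s e h) \<le> C * riesz_majorant s h"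
proof -
  obtain A where A: "A > 0" "\<And>x. \<bar>\<psi> x\<bar> \<le> A" using test_functions_bounded[OF \<psi>] by blast
  obtain L where L: "L > 0" "\<And>x. norm (grad \<psi> x) \<le> L" using test_functions_grad_bounded[OF \<psi>] by blast
  have Lip: "\<bar>\<psi> (x + h) - \<psi> x\<bar> \<le> L * norm h" for x h
    using Lipschitz_of_grad_bounded[OF smooth_fun_differentiable[OF test_functions_smooth[OF \<psi>]] L(2), of "x + h" x] by simp
  have "norm ((\<psi> (x + h) - \<psi> x) *\<^sub>R riesz_kernel s e h) \<le> (2 * A + L) * riesz_majorant s h" if e: "0 \<le> e" for x h e
  proof (cases "norm h \<le> 1")
    case True
    have "norm ((\<psi> (x + h) - \<psi> x) *\<^sub>R riesz_kernel s e h) \<le> (L * norm h) * norm h powr - (real CARD('n) + s)"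
      using Lip[of x h] norm_riesz_kernel_le[OF e s(1), of h] L(1) by (auto intro!: mult_mono)
    also have "\<dots> = L * norm h powr - (real CARD('n) + s - 1)"
      using norm_times_powr[of h "- (real CARD('n) + s)"] by (simp add: algebra_simps)
    also have "\<dots> \<le> (2 * A + L) * norm h powr - (real CARD('n) + s - 1)"
      using A by (intro mult_right_mono) auto
    finally show ?thesis using True by (simp add: riesz_majorant_def)
  next
    case False
    have "\<bar>\<psi> (x + h) - \<psi> x\<bar> \<le> 2 * A" using A(2)[of "x + h"] A(2)[of x] by linarith
    then have "norm ((\<psi> (x + h) - \<psi> x) *\<^sub>R riesz_kernel s e h) \<le> 2 * A * norm h powr - (real CARD('n) + s)"
      using norm_riesz_kernel_le[OF e s(1), of h] A(1) by (auto intro!: mult_mono)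
    also have "\<dots> \<le> (2 * A + L) * norm h powr - (real CARD('n) + s)"
      using L by (intro mult_right_mono) auto
    finally show ?thesis using False by (simp add: riesz_majorant_def)
  qed
  then show ?thesis using that[of "2 * A + L"] A L by simp
qed

lemma integrable_reg_frac_grad:
  assumes "0 \<le> e"
  shows "integrable lborel (\<lambda>h. (\<psi> (x + h) - \<psi> x) *\<^sub>R riesz_kernel s e h)"
proof -
  obtain C where C: "0 < C"
    "\<And>x h e. 0 \<le> e \<Longrightarrow> norm ((\<psi> (x + h) - \<psi> x) *\<^sub>R riesz_kernel s e h) \<le> C * riesz_majorant s h"
    using reg_frac_grad_majorant by blast
  show ?thesis
    by (rule Bochner_Integration.integrable_bound[of _ "\<lambda>h. C * riesz_majorant s h"])
       (use C assms in \<open>auto simp: riesz_majorant_nonneg abs_mult intro!: integrable_riesz_majorant[OF n s]\<close>)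
qed

lemma reg_frac_grad_bounded:
  obtains C where "0 < C" "\<And>x e. 0 \<le> e \<Longrightarrow> norm (reg_frac_grad s e \<psi> x) \<le> C"
proof -
  obtain C where C: "0 < C"
    "\<And>x h e. 0 \<le> e \<Longrightarrow> norm ((\<psi> (x + h) - \<psi> x) *\<^sub>R riesz_kernel s e h) \<le> C * riesz_majorant s h"
    using reg_frac_grad_majorant by blast
  have i: "integrable lborel (\<lambda>h. C * riesz_majorant s (h::real^'n))"
    by (intro integrable_mult_right integrable_riesz_majorant[OF n s])
  have "norm (reg_frac_grad s e \<psi> x) \<le> (LINT h|lborel. C * riesz_majorant s (h::real^'n))" if "0 \<le> e" for x e
  proof -
    have "norm (reg_frac_grad s e \<psi> x) \<le> (LINT h|lborel. norm ((\<psi> (x + h) - \<psi> x) *\<^sub>R riesz_kernel s e h))"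
      unfolding reg_frac_grad_def by (rule integral_norm_bound)
    also have "\<dots> \<le> (LINT h|lborel. C * riesz_majorant s (h::real^'n))"
      using C(2)[OF that] by (intro integral_mono integrable_norm integrable_reg_frac_grad that i)
    finally show ?thesis .
  qed
  moreover have "0 \<le> (LINT h|lborel. C * riesz_majorant s (h::real^'n))"
    using C by (intro Bochner_Integration.integral_nonneg) (simp add: riesz_majorant_nonneg)
  ultimately show ?thesis
    by (intro that[of "(LINT h|lborel. C * riesz_majorant s (h::real^'n)) + 1"]) (auto intro: add_increasing2)
qed

lemma reg_frac_grad_tendsto:
  "(\<lambda>k. reg_frac_grad s (inverse (real (Suc k))) \<psi> x) \<longlonglongrightarrow> reg_frac_grad s 0 \<psi> x"
proof -
  obtain C where C: "0 < C"
    "\<And>x h e. 0 \<le> e \<Longrightarrow> norm ((\<psi> (x + h) - \<psi> x) *\<^sub>R riesz_kernel s e h) \<le> C * riesz_majorant s h"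
    using reg_frac_grad_majorant by blast
  show ?thesis unfolding reg_frac_grad_def
  proof (rule integral_dominated_convergence[where w = "\<lambda>h. C * riesz_majorant s h"])
    show "integrable lborel (\<lambda>h. C * riesz_majorant s (h::real^'n))"
      by (intro integrable_mult_right integrable_riesz_majorant[OF n s])
    show "AE h in lborel. (\<lambda>k. (\<psi> (x + h) - \<psi> x) *\<^sub>R riesz_kernel s (inverse (real (Suc k))) h)
      \<longlonglongrightarrow> (\<psi> (x + h) - \<psi> x) *\<^sub>R riesz_kernel s 0 h"
    proof (rule AE_I2)
      fix h :: "real^'n"
      \<comment> \<open>For nonzero \<open>h\<close> the base of the power stays positive in the
        limit; at \<open>h = 0\<close> the increment of \<open>\<psi>\<close> vanishes.\<close>
      show "(\<lambda>k. (\<psi> (x + h) - \<psi> x) *\<^sub>R riesz_kernel s (inverse (real (Suc k))) h)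
        \<longlonglongrightarrow> (\<psi> (x + h) - \<psi> x) *\<^sub>R riesz_kernel s 0 h"
      proof (cases "h = 0")
        case False
        then show ?thesis unfolding riesz_kernel_def
          by (intro tendsto_intros LIMSEQ_inverse_real_of_nat) auto
      qed simp
    qed
  qed (use C in auto)
qed

end

subsection \<open>Smoothing by integration against a fixed kernel\<close>

text \<open>The convolution of \<open>\<psi>\<close> with the reflected kernel. All derivatives in
  \<open>x\<close> fall on \<open>\<psi>\<close>, so continuity of the kernel is enough for
  smoothness.\<close>

definition correlate :: "(real^'n::finite \<Rightarrow> real) \<Rightarrow> (real^'n \<Rightarrow> real) \<Rightarrow> real^'n \<Rightarrow> real" where
  "correlate \<Gamma> \<psi> x = (LINT h|lborel. \<psi> (x + h) * \<Gamma> h)"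

lemma integrable_continuous_compact_support:
  fixes f :: "'a::euclidean_space \<Rightarrow> 'b::euclidean_space"
  assumes "continuous_on UNIV f" "compact K" "\<And>x. x \<notin> K \<Longrightarrow> f x = 0"
  shows "integrable lborel f"
proof -
  have f: "f \<in> borel_measurable borel" using assms(1) by (rule borel_measurable_continuous_onI)
  have "integrable lborel (\<lambda>x. norm (f x) powr 1)"
    using powr_integral_continuous_support(1)[of f K 1] assms by auto
  then show ?thesis using f by (simp add: integrable_norm_iff)
qed

lemma integrable_correlate:
  fixes \<Gamma> :: "real^'n::finite \<Rightarrow> 'b::euclidean_space"
  assumes \<psi>: "\<psi> \<in> test_functions UNIV" and \<Gamma>: "continuous_on UNIV \<Gamma>"
  shows "integrable lborel (\<lambda>h. \<psi> (x + h) *\<^sub>R \<Gamma> h)"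
proof -
  obtain K where K: "smooth_fun \<psi>" "compact K" "K \<subseteq> UNIV" "\<And>x. x \<notin> K \<Longrightarrow> \<psi> x = 0"
    by (rule test_functionsE[OF \<psi>]) blast
  have "continuous_on UNIV (\<lambda>h. \<psi> (x + h))"
    by (intro continuous_on_compose2[OF smooth_fun_continuous[OF K(1), of UNIV]] continuous_intros) auto
  then have "continuous_on UNIV (\<lambda>h. \<psi> (x + h) *\<^sub>R \<Gamma> h)" by (intro continuous_intros \<Gamma>)
  then show ?thesis
  proof (rule integrable_continuous_compact_support)
    show "compact ((\<lambda>y. y - x) ` K)"
      using K(2) by (intro compact_continuous_image continuous_intros)
    show "\<psi> (x + h) *\<^sub>R \<Gamma> h = 0" if "h \<notin> (\<lambda>y. y - x) ` K" for h
    proof -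
      have "x + h \<notin> K" using that by (auto simp: image_iff)
      then show ?thesis using K(4) by simp
    qed
  qed
qed

text \<open>Differentiation under the integral: the normalised Taylor remainder of
  \<open>\<psi>\<close> tends to 0 pointwise, is at most \<open>2 * B\<close>, and vanishes outside
  a fixed ball of increments.\<close>

lemma has_derivative_correlate:
  fixes \<Gamma> :: "real^'n::finite \<Rightarrow> real"
  assumes \<psi>: "\<psi> \<in> test_functions UNIV" and \<Gamma>: "continuous_on UNIV \<Gamma>"
  shows "(correlate \<Gamma> \<psi> has_derivative (\<lambda>k. (\<chi> j. correlate \<Gamma> (partial j \<psi>) x) \<bullet> k)) (at x)"
proof -
  obtain K where K: "smooth_fun \<psi>" "compact K" "K \<subseteq> UNIV" "\<And>x. x \<notin> K \<Longrightarrow> \<psi> x = 0"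
    by (rule test_functionsE[OF \<psi>]) blast
  obtain B where B: "B > 0" "\<And>x. norm (grad \<psi> x) \<le> B" using test_functions_grad_bounded[OF \<psi>] by blast
  obtain R where R: "\<And>x. x \<in> K \<Longrightarrow> norm x \<le> R"
    using compact_imp_bounded[OF K(2)] by (auto simp: bounded_iff)
  have G0: "grad \<psi> x = 0" if "x \<notin> K" for x
    using partial_eq_0_outside[of K \<psi> x] K that by (simp add: vec_eq_iff compact_imp_closed)
  note int = integrable_correlate[OF _ \<Gamma>, unfolded real_scaleR_def]
  let ?D = "\<chi> j. correlate \<Gamma> (partial j \<psi>) x"
  have D: "?D \<bullet> k = (LINT h|lborel. (grad \<psi> (x + h) \<bullet> k) * \<Gamma> h)"
    and Di: "integrable lborel (\<lambda>h. (grad \<psi> (x + h) \<bullet> k) * \<Gamma> h)" for k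
  proof -
    have eq: "(grad \<psi> (x + h) \<bullet> k) * \<Gamma> h = (\<Sum>j\<in>UNIV. k $ j * (partial j \<psi> (x + h) * \<Gamma> h))" for h
      by (simp add: inner_vec_def sum_distrib_right sum_distrib_left mult_ac)
    show "integrable lborel (\<lambda>h. (grad \<psi> (x + h) \<bullet> k) * \<Gamma> h)"
      unfolding eq by (intro Bochner_Integration.integrable_sum integrable_mult_right int test_functions_partial \<psi>)
    show "?D \<bullet> k = (LINT h|lborel. (grad \<psi> (x + h) \<bullet> k) * \<Gamma> h)"
      unfolding eq using int[OF test_functions_partial[OF \<psi>]]
      by (simp add: inner_vec_def correlate_def mult.commute)
  qed
  have mG: "\<Gamma> \<in> borel_measurable borel" using \<Gamma> by (rule borel_measurable_continuous_onI)
  \<comment> \<open>The limit defining the derivative is tested along null sequences, the form to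
    which dominated convergence applies.\<close>
  have lim: "(\<lambda>i. norm (correlate \<Gamma> \<psi> (x + X i) - correlate \<Gamma> \<psi> x - ?D \<bullet> X i) / norm (X i)) \<longlonglongrightarrow> 0"
    if X: "X \<longlonglongrightarrow> 0" "\<And>i. X i \<noteq> 0" for X :: "nat \<Rightarrow> real^'n"
  proof -
    define Q where "Q i h = (\<psi> (x + X i + h) - \<psi> (x + h) - grad \<psi> (x + h) \<bullet> X i) / norm (X i)" for i h
    \<comment> \<open>With \<open>R\<close> a bound for the support of \<open>\<psi>\<close>, the
      radius \<open>R + M\<close> confines the remainders for all steps \<open>X i\<close> to a
      single ball around \<open>- x\<close>.\<close>
    obtain M where M: "\<And>i. norm (X i) \<le> M"
      using X(1) convergent_imp_Bseq[of X] by (auto simp: convergent_def Bseq_def)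
    have eq: "(correlate \<Gamma> \<psi> (x + X i) - correlate \<Gamma> \<psi> x - ?D \<bullet> X i) / norm (X i)
      = (LINT h|lborel. Q i h * \<Gamma> h)" for i
    proof -
      have "Q i h * \<Gamma> h = (\<psi> (x + X i + h) * \<Gamma> h - \<psi> (x + h) * \<Gamma> h - (grad \<psi> (x + h) \<bullet> X i) * \<Gamma> h) / norm (X i)" for h
        by (simp add: Q_def algebra_simps diff_divide_distrib)
      then show ?thesis
        unfolding D unfolding correlate_def using int[OF \<psi>] Di by simp
    qed
    have "(\<lambda>i. LINT h|lborel. Q i h * \<Gamma> h) \<longlonglongrightarrow> (LINT h::real^'n|lborel. 0 :: real)"
    proof (rule integral_dominated_convergence[where w = "\<lambda>h. indicator (cball (-x) (R + M)) h *\<^sub>R (2 * B * \<bar>\<Gamma> h\<bar>)"])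
      show "integrable lborel (\<lambda>h. indicator (cball (-x) (R + M)) h *\<^sub>R (2 * B * \<bar>\<Gamma> h\<bar>))"
        by (intro borel_integrable_compact compact_cball continuous_intros continuous_on_subset[OF \<Gamma>]) auto
      have [measurable]: "\<psi> \<in> borel_measurable borel" "grad \<psi> \<in> borel_measurable borel"
        using K(1) by (auto intro: borel_measurable_smooth_fun borel_measurable_grad)
      note [measurable] = mG
      show "(\<lambda>h. Q i h * \<Gamma> h) \<in> borel_measurable lborel" for i
        unfolding Q_def by measurable
      show "AE h in lborel. (\<lambda>i. Q i h * \<Gamma> h) \<longlonglongrightarrow> 0"
      proof (rule AE_I2)
        fix h
        have "((\<lambda>k. norm (\<psi> (x + h + k) - \<psi> (x + h) - grad \<psi> (x + h) \<bullet> k) / norm k) \<longlongrightarrow> 0) (at 0)"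
          using smooth_fun_has_derivative[OF K(1), of "x + h"] unfolding has_derivative_at by blast
        moreover have "filterlim X (at 0) sequentially"
          using X by (auto simp: filterlim_at intro!: always_eventually)
        ultimately have "(\<lambda>i. norm (\<psi> (x + h + X i) - \<psi> (x + h) - grad \<psi> (x + h) \<bullet> X i) / norm (X i)) \<longlonglongrightarrow> 0"
          by (rule filterlim_compose)
        then have "(\<lambda>i. norm (Q i h)) \<longlonglongrightarrow> 0"
          by (simp add: Q_def add_ac)
        then have "(\<lambda>i. Q i h) \<longlonglongrightarrow> 0" by (rule tendsto_norm_zero_cancel)
        then show "(\<lambda>i. Q i h * \<Gamma> h) \<longlonglongrightarrow> 0" by (rule tendsto_mult_left_zero)
      qed
      show "AE h in lborel. norm (Q i h * \<Gamma> h) \<le> indicator (cball (-x) (R + M)) h *\<^sub>R (2 * B * \<bar>\<Gamma> h\<bar>)" for i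
      proof (rule AE_I2)
        fix h
        show "norm (Q i h * \<Gamma> h) \<le> indicator (cball (-x) (R + M)) h *\<^sub>R (2 * B * \<bar>\<Gamma> h\<bar>)"
        proof (cases "h \<in> cball (-x) (R + M)")
          case True
          have "\<bar>\<psi> (x + X i + h) - \<psi> (x + h)\<bar> \<le> B * norm (X i)"
            using Lipschitz_of_grad_bounded[OF smooth_fun_differentiable[OF K(1)] B(2), of "x + X i + h" "x + h"] by simp
          moreover have "\<bar>grad \<psi> (x + h) \<bullet> X i\<bar> \<le> B * norm (X i)"
            using Cauchy_Schwarz_ineq2[of "grad \<psi> (x + h)" "X i"] mult_right_mono[OF B(2)[of "x + h"], of "norm (X i)"] by simp
          ultimately have "\<bar>Q i h\<bar> \<le> 2 * B"
            unfolding Q_def using X(2)[of i] by (simp add: divide_le_eq)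
          then show ?thesis using True by (simp add: abs_mult mult_right_mono)
        next
          case False
          then have n: "norm (x + h) > R + M" by (simp add: dist_norm norm_minus_commute algebra_simps)
          have "norm (x + h) - norm (X i) \<le> norm (x + h + X i)" by (rule norm_diff_ineq)
          then have "norm (x + X i + h) > R" using n M[of i] by (simp add: add_ac)
          moreover have "norm (x + h) > R" using n M[of i] norm_ge_zero[of "X i"] by linarith
          ultimately have "x + X i + h \<notin> K" "x + h \<notin> K" using R by force+
          then have "Q i h = 0" using K(4) G0 by (simp add: Q_def)
          then show ?thesis using False by simp
        qed
      qed
    qed auto
    then have "(\<lambda>i. norm (LINT h|lborel. Q i h * \<Gamma> h)) \<longlonglongrightarrow> 0"
      using tendsto_norm_zero by fastforce
    then show ?thesis unfolding eq[symmetric] by simp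
  qed
  show ?thesis unfolding has_derivative_at
  proof
    show "bounded_linear ((\<bullet>) ?D)" by (rule bounded_linear_inner_right)
    show "(\<lambda>k. norm (correlate \<Gamma> \<psi> (x + k) - correlate \<Gamma> \<psi> x - ?D \<bullet> k) / norm k) \<midarrow>0\<rightarrow> 0"
      unfolding tendsto_at_iff_sequentially using lim by (auto simp: o_def)
  qed
qed

lemma smooth_fun_correlate:
  fixes \<Gamma> :: "real^'n::finite \<Rightarrow> real"
  assumes \<psi>: "\<psi> \<in> test_functions UNIV" and \<Gamma>: "continuous_on UNIV \<Gamma>"
  shows "smooth_fun (correlate \<Gamma> \<psi>)" and "partial j (correlate \<Gamma> \<psi>) x = correlate \<Gamma> (partial j \<psi>) x"
proof -
  have p: "partial j (correlate \<Gamma> \<psi>) x = correlate \<Gamma> (partial j \<psi>) x"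
    if "\<psi> \<in> test_functions UNIV" for j \<psi> x
    using partial_eqI[OF has_derivative_correlate[OF that \<Gamma>], of j x] by (simp add: inner_axis)
  show "partial j (correlate \<Gamma> \<psi>) x = correlate \<Gamma> (partial j \<psi>) x" by (rule p[OF \<psi>])
  show "smooth_fun (correlate \<Gamma> \<psi>)"
  proof (rule smooth_fun_coinduct[of _ "correlate \<Gamma> ` test_functions UNIV"])
    fix g x j assume "g \<in> correlate \<Gamma> ` test_functions UNIV"
    then obtain \<phi> where \<phi>: "\<phi> \<in> test_functions UNIV" "g = correlate \<Gamma> \<phi>" by blast
    show "g differentiable (at x)"
      unfolding \<phi>(2) differentiable_def using has_derivative_correlate[OF \<phi>(1) \<Gamma>] by blast
    have "partial j g = correlate \<Gamma> (partial j \<phi>)" unfolding \<phi>(2) using p[OF \<phi>(1)] by blast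
    then show "partial j g \<in> correlate \<Gamma> ` test_functions UNIV"
      using test_functions_partial[OF \<phi>(1)] by blast
  qed (use \<psi> in blast)
qed

text \<open>For \<open>e = 0\<close> this is, up to a constant, the kernel
  \<open>norm h powr (1 - s - n)\<close> of the Riesz potential of order \<open>1 - s\<close>. The
  divisor is the exponent that differentiation brings down, so the gradient is exactly the negative
  of \<open>riesz_kernel s e\<close>.\<close>

definition riesz_potential_kernel :: "real \<Rightarrow> real \<Rightarrow> real^'n::finite \<Rightarrow> real" where
  "riesz_potential_kernel s e h =
     (h \<bullet> h + e) powr - ((real CARD('n) + s - 1) / 2) / (real CARD('n) + s - 1)"

lemma riesz_potential_kernel_derivative:
  fixes h :: "real^'n::finite"
  assumes "e > 0" "s > 0"
  shows "(riesz_potential_kernel s e has_derivative (\<lambda>k. - (riesz_kernel s e h) \<bullet> k)) (at h)"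
proof -
  define a where "a = real CARD('n) + s - 1"
  have a: "a > 0" using assms zero_less_card_finite[where 'a='n] unfolding a_def by linarith
  have pos: "h \<bullet> h + e > 0" using assms by (simp add: add_nonneg_pos)
  have "((\<lambda>h::real^'n. (h \<bullet> h + e) powr - (a / 2)) has_derivative
      (\<lambda>k. (- (a / 2) * (h \<bullet> h + e) powr (- (a / 2) - 1)) * (2 * (h \<bullet> k)))) (at h)"
  proof -
    have f: "((\<lambda>h. h \<bullet> h + e) has_derivative (\<lambda>k. 2 * (h \<bullet> k))) (at h)"
      by (auto intro!: derivative_eq_intros simp: inner_commute)
    have g: "((\<lambda>t. t powr - (a / 2)) has_derivative (*) (- (a / 2) * (h \<bullet> h + e) powr (- (a / 2) - 1))) (at (h \<bullet> h + e))"
      using has_real_derivative_powr[OF pos, of "- (a/2)"] by (simp add: has_field_derivative_def)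
    from has_derivative_compose[OF f g] show ?thesis .
  qed
  from has_derivative_mult_right[OF this, of "1 / a"]
  have "((\<lambda>h::real^'n. (h \<bullet> h + e) powr - (a / 2) / a) has_derivative
      (\<lambda>k. (1 / a) * ((- (a / 2) * (h \<bullet> h + e) powr (- (a / 2) - 1)) * (2 * (h \<bullet> k))))) (at h)"
    by simp
  moreover have "(1 / a) * ((- (a / 2) * (h \<bullet> h + e) powr (- (a / 2) - 1)) * (2 * (h \<bullet> k))) = - (riesz_kernel s e h) \<bullet> k" for k
  proof -
    have "- (a / 2) - 1 = - ((real CARD('n) + s + 1) / 2)" by (simp add: a_def field_simps)
    then show ?thesis using a by (simp add: riesz_kernel_def)
  qed
  ultimately show ?thesis by (simp add: riesz_potential_kernel_def[abs_def] a_def)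
qed

lemma continuous_on_riesz_kernel:
  assumes "e > 0"
  shows "continuous_on UNIV (riesz_kernel s e :: real^'n::finite \<Rightarrow> real^'n)"
  unfolding riesz_kernel_def[abs_def] using assms
  by (intro continuous_intros) (auto simp: add_nonneg_pos intro!: less_imp_neq[THEN not_sym])

context
  fixes \<psi> :: "real^'n::finite \<Rightarrow> real" and s :: real
  assumes \<psi>: "\<psi> \<in> test_functions UNIV" and n: "CARD('n) \<ge> 2" and s: "0 < s" "s < 1"
begin

text \<open>The kernel is odd, so the term with \<open>\<psi> x\<close> does not contribute to the integral.\<close>

lemma reg_frac_grad_eq_grad:
  assumes e: "e > 0"
  shows "smooth_fun (correlate (riesz_potential_kernel s e) \<psi>)"
    and "grad (correlate (riesz_potential_kernel s e) \<psi>) x = reg_frac_grad s e \<psi> x"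
proof -
  let ?\<Gamma> = "riesz_potential_kernel s e :: real^'n \<Rightarrow> real" and ?K = "riesz_kernel s e :: real^'n \<Rightarrow> real^'n"
  note der = riesz_potential_kernel_derivative[OF e s(1)]
  have \<Gamma>d: "?\<Gamma> differentiable (at h)" for h
    using der differentiable_def by blast
  then have \<Gamma>c: "continuous_on UNIV ?\<Gamma>"
    by (meson continuous_at_imp_continuous_on differentiable_imp_continuous_within)
  have p: "partial j ?\<Gamma> h = - ?K h $ j" for j h
    using partial_eqI[OF der, of j h] by (simp add: inner_axis)
  have "grad ?\<Gamma> = (\<lambda>h. - ?K h)" by (simp add: fun_eq_iff vec_eq_iff p)
  then have gc: "continuous_on UNIV (grad ?\<Gamma>)"
    using continuous_on_riesz_kernel[OF e] by (auto intro!: continuous_intros)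
  show "smooth_fun (correlate ?\<Gamma> \<psi>)" by (rule smooth_fun_correlate(1)[OF \<psi> \<Gamma>c])
  have Ki: "integrable lborel (\<lambda>h. \<psi> (x + h) *\<^sub>R ?K h)"
    by (rule integrable_correlate[OF \<psi> continuous_on_riesz_kernel[OF e]])
  have shift: "(\<lambda>h. \<psi> (h + x)) \<in> test_functions UNIV"
  proof -
    obtain K where K: "smooth_fun \<psi>" "compact K" "K \<subseteq> UNIV" "\<And>x. x \<notin> K \<Longrightarrow> \<psi> x = 0"
      by (rule test_functionsE[OF \<psi>]) blast
    show ?thesis
    proof (rule test_functionsI)
      show "compact ((\<lambda>y. y - x) ` K)"
        using K(2) by (intro compact_continuous_image continuous_intros)
      show "\<psi> (h + x) = 0" if "h \<notin> (\<lambda>y. y - x) ` K" for h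
      proof -
        have "h + x \<notin> K" using that by (auto simp: image_iff)
        then show ?thesis using K(4) by simp
      qed
    qed (use smooth_fun_translate[OF K(1)] in auto)
  qed
  \<comment> \<open>The derivative first falls on \<open>\<psi>\<close>; integration by parts in
    \<open>h\<close> moves it to the potential kernel, and the sign it costs cancels the minus in
    the gradient of that kernel.\<close>
  have 1: "grad (correlate ?\<Gamma> \<psi>) x = (LINT h|lborel. \<psi> (x + h) *\<^sub>R ?K h)"
  proof -
    have "partial j (correlate ?\<Gamma> \<psi>) x = (LINT h|lborel. \<psi> (x + h) *\<^sub>R ?K h) $ j" for j
    proof -
      have "partial j (correlate ?\<Gamma> \<psi>) x = (LINT h|lborel. ?\<Gamma> h * partial j (\<lambda>h. \<psi> (h + x)) h)"
        unfolding smooth_fun_correlate(2)[OF \<psi> \<Gamma>c] correlate_def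
        by (simp add: partial_translate[OF test_functions_smooth[OF \<psi>]] add.commute mult.commute)
      also have "\<dots> = - (LINT h|lborel. partial j ?\<Gamma> h * \<psi> (h + x))"
        by (rule integration_by_parts[OF \<Gamma>d gc shift])
      also have "\<dots> = (LINT h|lborel. (\<psi> (x + h) *\<^sub>R ?K h) $ j)"
        by (simp add: p add.commute mult.commute)
      also have "\<dots> = (LINT h|lborel. \<psi> (x + h) *\<^sub>R ?K h) $ j"
        by (rule integral_bounded_linear[OF bounded_linear_vec_nth Ki])
      finally show ?thesis .
    qed
    then show ?thesis by (simp add: vec_eq_iff)
  qed
  \<comment> \<open>Splitting off the term with \<open>\<psi> x\<close> requires the kernel itself
    to be integrable. Here \<open>e > 0\<close> bounds it on the unit ball, and its decay of order
    \<open>n + s\<close> handles the rest.\<close>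
  have Kint: "integrable lborel ?K"
  proof (rule Bochner_Integration.integrable_bound)
    define c where "c = e powr - ((real CARD('n) + s + 1) / 2)"
    show "integrable lborel (\<lambda>h::real^'n. c * indicator (cball 0 1) h
        + indicator (- cball 0 1) h * norm h powr - (real CARD('n) + s))"
      using s by (intro Bochner_Integration.integrable_add integrable_mult_right integrable_real_indicator
        integrable_norm_powr_at_infinity) (auto simp: emeasure_lborel_cball_less_top)
    have "norm (?K h) \<le> c * indicator (cball 0 1) h + indicator (- cball 0 1) h * norm h powr - (real CARD('n) + s)" for h
    proof (cases "norm h \<le> 1")
      case True
      have "norm (?K h) \<le> c * norm h"
        unfolding riesz_kernel_def c_def using e s by (auto intro!: mult_right_mono powr_mono2')
      also have "\<dots> \<le> c * 1" using True by (intro mult_left_mono) (auto simp: c_def)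
      finally show ?thesis using True by simp
    next
      case False
      then show ?thesis using norm_riesz_kernel_le[of e s h] e s by simp
    qed
    then show "AE h in lborel. norm (?K h) \<le> norm (c * indicator (cball 0 1) h
        + indicator (- cball 0 1) h * norm h powr - (real CARD('n) + s))"
      by (intro AE_I2) (smt (verit, best) real_norm_def)
  qed simp
  have "(LINT h|lborel. ?K h) = 0"
  proof -
    have "(LINT h|lborel. ?K h) = (LINT h|lborel. ?K (0 + (-1) *\<^sub>R h))"
      using lborel_integral_affine(1)[OF borel_measurable_riesz_kernel[of s e], of "-1" 0] by simp
    also have "\<dots> = - (LINT h|lborel. ?K h)" by (simp add: riesz_kernel_def)
    finally show ?thesis by (metis eq_neg_iff_add_eq_0 scaleR_2 scaleR_eq_0_iff zero_neq_numeral)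
  qed
  then show "grad (correlate ?\<Gamma> \<psi>) x = reg_frac_grad s e \<psi> x"
    unfolding 1 reg_frac_grad_def using Ki Kint by (simp add: scaleR_diff_left)
qed

end

subsection \<open>The fractional gradient in Lebesgue spaces\<close>

text \<open>At such an \<open>x\<close> the function vanishes, so only increments with
  \<open>x + h\<close> in the ball of radius \<open>R\<close> contribute. They satisfy
  \<open>norm h \<ge> norm x / 2\<close>, which turns the size of the kernel into decay in
  \<open>x\<close>.\<close>

lemma reg_frac_grad_0_tail:
  fixes \<psi> :: "real^'n::finite \<Rightarrow> real"
  assumes \<psi>: "\<psi> \<in> borel_measurable borel" "\<And>x. \<bar>\<psi> x\<bar> \<le> A" "\<And>x. norm x > R \<Longrightarrow> \<psi> x = 0"
    and R: "0 < R" and s: "0 < s" and x: "2 * R < norm x"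
  shows "norm (reg_frac_grad s 0 \<psi> x) \<le>
    A * measure lborel (cball (0::real^'n) R) * (norm x / 2) powr - (real CARD('n) + s)"
proof -
  note [measurable] = \<psi>(1)
  have A: "A \<ge> 0" using \<psi>(2)[of 0] by linarith
  define c where "c = (norm x / 2) powr - (real CARD('n) + s)"
  have 0: "\<psi> x = 0" using x R by (intro \<psi>(3)) auto
  have le: "norm ((\<psi> (x + h) - \<psi> x) *\<^sub>R riesz_kernel s 0 h) \<le> A * c * indicator (cball (-x) R) h" for h
  proof (cases "h \<in> cball (-x) R")
    case True
    then have "norm (x + h) \<le> R" by (simp add: dist_norm norm_minus_commute) (metis add.commute diff_minus_eq_add norm_minus_commute minus_diff_eq)
    moreover have "norm x \<le> norm (x + h) + norm h" using norm_triangle_ineq4[of "x + h" h] by simp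
    ultimately have h: "norm x / 2 \<le> norm h" using x by linarith
    have "norm (riesz_kernel s 0 h) \<le> norm h powr - (real CARD('n) + s)"
      using norm_riesz_kernel_le[of 0 s h] s by simp
    also have "\<dots> \<le> c" unfolding c_def using h x R s by (intro powr_mono2') auto
    finally show ?thesis using True \<psi>(2)[of "x + h"] A 0 by (auto intro!: mult_mono)
  next
    case False
    then have "norm (x + h) > R" by (simp add: dist_norm) (metis add.commute diff_minus_eq_add norm_minus_commute minus_diff_eq not_le)
    then show ?thesis using \<psi>(3)[of "x + h"] 0 False by simp
  qed
  have i: "integrable lborel (\<lambda>h. A * c * indicator (cball (-x) R) h)"
    by (intro integrable_mult_right integrable_real_indicator) (auto simp: emeasure_lborel_cball_less_top)
  have "norm (reg_frac_grad s 0 \<psi> x) \<le> (LINT h|lborel. norm ((\<psi> (x + h) - \<psi> x) *\<^sub>R riesz_kernel s 0 h))"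
    unfolding reg_frac_grad_def by (rule integral_norm_bound)
  also have "\<dots> \<le> (LINT h|lborel. A * c * indicator (cball (-x) R) h)"
    using le A by (intro integral_mono'[OF i]) (auto simp: c_def)
  also have "\<dots> = A * c * measure lborel (cball (-x) R)" by simp
  also have "measure lborel (cball (-x) R) = measure lborel (cball (0::real^'n) R)"
    using R by (simp add: content_cball)
  finally show ?thesis by (simp add: c_def mult_ac)
qed

context
  fixes s :: real
  assumes n: "CARD('n::finite) \<ge> 2" and s: "0 < s" "s < 1"
begin

text \<open>A pointwise limit of the regularised versions, which are gradients of smooth functions
  and hence continuous.\<close>

lemma reg_frac_grad_measurable:
  fixes \<psi> :: "real^'n \<Rightarrow> real"
  assumes \<psi>: "\<psi> \<in> test_functions UNIV"
  shows "reg_frac_grad s 0 \<psi> \<in> borel_measurable borel"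
proof (rule borel_measurable_LIMSEQ_metric[OF _ reg_frac_grad_tendsto[OF \<psi> n s]])
  fix k
  have e: "inverse (real (Suc k)) > 0" by simp
  have "reg_frac_grad s (inverse (real (Suc k))) \<psi> = grad (correlate (riesz_potential_kernel s (inverse (real (Suc k)))) \<psi>)"
    using reg_frac_grad_eq_grad(2)[OF \<psi> n s e] by (simp add: fun_eq_iff)
  then show "reg_frac_grad s (inverse (real (Suc k))) \<psi> \<in> borel_measurable borel"
    using reg_frac_grad_eq_grad(1)[OF \<psi> n s e] by (simp add: borel_measurable_grad)
qed

text \<open>Bounded on a large ball and of order \<open>norm x powr - (n + s)\<close> outside; since
  \<open>q \<ge> 1\<close>, the power \<open>q\<close> only improves a decay that is already
  integrable.\<close>

lemma integrable_reg_frac_grad_powr: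
  fixes \<psi> :: "real^'n \<Rightarrow> real"
  assumes \<psi>: "\<psi> \<in> test_functions UNIV" and q: "1 \<le> q"
  shows "integrable lborel (\<lambda>x. norm (reg_frac_grad s 0 \<psi> x) powr q)"
proof -
  note [measurable] = reg_frac_grad_measurable[OF \<psi>]
  obtain K where K: "smooth_fun \<psi>" "compact K" "K \<subseteq> UNIV" "\<And>x. x \<notin> K \<Longrightarrow> \<psi> x = 0"
    by (rule test_functionsE[OF \<psi>]) blast
  obtain R0 where R0: "\<And>x. x \<in> K \<Longrightarrow> norm x \<le> R0"
    using compact_imp_bounded[OF K(2)] by (auto simp: bounded_iff)
  \<comment> \<open>The maximum with 1 ensures \<open>norm x > 1\<close> outside the ball of radius
    \<open>2 * R\<close>, where larger exponents give faster decay and \<open>riesz_majorant\<close>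
    is given by its outer branch.\<close>
  define R where "R = max R0 1"
  have R: "R \<ge> 1" "\<And>x. norm x > R \<Longrightarrow> \<psi> x = 0" using R0 K(4) by (force simp: R_def)+
  obtain A where A: "A > 0" "\<And>x. \<bar>\<psi> x\<bar> \<le> A" using test_functions_bounded[OF \<psi>] by blast
  obtain C where C: "0 < C" "\<And>x e. 0 \<le> e \<Longrightarrow> norm (reg_frac_grad s e \<psi> x) \<le> C"
    using reg_frac_grad_bounded[OF \<psi> n s] by blast
  define c where "c = A * measure lborel (cball (0::real^'n) R) * 2 powr (real CARD('n) + s)"
  have c: "c \<ge> 0" using A by (simp add: c_def)
  show ?thesis
  proof (rule Bochner_Integration.integrable_bound)
    show "integrable lborel (\<lambda>x::real^'n. C powr q * indicator (cball 0 (2 * R)) x + c powr q * riesz_majorant s x)"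
      by (intro Bochner_Integration.integrable_add integrable_mult_right integrable_riesz_majorant[OF n s]
          integrable_real_indicator) (auto simp: emeasure_lborel_cball_less_top)
    have le: "norm (reg_frac_grad s 0 \<psi> x) powr q \<le> C powr q * indicator (cball 0 (2 * R)) x + c powr q * riesz_majorant s x" for x
    proof (cases "norm x \<le> 2 * R")
      case True
      have "norm (reg_frac_grad s 0 \<psi> x) powr q \<le> C powr q"
        using C(2)[of 0 x] q by (intro powr_mono2) auto
      then show ?thesis using True by (simp add: riesz_majorant_nonneg add_increasing2)
    next
      case False
      have "norm (reg_frac_grad s 0 \<psi> x) \<le> A * measure lborel (cball (0::real^'n) R) * (norm x / 2) powr - (real CARD('n) + s)"
        using False R A s by (intro reg_frac_grad_0_tail borel_measurable_smooth_fun[OF K(1)]) auto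
      also have "(norm x / 2) powr - (real CARD('n) + s) = 2 powr (real CARD('n) + s) * norm x powr - (real CARD('n) + s)"
        by (simp only: powr_divide powr_minus) (simp add: divide_simps)
      finally have "norm (reg_frac_grad s 0 \<psi> x) \<le> c * norm x powr - (real CARD('n) + s)"
        by (simp add: c_def mult_ac)
      then have "norm (reg_frac_grad s 0 \<psi> x) powr q \<le> (c * norm x powr - (real CARD('n) + s)) powr q"
        using q by (intro powr_mono2) auto
      also have "\<dots> = c powr q * norm x powr (- (real CARD('n) + s) * q)"
        using c by (simp only: powr_mult powr_powr)
      also have "norm x powr (- (real CARD('n) + s) * q) \<le> norm x powr - (real CARD('n) + s)"
      proof (rule powr_mono)
        show "- (real CARD('n) + s) * q \<le> - (real CARD('n) + s)"
          using mult_left_mono[OF q, of "real CARD('n) + s"] s by simp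
      qed (use False R in simp)
      finally show ?thesis using False R by (simp add: riesz_majorant_def mult_left_mono)
    qed
    then show "AE x in lborel. norm (norm (reg_frac_grad s 0 \<psi> x) powr q) \<le>
        norm (C powr q * indicator (cball 0 (2 * R)) x + c powr q * riesz_majorant s x)"
      by (intro AE_I2) (smt (verit, best) real_norm_def powr_ge_zero)
  qed simp
qed

lemma frac_grad_smooth_Lq:
  fixes \<psi> :: "real^'n \<Rightarrow> real"
  assumes \<psi>: "\<psi> \<in> test_functions UNIV" and q: "1 \<le> q"
  shows "frac_grad_smooth s \<psi> \<in> borel_measurable borel"
    and "integrable lborel (\<lambda>x. norm (frac_grad_smooth s \<psi> x) powr q)"
proof -
  have eq: "frac_grad_smooth s \<psi> = (\<lambda>x. riesz_const TYPE('n) s *\<^sub>R reg_frac_grad s 0 \<psi> x)"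
    using frac_grad_smooth_eq[OF borel_measurable_smooth_fun[OF test_functions_smooth[OF \<psi>]]] by blast
  show "frac_grad_smooth s \<psi> \<in> borel_measurable borel"
    unfolding eq using reg_frac_grad_measurable[OF \<psi>] by simp
  show "integrable lborel (\<lambda>x. norm (frac_grad_smooth s \<psi> x) powr q)"
    unfolding eq using integrable_reg_frac_grad_powr[OF \<psi> q] by (simp add: powr_mult)
qed

lemma frac_grad_smooth_diff:
  fixes \<psi> \<psi>' :: "real^'n \<Rightarrow> real"
  assumes \<psi>: "\<psi> \<in> test_functions UNIV" "\<psi>' \<in> test_functions UNIV"
  shows "frac_grad_smooth s (\<lambda>x. \<psi> x - \<psi>' x) x = frac_grad_smooth s \<psi> x - frac_grad_smooth s \<psi>' x"
proof -
  note m = borel_measurable_smooth_fun[OF test_functions_smooth]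
  have "reg_frac_grad s 0 (\<lambda>x. \<psi> x - \<psi>' x) x = (LINT h|lborel. (\<psi> (x + h) - \<psi> x) *\<^sub>R riesz_kernel s 0 h
      - (\<psi>' (x + h) - \<psi>' x) *\<^sub>R riesz_kernel s 0 h)"
    unfolding reg_frac_grad_def by (intro Bochner_Integration.integral_cong) (auto simp: scaleR_diff_left[symmetric])
  also have "\<dots> = reg_frac_grad s 0 \<psi> x - reg_frac_grad s 0 \<psi>' x"
    unfolding reg_frac_grad_def using integrable_reg_frac_grad[OF \<psi>(1) n s] integrable_reg_frac_grad[OF \<psi>(2) n s]
    by (intro Bochner_Integration.integral_diff) auto
  finally show ?thesis
    using frac_grad_smooth_eq[OF m[OF \<psi>(1)]] frac_grad_smooth_eq[OF m[OF \<psi>(2)]]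
      frac_grad_smooth_eq[OF m[OF test_functions_diff[OF \<psi>]]]
    by (simp add: scaleR_diff_right)
qed

end


subsection \<open>Completeness of the Lebesgue spaces\<close>

text \<open>A rapidly converging subsequence has an almost everywhere limit, and Fatou's lemma
  estimates the distance of the whole sequence to it. The \<open>q\<close>-th powers are used
  throughout, so the argument covers every \<open>q > 0\<close>.\<close>

lemma Riesz_Fischer:
  fixes f :: "nat \<Rightarrow> 'a \<Rightarrow> 'b::euclidean_space"
  assumes q: "0 < q" and f [measurable]: "\<And>k. f k \<in> borel_measurable M"
    and i: "\<And>k m. integrable M (\<lambda>x. norm (f k x - f m x) powr q)"
    and i0: "\<And>k. integrable M (\<lambda>x. norm (f k x) powr q)"
    and cauchy: "\<And>e. 0 < e \<Longrightarrow> \<exists>N. \<forall>k\<ge>N. \<forall>m\<ge>N. (LINT x|M. norm (f k x - f m x) powr q) < e"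
  obtains g where "g \<in> borel_measurable M" "integrable M (\<lambda>x. norm (g x) powr q)"
    "\<And>k. integrable M (\<lambda>x. norm (f k x - g x) powr q)"
    "(\<lambda>k. LINT x|M. norm (f k x - g x) powr q) \<longlonglongrightarrow> 0"
proof -
  \<comment> \<open>One factor pays for the division by \<open>((1/2)^j) powr q\<close>, the other
    makes the quotients summable. Almost everywhere the quotients therefore tend to 0, so the
    increments are eventually at most \<open>(1/2)^j\<close>.\<close>
  define e where "e j = (1/2)^j * ((1/2)^j) powr q" for j :: nat
  have e: "e j > 0" for j by (simp add: e_def)
  obtain N where N: "\<And>j k m. N j \<le> k \<Longrightarrow> N j \<le> m \<Longrightarrow> (LINT x|M. norm (f k x - f m x) powr q) < e j"
    using cauchy[OF e] by metis
  \<comment> \<open>Taking the maximum over all earlier thresholds lets \<open>r i\<close> serve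
    every accuracy \<open>e j\<close> with \<open>j \<le> i\<close>.\<close>
  define r where "r j = Max (N ` {..j}) + j" for j
  have rN: "N j \<le> r i" if "j \<le> i" for i j
  proof -
    have "N j \<le> Max (N ` {..i})" using that by (intro Max_ge) auto
    then show ?thesis by (simp add: r_def)
  qed
  define d where "d j x = f (r (Suc j)) x - f (r j) x" for j x
  have [measurable]: "d j \<in> borel_measurable M" for j unfolding d_def by simp
  have dint: "(\<integral>\<^sup>+x. ennreal (norm (d j x) powr q / ((1/2)^j) powr q) \<partial>M) \<le> ennreal ((1/2)^j)" for j
  proof -
    have "(\<integral>\<^sup>+x. ennreal (norm (d j x) powr q / ((1/2)^j) powr q) \<partial>M)
      = ennreal (LINT x|M. norm (d j x) powr q / ((1/2)^j) powr q)"
      using i[of "r (Suc j)" "r j"] by (intro nn_integral_eq_integral) (auto simp: d_def)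
    also have "\<dots> \<le> ennreal (e j / ((1/2)^j) powr q)"
      using N[OF rN rN, of j "Suc j" j] by (intro ennreal_leI) (simp add: d_def divide_right_mono)
    finally show ?thesis by (simp add: e_def)
  qed
  have "(\<integral>\<^sup>+x. (\<Sum>j. ennreal (norm (d j x) powr q / ((1/2)^j) powr q)) \<partial>M) < \<infinity>"
  proof -
    have "(\<integral>\<^sup>+x. (\<Sum>j. ennreal (norm (d j x) powr q / ((1/2)^j) powr q)) \<partial>M)
      = (\<Sum>j. \<integral>\<^sup>+x. ennreal (norm (d j x) powr q / ((1/2)^j) powr q) \<partial>M)"
      by (rule nn_integral_suminf) simp
    also have "\<dots> \<le> (\<Sum>j. ennreal ((1/2)^j))" by (intro suminf_le dint) auto
    also have "\<dots> = ennreal (\<Sum>j. (1/2)^j)" by (intro suminf_ennreal2 summable_geometric) auto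
    also have "\<dots> < \<infinity>" by simp
    finally show ?thesis .
  qed
  then have "AE x in M. (\<Sum>j. ennreal (norm (d j x) powr q / ((1/2)^j) powr q)) \<noteq> \<infinity>"
    by (intro nn_integral_PInf_AE) auto
  then have conv: "AE x in M. convergent (\<lambda>j. f (r j) x)"
  proof eventually_elim
    case (elim x)
    then have "summable (\<lambda>j. norm (d j x) powr q / ((1/2)^j) powr q)"
      by (intro summable_suminf_not_top) auto
    then have "(\<lambda>j. norm (d j x) powr q / ((1/2)^j) powr q) \<longlonglongrightarrow> 0" by (rule summable_LIMSEQ_zero)
    then have "\<forall>\<^sub>F j in sequentially. norm (d j x) powr q / ((1/2)^j) powr q < 1"
      by (rule order_tendstoD) simp
    then have "\<forall>\<^sub>F j in sequentially. norm (d j x) \<le> (1/2)^j"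
    proof eventually_elim
      case (elim j)
      then have "norm (d j x) powr q < ((1/2)^j) powr q" by (simp add: field_simps)
      then show ?case using q by (meson not_le powr_mono2 less_imp_le norm_ge_zero zero_le_power zero_le_divide_1_iff zero_le_numeral linorder_not_less)
    qed
    then have "summable (\<lambda>j. d j x)"
      by (rule summable_comparison_test_ev) (intro summable_geometric, simp)
    moreover have "(\<Sum>i<j. d i x) = f (r j) x - f (r 0) x" for j
      using sum_lessThan_telescope[of "\<lambda>i. f (r i) x" j] by (simp add: d_def)
    ultimately have "convergent (\<lambda>j. f (r j) x - f (r 0) x)" by (simp add: summable_iff_convergent)
    then show ?case using convergent_diff_const_right_iff by blast
  qed
  define g where "g x = lim (\<lambda>j. f (r j) x)" for x
  have gm [measurable]: "g \<in> borel_measurable M" unfolding g_def by simp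
  have lim: "AE x in M. (\<lambda>j. f (r j) x) \<longlonglongrightarrow> g x"
    using conv by eventually_elim (simp add: g_def convergent_LIMSEQ_iff)
  have fatou: "(\<integral>\<^sup>+x. ennreal (norm (f k x - g x) powr q) \<partial>M) \<le> ennreal (e j)" if k: "k \<ge> N j" for k j
  proof -
    have "AE x in M. ennreal (norm (f k x - g x) powr q) = liminf (\<lambda>i. ennreal (norm (f k x - f (r i) x) powr q))"
      using lim
    proof eventually_elim
      case (elim x)
      have "(\<lambda>i. ennreal (norm (f k x - f (r i) x) powr q)) \<longlonglongrightarrow> ennreal (norm (f k x - g x) powr q)"
        using q by (intro tendsto_intros elim tendsto_ennrealI tendsto_powr') auto
      then show ?case by (intro lim_imp_Liminf[symmetric]) auto
    qed
    then have "(\<integral>\<^sup>+x. ennreal (norm (f k x - g x) powr q) \<partial>M) =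
        (\<integral>\<^sup>+x. liminf (\<lambda>i. ennreal (norm (f k x - f (r i) x) powr q)) \<partial>M)"
      by (rule nn_integral_cong_AE)
    also have "\<dots> \<le> liminf (\<lambda>i. \<integral>\<^sup>+x. ennreal (norm (f k x - f (r i) x) powr q) \<partial>M)"
      by (rule nn_integral_liminf) simp
    also have "\<dots> \<le> ennreal (e j)"
    proof (rule Liminf_le)
      have "\<forall>i\<ge>j. (\<integral>\<^sup>+x. ennreal (norm (f k x - f (r i) x) powr q) \<partial>M) \<le> ennreal (e j)"
      proof safe
        fix l assume "l \<ge> j"
        have "(\<integral>\<^sup>+x. ennreal (norm (f k x - f (r l) x) powr q) \<partial>M) = ennreal (LINT x|M. norm (f k x - f (r l) x) powr q)"
          using i by (intro nn_integral_eq_integral) auto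
        also have "\<dots> \<le> ennreal (e j)" using N[OF k rN[OF \<open>l \<ge> j\<close>]] by (intro ennreal_leI) simp
        finally show "(\<integral>\<^sup>+x. ennreal (norm (f k x - f (r l) x) powr q) \<partial>M) \<le> ennreal (e j)" .
      qed
      then show "\<forall>\<^sub>F i in sequentially. (\<integral>\<^sup>+x. ennreal (norm (f k x - f (r i) x) powr q) \<partial>M) \<le> ennreal (e j)"
        unfolding eventually_sequentially by blast
    qed simp
    finally show ?thesis .
  qed
  have i1: "integrable M (\<lambda>x. norm (f k x - g x) powr q)" if "k \<ge> N 0" for k
  proof (rule integrableI_nonneg)
    show "(\<integral>\<^sup>+x. ennreal (norm (f k x - g x) powr q) \<partial>M) < \<infinity>"
      using fatou[OF that] by (rule order_le_less_trans) simp
  qed auto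
  have "integrable M (\<lambda>x. norm (f (N 0) x - (f (N 0) x - g x)) powr q)"
    using q by (intro integrable_norm_powr_diff i0 i1) auto
  then have ig: "integrable M (\<lambda>x. norm (g x) powr q)" by simp
  have ik: "integrable M (\<lambda>x. norm (f k x - g x) powr q)" for k
    using q by (intro integrable_norm_powr_diff i0 ig) auto
  have "(\<lambda>k. LINT x|M. norm (f k x - g x) powr q) \<longlonglongrightarrow> 0"
  proof (rule LIMSEQ_I)
    fix \<epsilon> :: real assume "\<epsilon> > 0"
    then obtain j where j: "(1/2)^j < \<epsilon>" using real_arch_pow_inv[of \<epsilon> "1/2"] by auto
    have "((1/2::real)^j) powr q \<le> 1 powr q" using q by (intro powr_mono2) (auto simp: power_le_one)
    then have ej: "e j \<le> (1/2)^j" by (simp add: e_def mult_left_le)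
    have "norm ((LINT x|M. norm (f k x - g x) powr q) - 0) < \<epsilon>" if "k \<ge> N j" for k
    proof -
      have "ennreal (LINT x|M. norm (f k x - g x) powr q) \<le> ennreal (e j)"
        using fatou[OF that] ik by (simp add: nn_integral_eq_integral)
      then have "(LINT x|M. norm (f k x - g x) powr q) \<le> e j" using e[of j] by (simp add: less_imp_le)
      moreover have "0 \<le> (LINT x|M. norm (f k x - g x) powr q)" by (rule Bochner_Integration.integral_nonneg) simp
      ultimately show ?thesis using j ej by simp
    qed
    then show "\<exists>no. \<forall>k\<ge>no. norm ((LINT x|M. norm (f k x - g x) powr q) - 0) < \<epsilon>" by blast
  qed
  then show ?thesis using that gm ig ik by blast
qed


subsection \<open>Approximation of the fractional gradient by gradients\<close>

text \<open>\<open>frac_grad\<close> is a choice, so a candidate must exist: the Cauchy condition in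
  the Sobolev norm makes the fractional gradients of the approximating test functions Cauchy in
  \<open>L\<^sup>q\<close>, and completeness provides their limit.\<close>

lemma frac_grad_properties:
  fixes u :: "real^'n::finite \<Rightarrow> real"
  assumes n: "CARD('n) \<ge> 2" and s: "0 < s" "s < 1" and q: "1 < q" and u: "u \<in> Hsq s q"
  shows "frac_grad s q u \<in> Lq q UNIV"
    and "\<exists>\<psi>. Hsq_approx s q \<psi> u \<and>
      (\<lambda>k. Lq_norm q UNIV (\<lambda>x. frac_grad_smooth s (\<psi> k) x - frac_grad s q u x)) \<longlonglongrightarrow> 0"
proof -
  obtain \<psi> where \<psi>: "Hsq_approx s q \<psi> u" using u unfolding Hsq_def by blast
  have t: "\<psi> k \<in> test_functions UNIV" for k using \<psi> by (simp add: Hsq_approx_def)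
  define f where "f k = frac_grad_smooth s (\<psi> k)" for k
  have fm: "f k \<in> borel_measurable lebesgue" for k
    using frac_grad_smooth_Lq(1)[OF n s t, of q] q by (simp add: f_def measurable_completion)
  have fi: "integrable lebesgue (\<lambda>x. norm (f k x) powr q)" for k
    using frac_grad_smooth_Lq[OF n s t, of q k] q by (simp add: f_def integrable_completion)
  have fd: "integrable lebesgue (\<lambda>x. norm (f k x - f m x) powr q)" for k m
    using q by (intro integrable_norm_powr_diff fm fi) auto
  have cauchy: "\<exists>N. \<forall>k\<ge>N. \<forall>m\<ge>N. (LINT x|lebesgue. norm (f k x - f m x) powr q) < e" if "0 < e" for e
  proof -
    have "0 < e powr (1 / q)" using that by simp
    then obtain N where N: "\<And>k m. k \<ge> N \<Longrightarrow> m \<ge> N \<Longrightarrow> Hsq_norm_smooth s q (\<lambda>x. \<psi> k x - \<psi> m x) < e powr (1 / q)"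
      using \<psi> unfolding Hsq_approx_def by metis
    have "(LINT x|lebesgue. norm (f k x - f m x) powr q) < e" if "k \<ge> N" "m \<ge> N" for k m
    proof -
      define H where "H = Lq_norm q UNIV (\<lambda>x. \<psi> k x - \<psi> m x) powr q
        + Lq_norm q UNIV (frac_grad_smooth s (\<lambda>x. \<psi> k x - \<psi> m x)) powr q"
      have "H powr (1 / q) < e powr (1 / q)"
        using N[OF that] by (simp add: Hsq_norm_smooth_def H_def)
      moreover have "H \<ge> 0" by (simp add: H_def)
      ultimately have "H < e" using q by (metis not_le powr_mono2 divide_nonneg_nonneg less_eq_real_def \<open>0 < e\<close> zero_less_one order.strict_trans)
      moreover have "Lq_norm q UNIV (frac_grad_smooth s (\<lambda>x. \<psi> k x - \<psi> m x)) powr q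
          = (LINT x|lebesgue. norm (f k x - f m x) powr q)"
        using q frac_grad_smooth_diff[OF n s t t, of k m]
        by (simp add: Lq_norm_powr lebesgue_on_UNIV_eq f_def)
      ultimately show ?thesis using powr_ge_zero[of "Lq_norm q UNIV (\<lambda>x. \<psi> k x - \<psi> m x)" q]
        unfolding H_def by linarith
    qed
    then show ?thesis by blast
  qed
  obtain g where g: "g \<in> borel_measurable lebesgue" "integrable lebesgue (\<lambda>x. norm (g x) powr q)"
    "(\<lambda>k. LINT x|lebesgue. norm (f k x - g x) powr q) \<longlonglongrightarrow> 0"
    by (rule Riesz_Fischer[OF _ fm fd fi cauchy]) (use q in auto)
  have "g \<in> Lq q UNIV" using g by (simp add: Lq_def lebesgue_on_UNIV_eq)
  moreover have "(\<lambda>k. Lq_norm q UNIV (\<lambda>x. frac_grad_smooth s (\<psi> k) x - g x)) \<longlonglongrightarrow> 0"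
  proof -
    have "(\<lambda>k. (LINT x|lebesgue. norm (f k x - g x) powr q) powr (1 / q)) \<longlonglongrightarrow> 0 powr (1 / q)"
      using q by (intro tendsto_powr'[OF g(3) tendsto_const]) (auto intro!: always_eventually Bochner_Integration.integral_nonneg)
    then show ?thesis by (simp add: Lq_norm_def lebesgue_on_UNIV_eq f_def)
  qed
  ultimately have "\<exists>V. V \<in> Lq q UNIV \<and> (\<exists>\<psi>. Hsq_approx s q \<psi> u \<and>
     (\<lambda>k. Lq_norm q UNIV (\<lambda>x. frac_grad_smooth s (\<psi> k) x - V x)) \<longlonglongrightarrow> 0)"
    using \<psi> by blast
  from someI_ex[OF this]
  show "frac_grad s q u \<in> Lq q UNIV"
    and "\<exists>\<psi>. Hsq_approx s q \<psi> u \<and>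
      (\<lambda>k. Lq_norm q UNIV (\<lambda>x. frac_grad_smooth s (\<psi> k) x - frac_grad s q u x)) \<longlonglongrightarrow> 0"
    unfolding frac_grad_def by blast+
qed

lemma finite_measure_lebesgue_on_bounded:
  fixes U :: "'a::euclidean_space set"
  assumes "bounded U" "U \<in> sets lebesgue"
  shows "finite_measure (lebesgue_on U)"
proof
  have "emeasure lebesgue U < \<infinity>"
  proof -
    obtain R where "U \<subseteq> cball 0 R" using assms(1) by (auto simp: bounded_iff subset_eq)
    then have "emeasure lebesgue U \<le> emeasure lebesgue (cball (0::'a) R)" by (rule emeasure_mono) simp
    also have "\<dots> < \<infinity>" using emeasure_lborel_cball_less_top by (simp add: emeasure_completion)
    finally show ?thesis .
  qed
  then show "emeasure (lebesgue_on U) (space (lebesgue_on U)) \<noteq> \<infinity>"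
    using assms(2) by (simp add: emeasure_restrict_space)
qed

text \<open>Two errors are added: from \<open>frac_grad\<close> to the fractional gradient of a test
  function, small on the whole space, and from there to the regularised gradient, small on
  \<open>U\<close>. On the bounded set \<open>U\<close> the uniform bound is integrable, whence
  dominated convergence.\<close>

lemma frac_grad_approx_grad:
  fixes u :: "real^'n::finite \<Rightarrow> real"
  assumes n: "CARD('n) \<ge> 2" and s: "0 < s" "s < 1" and q: "1 < q" and u: "u \<in> Hsq s q"
    and U: "bounded U" "U \<in> sets lebesgue" and e: "0 < e"
  shows "\<exists>v. smooth_fun v \<and> integrable (lebesgue_on U) (\<lambda>x. norm (grad v x) powr q) \<and>
    (LINT x|lebesgue_on U. norm (grad v x - frac_grad s q u x) powr q) < e"
proof -
  let ?V = "frac_grad s q u" and ?M = "lebesgue_on U"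
  note FG = frac_grad_properties[OF n s q u]
  obtain \<psi> where \<psi>: "Hsq_approx s q \<psi> u"
    "(\<lambda>k. Lq_norm q UNIV (\<lambda>x. frac_grad_smooth s (\<psi> k) x - ?V x)) \<longlonglongrightarrow> 0"
    using FG(2) by blast
  have Vm: "?V \<in> borel_measurable lebesgue" and Vi: "integrable lebesgue (\<lambda>x. norm (?V x) powr q)"
    using FG(1) by (auto simp: Lq_def lebesgue_on_UNIV_eq)
  have t: "\<psi> k \<in> test_functions UNIV" for k using \<psi> by (simp add: Hsq_approx_def)
  \<comment> \<open>The 2 counts the two errors, and \<open>2 powr q\<close> is the constant of the
    quasi-triangle inequality.\<close>
  define \<epsilon> where "\<epsilon> = e / (2 * 2 powr q)"
  have \<epsilon>: "\<epsilon> > 0" using e by (simp add: \<epsilon>_def)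
  have "(\<lambda>k. Lq_norm q UNIV (\<lambda>x. frac_grad_smooth s (\<psi> k) x - ?V x) powr q) \<longlonglongrightarrow> 0 powr q"
    using q by (intro tendsto_powr'[OF \<psi>(2) tendsto_const]) (auto simp: Lq_norm_def)
  then have "\<forall>\<^sub>F k in sequentially. Lq_norm q UNIV (\<lambda>x. frac_grad_smooth s (\<psi> k) x - ?V x) powr q < \<epsilon>"
    using \<epsilon> q by (intro order_tendstoD) auto
  then obtain k where k: "(LINT x|lebesgue. norm (frac_grad_smooth s (\<psi> k) x - ?V x) powr q) < \<epsilon>"
    using q by (auto simp: eventually_sequentially Lq_norm_powr lebesgue_on_UNIV_eq)
  let ?G = "frac_grad_smooth s (\<psi> k)" and ?c = "riesz_const TYPE('n) s"
  have Gm: "?G \<in> borel_measurable borel" and Gi: "integrable lborel (\<lambda>x. norm (?G x) powr q)"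
    using frac_grad_smooth_Lq[OF n s t, of q k] q by auto
  have Geq: "?G x = ?c *\<^sub>R reg_frac_grad s 0 (\<psi> k) x" for x
    by (rule frac_grad_smooth_eq[OF borel_measurable_smooth_fun[OF test_functions_smooth[OF t]]])
  define v where "v i x = ?c * correlate (riesz_potential_kernel s (inverse (real (Suc i)))) (\<psi> k) x" for i x
  have sm: "smooth_fun (v i)" and gv: "grad (v i) x = ?c *\<^sub>R reg_frac_grad s (inverse (real (Suc i))) (\<psi> k) x" for i x
  proof -
    have e: "inverse (real (Suc i)) > 0" by simp
    show "smooth_fun (v i)" unfolding v_def[abs_def]
      by (rule smooth_fun_cmult[OF reg_frac_grad_eq_grad(1)[OF t n s e]])
    show "grad (v i) x = ?c *\<^sub>R reg_frac_grad s (inverse (real (Suc i))) (\<psi> k) x" unfolding v_def[abs_def]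
      by (subst grad_cmult[OF reg_frac_grad_eq_grad(1)[OF t n s e]]) (simp only: reg_frac_grad_eq_grad(2)[OF t n s e])
  qed
  obtain C where C: "0 < C" "\<And>x e. 0 \<le> e \<Longrightarrow> norm (reg_frac_grad s e (\<psi> k) x) \<le> C"
    using reg_frac_grad_bounded[OF t n s] by blast
  interpret M: finite_measure ?M using finite_measure_lebesgue_on_bounded[OF U] .
  have vm: "grad (v i) \<in> borel_measurable ?M" for i
    by (intro borel_measurable_lebesgue_onI borel_measurable_grad sm)
  have Gm': "?G \<in> borel_measurable ?M" by (intro borel_measurable_lebesgue_onI Gm)
  have vb: "norm (grad (v i) x) \<le> \<bar>?c\<bar> * C" for i x
    unfolding gv using C(2)[of "inverse (real (Suc i))" x] by (simp add: mult_left_mono)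
  have Gb: "norm (?G x) \<le> \<bar>?c\<bar> * C" for x
    unfolding Geq using C(2)[of 0 x] by (simp add: mult_left_mono)
  have bd: "norm (grad (v i) x - ?G x) powr q \<le> (2 * (\<bar>?c\<bar> * C)) powr q" for i x
    using q norm_triangle_ineq4[of "grad (v i) x" "?G x"] vb[of i x] Gb[of x] by (intro powr_mono2) auto
  have "(\<lambda>i. LINT x|?M. norm (grad (v i) x - ?G x) powr q) \<longlonglongrightarrow> (LINT x|?M. 0)"
  proof (rule integral_dominated_convergence[where w = "\<lambda>_. (2 * (\<bar>?c\<bar> * C)) powr q"])
    show "AE x in ?M. (\<lambda>i. norm (grad (v i) x - ?G x) powr q) \<longlonglongrightarrow> 0"
    proof (rule AE_I2)
      fix x
      have "(\<lambda>i. grad (v i) x - ?G x) \<longlonglongrightarrow> ?c *\<^sub>R reg_frac_grad s 0 (\<psi> k) x - ?G x"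
        unfolding gv by (intro tendsto_intros reg_frac_grad_tendsto[OF t n s])
      then have "(\<lambda>i. norm (grad (v i) x - ?G x)) \<longlonglongrightarrow> 0"
        unfolding Geq by (simp add: tendsto_norm_zero)
      then have "(\<lambda>i. norm (grad (v i) x - ?G x) powr q) \<longlonglongrightarrow> 0 powr q"
        using q by (intro tendsto_powr'[OF _ tendsto_const]) auto
      then show "(\<lambda>i. norm (grad (v i) x - ?G x) powr q) \<longlonglongrightarrow> 0" using q by simp
    qed
  qed (use vm Gm' bd in auto)
  then have "\<forall>\<^sub>F i in sequentially. (LINT x|?M. norm (grad (v i) x - ?G x) powr q) < \<epsilon>"
    using \<epsilon> by (intro order_tendstoD) auto
  then obtain i where i: "(LINT x|?M. norm (grad (v i) x - ?G x) powr q) < \<epsilon>"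
    by (auto simp: eventually_sequentially)
  have vi: "integrable ?M (\<lambda>x. norm (grad (v i) x) powr q)"
  proof (rule M.integrable_const_bound[where B = "(\<bar>?c\<bar> * C) powr q"])
    show "AE x in ?M. norm (norm (grad (v i) x) powr q) \<le> (\<bar>?c\<bar> * C) powr q"
      using vb q by (auto intro!: powr_mono2)
  qed (use vm[of i] in simp)
  have Vm': "?V \<in> borel_measurable ?M" using Vm by (rule measurable_restrict_space1)
  have GV: "integrable lebesgue (\<lambda>x. norm (?G x - ?V x) powr q)"
    using q Gi Gm by (intro integrable_norm_powr_diff Vm Vi) (auto simp: integrable_completion measurable_completion)
  have GV': "integrable ?M (\<lambda>x. norm (?G x - ?V x) powr q)"
    using integrable_mult_indicator[OF U(2) GV] U(2) by (simp add: integrable_restrict_space)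
  have "(LINT x|?M. norm (?G x - ?V x) powr q) \<le> (LINT x|lebesgue. norm (?G x - ?V x) powr q)"
    using U(2) GV integrable_mult_indicator[OF U(2) GV]
    by (subst integral_restrict_space) (auto intro!: integral_mono simp: indicator_def)
  then have j: "(LINT x|?M. norm (?G x - ?V x) powr q) < \<epsilon>" using k by linarith
  have vG: "integrable ?M (\<lambda>x. norm (grad (v i) x - ?G x) powr q)"
    by (rule M.integrable_const_bound[where B = "(2 * (\<bar>?c\<bar> * C)) powr q"]) (use bd vm[of i] Gm' in auto)
  have "(LINT x|?M. norm ((grad (v i) x - ?G x) + (?G x - ?V x)) powr q) \<le>
    2 powr q * ((LINT x|?M. norm (grad (v i) x - ?G x) powr q) + (LINT x|?M. norm (?G x - ?V x) powr q))"
    using q vm[of i] Gm' Vm' vG GV' by (intro integrable_norm_powr_add(2)) auto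
  also have "\<dots> < 2 powr q * (\<epsilon> + \<epsilon>)" using i j by (intro mult_strict_left_mono add_strict_mono) auto
  also have "\<dots> = e" by (simp add: \<epsilon>_def)
  finally have "(LINT x|?M. norm (grad (v i) x - ?V x) powr q) < e" by simp
  then show ?thesis using sm vi by blast
qed

subsection \<open>Compactness\<close>

text \<open>A Borel version of \<open>lebesgue_on (ball z r)\<close>, suited to product
  measurability and Fubini's theorem. \<open>lebesgue_on_ball\<close> leads back to the completed
  measure.\<close>

definition ball_measure :: "real^'n::finite \<Rightarrow> real \<Rightarrow> (real^'n) measure" where
  "ball_measure z r = restrict_space lborel (ball z r)"

definition unit_interval :: "real measure" where
  "unit_interval = restrict_space lborel {0..1}"

lemma space_ball_measure [simp]: "space (ball_measure z r) = ball z r"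
  by (simp add: ball_measure_def space_restrict_space)

lemma space_unit_interval [simp]: "space unit_interval = {0..1}"
  by (simp add: unit_interval_def space_restrict_space)

lemma ball_measurable [measurable]: "ball (c::'a::euclidean_space) r \<in> sets borel"
  by simp

lemma integral_ball_measure:
  fixes f :: "real^'n::finite \<Rightarrow> 'b::{banach, second_countable_topology}"
  shows "(LINT x|ball_measure z r. f x) = (LINT x|lborel. indicator (ball z r) x *\<^sub>R f x)"
    and "integrable (ball_measure z r) f \<longleftrightarrow> integrable lborel (\<lambda>x. indicator (ball z r) x *\<^sub>R f x)"
  unfolding ball_measure_def by (subst integral_restrict_space integrable_restrict_space; simp)+

lemma lebesgue_on_ball:
  fixes f :: "real^'n::finite \<Rightarrow> 'b::{banach, second_countable_topology}"
  assumes [measurable]: "f \<in> borel_measurable borel"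
  shows "(LINT x|lebesgue_on (ball z r). f x) = (LINT x|ball_measure z r. f x)"
  unfolding integral_ball_measure
  by (subst integral_restrict_space, simp, rule integral_completion) measurable

lemma finite_measure_ball_measure: "finite_measure (ball_measure z r)"
proof
  have "emeasure lborel (ball z r) \<le> emeasure lborel (cball z r)" by (intro emeasure_mono) auto
  also have "\<dots> < \<infinity>" using emeasure_lborel_cball_less_top by simp
  finally show "emeasure (ball_measure z r) (space (ball_measure z r)) \<noteq> \<infinity>"
    by (simp add: ball_measure_def emeasure_restrict_space)
qed

lemma finite_measure_unit_interval: "finite_measure unit_interval"
  by standard (simp add: unit_interval_def emeasure_restrict_space)

lemma measure_ball_measure: "measure (ball_measure z r) (ball z r) = measure lborel (ball z r)"
  by (simp add: ball_measure_def measure_restrict_space)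

lemma measure_unit_interval: "measure unit_interval {0..1} = 1"
  by (simp add: unit_interval_def measure_restrict_space)

lemma ball_measure_ident [measurable]:
  "(\<lambda>x. x) \<in> borel_measurable (ball_measure z r)"
  unfolding ball_measure_def by (intro measurable_restrict_space1) simp

lemma unit_interval_ident [measurable]: "(\<lambda>x. x) \<in> borel_measurable unit_interval"
  unfolding unit_interval_def by (intro measurable_restrict_space1) simp

lemma ball_measure_borel:
  "f \<in> borel_measurable borel \<Longrightarrow> f \<in> borel_measurable (ball_measure z r)"
  unfolding ball_measure_def by (intro measurable_restrict_space1) simp

lemma fst_ball_measure [measurable]: "fst \<in> borel_measurable (ball_measure z r \<Otimes>\<^sub>M M)"
  using measurable_compose[OF measurable_fst ball_measure_ident] by (simp add: o_def)

lemma snd_ball_measure [measurable]: "snd \<in> borel_measurable (M \<Otimes>\<^sub>M ball_measure z r)"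
  using measurable_compose[OF measurable_snd ball_measure_ident] by (simp add: o_def)

lemma snd_unit_interval [measurable]: "snd \<in> borel_measurable (M \<Otimes>\<^sub>M unit_interval)"
  using measurable_compose[OF measurable_snd unit_interval_ident] by (simp add: o_def)

lemma convex_comb_in_ball:
  fixes x c z :: "'a::real_normed_vector"
  assumes "x \<in> ball z r" "c \<in> ball z r" "0 \<le> t" "t \<le> (1::real)"
  shows "(1 - t) *\<^sub>R c + t *\<^sub>R x \<in> ball z r"
  using convexD[OF convex_ball, of c z r x "1 - t" t] assms by simp

lemma continuous_bounded_on_ball:
  fixes f :: "real^'n::finite \<Rightarrow> 'b::real_normed_vector"
  assumes "continuous_on UNIV f"
  obtains C where "C > 0" "\<And>x. x \<in> ball z r \<Longrightarrow> norm (f x) \<le> C"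
proof -
  have "bounded (f ` cball z r)"
    using assms by (intro compact_imp_bounded compact_continuous_image) (auto intro: continuous_on_subset)
  then obtain C where "C > 0" "\<And>x. x \<in> cball z r \<Longrightarrow> norm (f x) \<le> C" by (auto simp: bounded_pos)
  then show ?thesis using that[of C] by auto
qed

text \<open>The contraction towards \<open>c\<close> by the factor \<open>t\<close> maps the ball
  into itself with Jacobian \<open>t ^ CARD('n)\<close>, and as \<open>g\<close> is nonnegative the
  integral over the image is at most that over the ball.\<close>

lemma integral_convex_comb_le:
  fixes g :: "real^'n::finite \<Rightarrow> real"
  assumes g: "continuous_on UNIV g" "\<And>x. 0 \<le> g x" and c: "c \<in> ball z r" and t: "0 < t" "t \<le> 1"
  shows "(LINT x|ball_measure z r. g ((1 - t) *\<^sub>R c + t *\<^sub>R x)) \<le> (1 / t ^ CARD('n)) * (LINT x|ball_measure z r. g x)"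
proof -
  have [measurable]: "g \<in> borel_measurable borel" using g by (intro borel_measurable_continuous_onI)
  obtain C where C: "C > 0" "\<And>x. x \<in> ball z r \<Longrightarrow> norm (g x) \<le> C"
    using continuous_bounded_on_ball[OF g(1)] by blast
  define G where "G y = indicator (ball z r) y * g y" for y
  have [measurable]: "G \<in> borel_measurable borel" unfolding G_def by measurable
  have Gi: "integrable lborel G"
    by (rule integrable_bounded_support[of _ "ball z r" C]) (use C in \<open>auto simp: G_def indicator_def\<close>)
  have eq: "(LINT y|lborel. G y) = \<bar>t\<bar> ^ DIM(real^'n) *\<^sub>R (LINT x|lborel. G ((1 - t) *\<^sub>R c + t *\<^sub>R x))"
    using t by (intro lborel_integral_affine) auto
  have Gi': "integrable lborel (\<lambda>x. G ((1 - t) *\<^sub>R c + t *\<^sub>R x))"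
    using t Gi by (subst lborel_integral_affine(2)) auto
  have "(LINT x|ball_measure z r. g ((1 - t) *\<^sub>R c + t *\<^sub>R x)) \<le> (LINT x|lborel. G ((1 - t) *\<^sub>R c + t *\<^sub>R x))"
    unfolding integral_ball_measure
    by (rule integral_mono'[OF Gi'])
       (use g(2) c t in \<open>auto simp: G_def indicator_def simp del: mem_ball intro: convex_comb_in_ball\<close>)
  also have "\<dots> = (1 / t ^ CARD('n)) * (LINT x|ball_measure z r. g x)"
    using eq t unfolding integral_ball_measure G_def by (simp add: field_simps)
  finally show ?thesis .
qed

text \<open>For \<open>h = grad v\<close> this is the integrand in \<open>t\<close> of
  \<open>v x - v c\<close>, expressed along the segment from \<open>c\<close> to \<open>x\<close>,
  after integration over all \<open>c\<close> in the ball.\<close>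

definition radial_mean :: "real^'n::finite \<Rightarrow> real \<Rightarrow> (real^'n \<Rightarrow> real^'n) \<Rightarrow> real^'n \<Rightarrow> real \<Rightarrow> real" where
  "radial_mean z r h x t = (LINT c|ball_measure z r. h ((1 - t) *\<^sub>R c + t *\<^sub>R x) \<bullet> (x - c))"

lemma ball_dist_le:
  "x \<in> ball z r \<Longrightarrow> c \<in> ball z r \<Longrightarrow> norm (x - c) \<le> 2 * r"
  using dist_triangle_less_add[of x z r c r] by (simp add: dist_norm norm_minus_commute dist_commute)

lemma integral_grad_segment:
  assumes "smooth_fun v"
  shows "(LINT t|unit_interval. grad v ((1 - t) *\<^sub>R c + t *\<^sub>R x) \<bullet> (x - c)) = v x - v c"
proof -
  have cont: "isCont (\<lambda>t. grad v ((1 - t) *\<^sub>R c + t *\<^sub>R x) \<bullet> (x - c)) t" for t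
  proof -
    have "continuous_on UNIV (\<lambda>t. grad v ((1 - t) *\<^sub>R c + t *\<^sub>R x) \<bullet> (x - c))"
      by (intro continuous_intros continuous_on_compose2[OF smooth_fun_continuous_grad[OF assms, of UNIV]]) auto
    then show ?thesis by (simp add: continuous_on_eq_continuous_at)
  qed
  have der: "((\<lambda>t. v ((1 - t) *\<^sub>R c + t *\<^sub>R x)) has_real_derivative grad v ((1 - t) *\<^sub>R c + t *\<^sub>R x) \<bullet> (x - c)) (at t)" for t
  proof -
    have "((\<lambda>t. (1 - t) *\<^sub>R c + t *\<^sub>R x) has_derivative (\<lambda>k. k *\<^sub>R (x - c))) (at t)"
      by (auto intro!: derivative_eq_intros simp: algebra_simps)
    from has_derivative_compose[OF this smooth_fun_has_derivative[OF assms]]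
    show ?thesis by (simp add: has_field_derivative_def mult.commute[of _ "_ \<bullet> _"])
  qed
  have "(LINT t|unit_interval. grad v ((1 - t) *\<^sub>R c + t *\<^sub>R x) \<bullet> (x - c))
    = (LINT t|lborel. grad v ((1 - t) *\<^sub>R c + t *\<^sub>R x) \<bullet> (x - c) * indicator {0..1} t)"
    unfolding unit_interval_def by (subst integral_restrict_space) (auto simp: mult.commute)
  also have "\<dots> = v ((1 - 1) *\<^sub>R c + 1 *\<^sub>R x) - v ((1 - 0) *\<^sub>R c + 0 *\<^sub>R x)"
    by (rule integral_FTC_Icc_real) (use der cont in auto)
  finally show ?thesis by simp
qed

lemma radial_mean_measurable:
  fixes h :: "real^'n::finite \<Rightarrow> real^'n"
  assumes h: "h \<in> borel_measurable borel"
  shows "(\<lambda>(x, t). radial_mean z r h x t) \<in> borel_measurable (ball_measure z r \<Otimes>\<^sub>M unit_interval)"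
proof -
  note [measurable] = h
  interpret finite_measure "ball_measure z r" by (rule finite_measure_ball_measure)
  let ?M = "(ball_measure z r \<Otimes>\<^sub>M unit_interval) \<Otimes>\<^sub>M ball_measure z r"
  have [measurable]: "(\<lambda>p. fst (fst p)) \<in> borel_measurable ?M" "(\<lambda>p. snd (fst p)) \<in> borel_measurable ?M"
    "(\<lambda>p. snd p) \<in> borel_measurable ?M"
    using measurable_compose[OF measurable_fst fst_ball_measure] measurable_compose[OF measurable_fst snd_unit_interval]
      snd_ball_measure by auto
  have "(\<lambda>p. h ((1 - snd (fst p)) *\<^sub>R snd p + snd (fst p) *\<^sub>R fst (fst p)) \<bullet> (fst (fst p) - snd p)) \<in> borel_measurable ?M"
    by measurable
  then show ?thesis
    unfolding radial_mean_def case_prod_beta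
    by (intro borel_measurable_lebesgue_integral) (simp add: case_prod_beta)
qed

text \<open>Here \<open>c\<close> is the variable, so the map from \<open>c\<close> to
  \<open>(1 - t) c + t x\<close> has Jacobian \<open>(1 - t) ^ CARD('n)\<close>. The bound
  degenerates as \<open>t\<close> approaches 1, but is uniform in \<open>x\<close> for each fixed
  \<open>t\<close>.\<close>

lemma radial_mean_bound:
  fixes h :: "real^'n::finite \<Rightarrow> real^'n"
  assumes h: "continuous_on UNIV h" and x: "x \<in> ball z r" and t: "0 \<le> t" "t < 1"
  shows "\<bar>radial_mean z r h x t\<bar> \<le> (2 * r / (1 - t) ^ CARD('n)) * (LINT y|ball_measure z r. norm (h y))"
proof -
  note [measurable] = ball_measure_borel[OF borel_measurable_continuous_onI]
  interpret finite_measure "ball_measure z r" by (rule finite_measure_ball_measure)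
  have hc: "continuous_on UNIV (\<lambda>c. h ((1 - t) *\<^sub>R c + t *\<^sub>R x))"
    by (intro continuous_on_compose2[OF h] continuous_intros) auto
  obtain C where C: "C > 0" "\<And>x. x \<in> ball z r \<Longrightarrow> norm (h x) \<le> C"
    using continuous_bounded_on_ball[OF h] by blast
  have in_ball: "(1 - t) *\<^sub>R c + t *\<^sub>R x \<in> ball z r" if "c \<in> ball z r" for c
    using convex_comb_in_ball[OF x that] t by simp
  have i: "integrable (ball_measure z r) (\<lambda>c. norm (h ((1 - t) *\<^sub>R c + t *\<^sub>R x)) * (2 * r))"
    by (intro integrable_mult_left integrable_const_bound[where B = C] AE_I2 ball_measure_borel borel_measurable_continuous_onI
        continuous_intros hc) (use C(2)[OF in_ball] in auto)
  have "\<bar>radial_mean z r h x t\<bar> \<le> (LINT c|ball_measure z r. norm (h ((1 - t) *\<^sub>R c + t *\<^sub>R x) \<bullet> (x - c)))"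
    unfolding radial_mean_def using integral_norm_bound[of "ball_measure z r"] by fastforce
  also have "\<dots> \<le> (LINT c|ball_measure z r. norm (h ((1 - t) *\<^sub>R c + t *\<^sub>R x)) * (2 * r))"
  proof (rule integral_mono'[OF i])
    fix c assume "c \<in> space (ball_measure z r)"
    then have c: "norm (x - c) \<le> 2 * r" using ball_dist_le[OF x] by simp
    show "norm (h ((1 - t) *\<^sub>R c + t *\<^sub>R x) \<bullet> (x - c)) \<le> norm (h ((1 - t) *\<^sub>R c + t *\<^sub>R x)) * (2 * r)"
      using Cauchy_Schwarz_ineq2[of "h ((1 - t) *\<^sub>R c + t *\<^sub>R x)" "x - c"]
        mult_left_mono[OF c, of "norm (h ((1 - t) *\<^sub>R c + t *\<^sub>R x))"] by simp
    have "0 \<le> r" using x by (simp add: dist_norm) (smt (verit) norm_ge_zero)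
    then show "0 \<le> norm (h ((1 - t) *\<^sub>R c + t *\<^sub>R x)) * (2 * r)" by simp
  qed
  also have "\<dots> = (LINT c|ball_measure z r. norm (h ((1 - (1 - t)) *\<^sub>R x + (1 - t) *\<^sub>R c))) * (2 * r)"
    by (simp add: add.commute)
  also have "\<dots> \<le> (1 / (1 - t) ^ CARD('n)) * (LINT c|ball_measure z r. norm (h c)) * (2 * r)"
  proof (rule mult_right_mono)
    show "0 \<le> 2 * r" using x by (simp add: dist_norm) (smt (verit) norm_ge_zero)
    show "(LINT c|ball_measure z r. norm (h ((1 - (1 - t)) *\<^sub>R x + (1 - t) *\<^sub>R c)))
      \<le> (1 / (1 - t) ^ CARD('n)) * (LINT c|ball_measure z r. norm (h c))"
      using t by (intro integral_convex_comb_le[of "\<lambda>y. norm (h y)"] continuous_intros h x) auto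
  qed
  finally show ?thesis by (simp add: mult_ac)
qed

text \<open>The fundamental theorem of calculus on each segment, integrated over \<open>c\<close>,
  with the order of integration exchanged. Dividing by the volume gives \<open>v x\<close> minus its
  mean.\<close>

lemma radial_mean_rep:
  assumes v: "smooth_fun v" and x: "x \<in> ball z r"
  shows "measure lborel (ball z r) * v x - (LINT c|ball_measure z r. v c) = (LINT t|unit_interval. radial_mean z r (grad v) x t)"
proof -
  let ?N = "ball_measure z r"
  interpret N: finite_measure ?N by (rule finite_measure_ball_measure)
  interpret T: finite_measure unit_interval by (rule finite_measure_unit_interval)
  interpret P: pair_sigma_finite ?N unit_interval ..
  interpret PF: finite_measure "?N \<Otimes>\<^sub>M unit_interval"
    by (rule finite_measure_pair_measure) (rule finite_measure_ball_measure finite_measure_unit_interval)+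
  have [measurable]: "grad v \<in> borel_measurable borel" "v \<in> borel_measurable borel"
    using v by (auto intro: borel_measurable_grad borel_measurable_smooth_fun)
  obtain C where C: "C > 0" "\<And>x. x \<in> ball z r \<Longrightarrow> norm (grad v x) \<le> C"
    using continuous_bounded_on_ball[OF smooth_fun_continuous_grad[OF v]] by blast
  obtain C' where C': "C' > 0" "\<And>x. x \<in> ball z r \<Longrightarrow> norm (v x) \<le> C'"
    using continuous_bounded_on_ball[OF smooth_fun_continuous[OF v]] by blast
  have vi: "integrable ?N v"
    by (rule N.integrable_const_bound[where B = C']) (use C' in \<open>auto intro: ball_measure_borel\<close>)
  let ?f = "\<lambda>c t. grad v ((1 - t) *\<^sub>R c + t *\<^sub>R x) \<bullet> (x - c)"
  have fi: "integrable (?N \<Otimes>\<^sub>M unit_interval) (\<lambda>(c, t). ?f c t)"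
  proof (rule PF.integrable_const_bound[where B = "C * (2 * r)"])
    show "AE p in ?N \<Otimes>\<^sub>M unit_interval. norm (case p of (c, t) \<Rightarrow> ?f c t) \<le> C * (2 * r)"
    proof (rule AE_I2)
      fix p assume "p \<in> space (?N \<Otimes>\<^sub>M unit_interval)"
      then obtain c t where p: "p = (c, t)" "c \<in> ball z r" "0 \<le> t" "t \<le> 1"
        by (auto simp: space_pair_measure simp del: mem_ball)
      have "norm (?f c t) \<le> norm (grad v ((1 - t) *\<^sub>R c + t *\<^sub>R x)) * norm (x - c)"
        using Cauchy_Schwarz_ineq2 by simp
      also have "\<dots> \<le> C * (2 * r)"
        using C convex_comb_in_ball[OF x p(2-4)] ball_dist_le[OF x p(2)] by (intro mult_mono) auto
      finally show "norm (case p of (c, t) \<Rightarrow> ?f c t) \<le> C * (2 * r)" by (simp add: p)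
    qed
    show "(\<lambda>(c, t). ?f c t) \<in> borel_measurable (?N \<Otimes>\<^sub>M unit_interval)"
      unfolding case_prod_beta by measurable
  qed
  have "(LINT t|unit_interval. LINT c|?N. ?f c t) = (LINT c|?N. LINT t|unit_interval. ?f c t)"
    by (rule P.Fubini_integral[OF fi])
  also have "\<dots> = (LINT c|?N. v x - v c)" by (simp only: integral_grad_segment[OF v])
  also have "\<dots> = measure lborel (ball z r) * v x - (LINT c|?N. v c)"
    using vi by (simp add: measure_ball_measure)
  finally show ?thesis by (simp add: radial_mean_def)
qed

lemma radial_mean_tendsto_0:
  fixes h :: "nat \<Rightarrow> real^'n::finite \<Rightarrow> real^'n"
  assumes h: "\<And>k. h k \<in> borel_measurable borel" and x: "x \<in> ball z r" and t: "0 \<le> t" "t < 1"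
    and weak: "\<And>b C. b \<in> borel_measurable borel \<Longrightarrow> (\<And>y. norm (b y) \<le> C) \<Longrightarrow>
      (\<lambda>k. LINT y|ball_measure z r. b y \<bullet> h k y) \<longlonglongrightarrow> 0"
  shows "(\<lambda>k. radial_mean z r (h k) x t) \<longlonglongrightarrow> 0"
proof -
  note [measurable] = h
  \<comment> \<open>\<open>p\<close> inverts the substitution \<open>y = (1 - t) c + t x\<close>.
    The cutoff in \<open>b\<close> records that \<open>p y\<close> must lie in the ball, and by
    convexity \<open>b\<close> then vanishes outside the ball in \<open>y\<close> too.\<close>
  define p where "p y = (1 / (1 - t)) *\<^sub>R (y - t *\<^sub>R x)" for y
  define b where "b y = indicator (ball z r) (p y) *\<^sub>R (x - p y)" for y
  have [measurable]: "p \<in> borel_measurable borel" unfolding p_def by simp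
  have bm [measurable]: "b \<in> borel_measurable borel" unfolding b_def by measurable
  have p: "p (t *\<^sub>R x + (1 - t) *\<^sub>R c) = c" for c using t by (simp add: p_def)
  have p': "(1 - t) *\<^sub>R p y + t *\<^sub>R x = y" for y using t by (simp add: p_def)
  have bb: "norm (b y) \<le> 2 * \<bar>r\<bar>" for y
    using ball_dist_le[OF x, of "p y"] by (auto simp: b_def indicator_def simp del: mem_ball)
  have b0: "b y = 0" if "y \<notin> ball z r" for y
    using convex_comb_in_ball[OF x, of "p y" t] p'[of y] t that by (auto simp: b_def indicator_def simp del: mem_ball)
  have eq: "radial_mean z r (h k) x t = (1 / (1 - t) ^ CARD('n)) * (LINT y|ball_measure z r. b y \<bullet> h k y)" for k
  proof -
    have "(LINT y|ball_measure z r. b y \<bullet> h k y) = (LINT y|lborel. b y \<bullet> h k y)"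
      unfolding integral_ball_measure using b0
      by (intro Bochner_Integration.integral_cong) (auto simp: indicator_def simp del: mem_ball)
    also have "\<dots> = \<bar>1 - t\<bar> ^ DIM(real^'n) *\<^sub>R (LINT c|lborel. b (t *\<^sub>R x + (1 - t) *\<^sub>R c) \<bullet> h k (t *\<^sub>R x + (1 - t) *\<^sub>R c))"
      using t by (intro lborel_integral_affine) auto
    also have "(LINT c|lborel. b (t *\<^sub>R x + (1 - t) *\<^sub>R c) \<bullet> h k (t *\<^sub>R x + (1 - t) *\<^sub>R c)) = radial_mean z r (h k) x t"
      unfolding radial_mean_def integral_ball_measure b_def p
      by (simp add: inner_commute add.commute)
    finally show ?thesis using t by simp
  qed
  have "(\<lambda>k. (1 / (1 - t) ^ CARD('n)) * (LINT y|ball_measure z r. b y \<bullet> h k y)) \<longlonglongrightarrow> (1 / (1 - t) ^ CARD('n)) * 0"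
    by (intro tendsto_mult tendsto_const weak[OF bm bb])
  then show ?thesis unfolding eq by simp
qed


text \<open>Dominated convergence in \<open>t\<close> with the null set of the two endpoints
  removed: at \<open>t = 1\<close> the radial means are not controlled by weak convergence.\<close>

lemma tendsto_integral_powr_unit_interval:
  fixes f :: "nat \<Rightarrow> real \<Rightarrow> real"
  assumes m: "\<And>k. f k \<in> borel_measurable unit_interval" and b: "\<And>k t. 0 < t \<Longrightarrow> t < 1 \<Longrightarrow> \<bar>f k t\<bar> \<le> C"
    and lim: "\<And>t. 0 < t \<Longrightarrow> t < 1 \<Longrightarrow> (\<lambda>k. f k t) \<longlonglongrightarrow> 0"
  shows "(\<lambda>k. LINT t|unit_interval. f k t) \<longlonglongrightarrow> 0"
proof -
  interpret finite_measure unit_interval by (rule finite_measure_unit_interval)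
  have ae: "AE t in unit_interval. 0 < t \<and> t < 1"
  proof -
    have "AE t in lborel. t \<in> {0..1} \<longrightarrow> 0 < t \<and> t < (1::real)"
      using AE_lborel_singleton[of "0::real"] AE_lborel_singleton[of "1::real"] by eventually_elim auto
    then show ?thesis unfolding unit_interval_def by (subst AE_restrict_space_iff) auto
  qed
  have "(\<lambda>k. LINT t|unit_interval. f k t) \<longlonglongrightarrow> (LINT t|unit_interval. 0)"
  proof (rule integral_dominated_convergence[where w = "\<lambda>_. C"])
    show "AE t in unit_interval. (\<lambda>k. f k t) \<longlonglongrightarrow> 0" using ae by eventually_elim (use lim in blast)
    show "AE t in unit_interval. norm (f k t) \<le> C" for k using ae by eventually_elim (use b in simp)
  qed (use m in auto)
  then show ?thesis by simp
qed

text \<open>For \<open>t \<ge> 1/2\<close> the substitution is made in \<open>x\<close> with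
  \<open>c\<close> fixed, for \<open>t < 1/2\<close> in \<open>c\<close> with \<open>x\<close>
  fixed. The inverse Jacobian is at most \<open>2 ^ CARD('n)\<close> either way, so unlike in
  \<open>radial_mean_bound\<close> nothing degenerates near \<open>t = 1\<close>.\<close>

lemma double_integral_segment_le:
  fixes g :: "real^'n::finite \<Rightarrow> real"
  assumes g: "continuous_on UNIV g" "\<And>x. 0 \<le> g x" and t: "0 < t" "t < 1"
  shows "(LINT x|ball_measure z r. LINT c|ball_measure z r. g ((1 - t) *\<^sub>R c + t *\<^sub>R x))
    \<le> 2 ^ CARD('n) * measure lborel (ball z r) * (LINT x|ball_measure z r. g x)"
proof -
  let ?N = "ball_measure z r" and ?I = "LINT x|ball_measure z r. g x"
  interpret N: finite_measure ?N by (rule finite_measure_ball_measure)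
  interpret P: pair_sigma_finite ?N ?N ..
  interpret PF: finite_measure "?N \<Otimes>\<^sub>M ?N"
    by (rule finite_measure_pair_measure) (rule finite_measure_ball_measure)+
  have [measurable]: "g \<in> borel_measurable borel" using g by (intro borel_measurable_continuous_onI)
  obtain C where C: "C > 0" "\<And>x. x \<in> ball z r \<Longrightarrow> norm (g x) \<le> C"
    using continuous_bounded_on_ball[OF g(1)] by blast
  have I: "0 \<le> ?I" using g(2) by (rule Bochner_Integration.integral_nonneg)
  have fi: "integrable (?N \<Otimes>\<^sub>M ?N) (\<lambda>(x, c). g ((1 - t) *\<^sub>R c + t *\<^sub>R x))"
  proof (rule PF.integrable_const_bound[where B = C])
    show "AE p in ?N \<Otimes>\<^sub>M ?N. norm (case p of (x, c) \<Rightarrow> g ((1 - t) *\<^sub>R c + t *\<^sub>R x)) \<le> C"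
      using C(2)[OF convex_comb_in_ball] t by (intro AE_I2) (auto simp: space_pair_measure simp del: mem_ball)
    show "(\<lambda>(x, c). g ((1 - t) *\<^sub>R c + t *\<^sub>R x)) \<in> borel_measurable (?N \<Otimes>\<^sub>M ?N)"
      unfolding case_prod_beta by measurable
  qed
  have bound: "(LINT a|?N. LINT b|?N. g ((1 - \<tau>) *\<^sub>R a + \<tau> *\<^sub>R b)) \<le> 2 ^ CARD('n) * measure lborel (ball z r) * ?I"
    if i: "integrable ?N (\<lambda>a. LINT b|?N. g ((1 - \<tau>) *\<^sub>R a + \<tau> *\<^sub>R b))" and \<tau>: "1/2 \<le> \<tau>" "\<tau> \<le> 1" for \<tau>
  proof -
    have "(LINT a|?N. LINT b|?N. g ((1 - \<tau>) *\<^sub>R a + \<tau> *\<^sub>R b)) \<le> (LINT a|?N. 2 ^ CARD('n) * ?I)"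
    proof (rule integral_mono[OF i])
      fix a assume "a \<in> space ?N"
      then have "(LINT b|?N. g ((1 - \<tau>) *\<^sub>R a + \<tau> *\<^sub>R b)) \<le> (1 / \<tau> ^ CARD('n)) * ?I"
        using \<tau> by (intro integral_convex_comb_le g) auto
      also have "1 / \<tau> ^ CARD('n) = (1 / \<tau>) ^ CARD('n)" by (simp add: power_divide)
      also have "\<dots> * ?I \<le> 2 ^ CARD('n) * ?I"
        using \<tau> I by (intro mult_right_mono power_mono) (auto simp: field_simps)
      finally show "(LINT b|?N. g ((1 - \<tau>) *\<^sub>R a + \<tau> *\<^sub>R b)) \<le> 2 ^ CARD('n) * ?I" .
    qed simp
    then show ?thesis by (simp add: measure_ball_measure mult_ac)
  qed
  show ?thesis
  proof (cases "t \<ge> 1/2")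
    case True
    have "(LINT x|?N. LINT c|?N. g ((1 - t) *\<^sub>R c + t *\<^sub>R x)) = (LINT c|?N. LINT x|?N. g ((1 - t) *\<^sub>R c + t *\<^sub>R x))"
      using P.Fubini_integral[OF fi] by simp
    then show ?thesis using bound[of t] P.integrable_snd[OF fi] True t by simp
  next
    case False
    have eq: "(1 - t) *\<^sub>R c + t *\<^sub>R x = (1 - (1 - t)) *\<^sub>R x + (1 - t) *\<^sub>R c" for x c :: "real^'n" by (simp add: add.commute)
    have "integrable ?N (\<lambda>x. LINT c|?N. g ((1 - t) *\<^sub>R c + t *\<^sub>R x))"
      using P.integrable_fst'[OF fi] by simp
    then show ?thesis using False t unfolding eq by (intro bound) auto
  qed
qed

text \<open>The function minus its mean is the average of its radial means over \<open>t\<close>. For fixed \<open>t < 1\<close>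
  the substitution \<open>y = (1 - t) c + t x\<close> makes a radial mean a pairing of the gradient with a bounded
  function, so weak convergence gives pointwise convergence in \<open>x\<close>, and dominated convergence does the rest.\<close>

lemma weak_grad_imp_strong_conv:
  fixes v :: "nat \<Rightarrow> real^'n::finite \<Rightarrow> real"
  assumes q: "1 < q" and r: "0 < r" and v: "\<And>k. smooth_fun (v k)"
    and bdd: "\<And>k. (LINT x|ball_measure z r. norm (grad (v k) x) powr q) \<le> M"
    and weak: "\<And>b C. b \<in> borel_measurable borel \<Longrightarrow> (\<And>y. norm (b y) \<le> C) \<Longrightarrow>
      (\<lambda>k. LINT y|ball_measure z r. b y \<bullet> grad (v k) y) \<longlonglongrightarrow> 0"
  shows "\<exists>m. (\<lambda>k. LINT x|ball_measure z r. \<bar>v k x - m k\<bar> powr q) \<longlonglongrightarrow> 0"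
proof -
  let ?N = "ball_measure z r" and ?T = unit_interval
  define V where "V = measure lborel (ball z r)"
  have V: "V > 0" using r by (simp add: V_def content_ball_pos)
  define a where "a k x t = radial_mean z r (grad (v k)) x t" for k x t
  define E where "E k t = (LINT x|?N. \<bar>a k x t\<bar> powr q)" for k t
  interpret N: finite_measure ?N by (rule finite_measure_ball_measure)
  interpret T: finite_measure ?T by (rule finite_measure_unit_interval)
  interpret P: pair_sigma_finite ?N ?T ..
  interpret PF: finite_measure "?N \<Otimes>\<^sub>M ?T"
    by (rule finite_measure_pair_measure) (rule finite_measure_ball_measure finite_measure_unit_interval)+
  have gm [measurable]: "grad (v k) \<in> borel_measurable borel" for k by (rule borel_measurable_grad[OF v])
  have gc: "continuous_on S (grad (v k))" for S k by (rule smooth_fun_continuous_grad[OF v])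
  have am [measurable]: "(\<lambda>(x, t). a k x t) \<in> borel_measurable (?N \<Otimes>\<^sub>M ?T)" for k
    unfolding a_def by (rule radial_mean_measurable[OF gm])
  have a0: "(\<lambda>k. a k x t) \<longlonglongrightarrow> 0" if "x \<in> ball z r" "0 < t" "t < 1" for x t
    unfolding a_def using that by (intro radial_mean_tendsto_0 gm weak) auto
  have gi: "integrable ?N (\<lambda>x. norm (grad (v k) x) powr q)" for k
  proof -
    obtain C where C: "C > 0" "\<And>x. x \<in> ball z r \<Longrightarrow> norm (grad (v k) x) \<le> C"
      using continuous_bounded_on_ball[OF gc] by blast
    show ?thesis
      by (rule N.integrable_const_bound[where B = "C powr q"])
         (use C q in \<open>auto intro!: powr_mono2 ball_measure_borel simp del: mem_ball\<close>)
  qed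
  \<comment> \<open>Jensen's inequality turns the bound on the \<open>q\<close>-th powers into one
    on the integrals of the norms, the quantity in \<open>radial_mean_bound\<close>.\<close>
  obtain M1 where M1: "\<And>k. (LINT x|?N. norm (grad (v k) x)) \<le> M1"
  proof
    fix k
    have "norm (LINT x|?N. norm (grad (v k) x)) powr q \<le> V powr (q - 1) * (LINT x|?N. norm (norm (grad (v k) x)) powr q)"
      unfolding V_def measure_ball_measure[symmetric]
      using norm_integral_powr_le(2)[OF q finite_measure_ball_measure, of "\<lambda>x. norm (grad (v k) x)" z r] gi[of k]
      by (simp add: ball_measure_borel)
    also have "\<dots> \<le> V powr (q - 1) * M" using bdd[of k] by (intro mult_left_mono) auto
    finally have "(norm (LINT x|?N. norm (grad (v k) x)) powr q) powr (1/q) \<le> (V powr (q - 1) * M) powr (1/q)"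
      using q by (intro powr_mono2) auto
    then show "(LINT x|?N. norm (grad (v k) x)) \<le> (V powr (q - 1) * M) powr (1/q)"
      using q by (simp add: powr_powr)
  qed
  have am1: "(\<lambda>x. a k x t) \<in> borel_measurable ?N" if "t \<in> {0..1}" for k t
    using measurable_compose[OF measurable_Pair2'[of t ?T ?N] am[of k]] that by simp
  \<comment> \<open>With \<open>t < 1\<close> fixed, \<open>radial_mean_bound\<close> gives a
    dominating constant independent of \<open>x\<close> and \<open>k\<close>. It blows up at
    \<open>t = 1\<close>, so the later integration over \<open>t\<close> relies on \<open>Eb\<close>
    instead.\<close>
  have E0: "(\<lambda>k. E k t) \<longlonglongrightarrow> 0" if t: "0 < t" "t < 1" for t
  proof -
    have "(\<lambda>k. E k t) \<longlonglongrightarrow> (LINT x|?N. 0)" unfolding E_def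
    proof (rule integral_dominated_convergence[where w = "\<lambda>_. (2 * r / (1 - t) ^ CARD('n) * M1) powr q"])
      show "AE x in ?N. (\<lambda>k. \<bar>a k x t\<bar> powr q) \<longlonglongrightarrow> 0"
      proof (rule AE_I2)
        fix x assume "x \<in> space ?N"
        then have "(\<lambda>k. \<bar>a k x t\<bar>) \<longlonglongrightarrow> 0" using a0 t by (simp add: tendsto_rabs_zero)
        then have "(\<lambda>k. \<bar>a k x t\<bar> powr q) \<longlonglongrightarrow> 0 powr q"
          using q by (intro tendsto_powr'[OF _ tendsto_const]) auto
        then show "(\<lambda>k. \<bar>a k x t\<bar> powr q) \<longlonglongrightarrow> 0" using q by simp
      qed
      show "AE x in ?N. norm (\<bar>a k x t\<bar> powr q) \<le> (2 * r / (1 - t) ^ CARD('n) * M1) powr q" for k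
      proof (rule AE_I2)
        fix x assume x: "x \<in> space ?N"
        have "\<bar>a k x t\<bar> \<le> 2 * r / (1 - t) ^ CARD('n) * (LINT y|?N. norm (grad (v k) y))"
          unfolding a_def using x t by (intro radial_mean_bound gc) auto
        also have "\<dots> \<le> 2 * r / (1 - t) ^ CARD('n) * M1"
          using r t M1[of k] by (intro mult_left_mono) auto
        finally show "norm (\<bar>a k x t\<bar> powr q) \<le> (2 * r / (1 - t) ^ CARD('n) * M1) powr q"
          using q by (simp add: powr_mono2)
      qed
    qed (use am1 t in auto)
    then show ?thesis by simp
  qed
  \<comment> \<open>The factors come from Jensen's inequality over \<open>c\<close>, from
    \<open>norm (x - c) \<le> 2 * r\<close>, and from \<open>double_integral_segment_le\<close>;
    none of them depends on \<open>t\<close> or \<open>k\<close>.\<close>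
  define K where "K = V powr (q - 1) * (2 * r) powr q * (2 ^ CARD('n) * V * M)"
  have Eb: "\<bar>E k t\<bar> \<le> K" if t: "0 < t" "t < 1" for k t
  proof -
    let ?g = "\<lambda>y. norm (grad (v k) y) powr q"
    have gcq: "continuous_on UNIV ?g" using q by (intro continuous_on_powr' continuous_intros gc) auto
    obtain C where C: "C > 0" "\<And>x. x \<in> ball z r \<Longrightarrow> norm (?g x) \<le> C"
      using continuous_bounded_on_ball[OF gcq] by blast
    have gin: "integrable ?N (\<lambda>c. ?g ((1 - t) *\<^sub>R c + t *\<^sub>R x))" if x: "x \<in> ball z r" for x
    proof (rule N.integrable_const_bound[where B = C])
      show "AE c in ?N. norm (?g ((1 - t) *\<^sub>R c + t *\<^sub>R x)) \<le> C"
        using C(2)[OF convex_comb_in_ball[OF x]] t by (intro AE_I2) auto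
    qed (intro ball_measure_borel, measurable)
    have pt: "\<bar>a k x t\<bar> powr q \<le> V powr (q - 1) * (2 * r) powr q * (LINT c|?N. ?g ((1 - t) *\<^sub>R c + t *\<^sub>R x))"
      if x: "x \<in> ball z r" for x
    proof -
      let ?f = "\<lambda>c. grad (v k) ((1 - t) *\<^sub>R c + t *\<^sub>R x) \<bullet> (x - c)"
      have fm: "?f \<in> borel_measurable ?N" by (intro ball_measure_borel) measurable
      have fb: "norm (?f c) powr q \<le> (2 * r) powr q * ?g ((1 - t) *\<^sub>R c + t *\<^sub>R x)" if "c \<in> ball z r" for c
      proof -
        have "norm (?f c) \<le> norm (grad (v k) ((1 - t) *\<^sub>R c + t *\<^sub>R x)) * norm (x - c)"
          using Cauchy_Schwarz_ineq2 by simp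
        also have "\<dots> \<le> norm (grad (v k) ((1 - t) *\<^sub>R c + t *\<^sub>R x)) * (2 * r)"
          using ball_dist_le[OF x that] by (intro mult_left_mono) auto
        finally have "norm (?f c) powr q \<le> (norm (grad (v k) ((1 - t) *\<^sub>R c + t *\<^sub>R x)) * (2 * r)) powr q"
          using q by (intro powr_mono2) auto
        then show ?thesis using r by (simp add: powr_mult mult.commute)
      qed
      have gi2: "integrable ?N (\<lambda>c. (2 * r) powr q * ?g ((1 - t) *\<^sub>R c + t *\<^sub>R x))"
        using gin[OF x] by simp
      have fi: "integrable ?N (\<lambda>c. norm (?f c) powr q)"
      proof (rule Bochner_Integration.integrable_bound[OF gi2])
        show "AE c in ?N. norm (norm (?f c) powr q) \<le> norm ((2 * r) powr q * ?g ((1 - t) *\<^sub>R c + t *\<^sub>R x))"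
          by (rule AE_I2) (use fb in \<open>simp del: mem_ball add: abs_mult\<close>)
      qed (use fm in simp)
      have "\<bar>a k x t\<bar> powr q \<le> V powr (q - 1) * (LINT c|?N. norm (?f c) powr q)"
        using norm_integral_powr_le(2)[OF q finite_measure_ball_measure fm fi]
        by (simp add: a_def radial_mean_def V_def measure_ball_measure)
      also have "\<dots> \<le> V powr (q - 1) * (LINT c|?N. (2 * r) powr q * ?g ((1 - t) *\<^sub>R c + t *\<^sub>R x))"
        by (intro mult_left_mono integral_mono[OF fi gi2]) (use fb in \<open>auto simp del: mem_ball\<close>)
      finally show ?thesis by (simp add: mult_ac)
    qed
    have "E k t \<le> (LINT x|?N. V powr (q - 1) * (2 * r) powr q * (LINT c|?N. ?g ((1 - t) *\<^sub>R c + t *\<^sub>R x)))"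
      unfolding E_def
    proof (rule integral_mono')
      have "(\<lambda>x. LINT c|?N. ?g ((1 - t) *\<^sub>R c + t *\<^sub>R x)) \<in> borel_measurable ?N"
      proof (rule N.borel_measurable_lebesgue_integral)
        show "(\<lambda>(x, c). ?g ((1 - t) *\<^sub>R c + t *\<^sub>R x)) \<in> borel_measurable (?N \<Otimes>\<^sub>M ?N)"
          unfolding case_prod_beta by measurable
      qed
      moreover have "norm (LINT c|?N. ?g ((1 - t) *\<^sub>R c + t *\<^sub>R x)) \<le> C * V" if x: "x \<in> ball z r" for x
      proof -
        have "norm (LINT c|?N. ?g ((1 - t) *\<^sub>R c + t *\<^sub>R x)) \<le> (LINT c|?N. C)"
          using C(2)[OF convex_comb_in_ball[OF x]] t gin[OF x]
          by (intro order_trans[OF integral_norm_bound] integral_mono) auto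
        then show ?thesis by (simp add: V_def measure_ball_measure mult.commute)
      qed
      ultimately show "integrable ?N (\<lambda>x. V powr (q - 1) * (2 * r) powr q * (LINT c|?N. ?g ((1 - t) *\<^sub>R c + t *\<^sub>R x)))"
        by (intro integrable_mult_right N.integrable_const_bound[where B = "C * V"]) (auto simp del: mem_ball)
      show "0 \<le> V powr (q - 1) * (2 * r) powr q * (LINT c|?N. ?g ((1 - t) *\<^sub>R c + t *\<^sub>R x))" for x
        by (intro mult_nonneg_nonneg Bochner_Integration.integral_nonneg) auto
    qed (use pt in \<open>simp del: mem_ball\<close>)
    also have "\<dots> = V powr (q - 1) * (2 * r) powr q * (LINT x|?N. LINT c|?N. ?g ((1 - t) *\<^sub>R c + t *\<^sub>R x))" by simp
    also have "(LINT x|?N. LINT c|?N. ?g ((1 - t) *\<^sub>R c + t *\<^sub>R x)) \<le> 2 ^ CARD('n) * V * (LINT x|?N. ?g x)"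
      unfolding V_def by (rule double_integral_segment_le[OF gcq _ t]) simp
    also have "\<dots> \<le> 2 ^ CARD('n) * V * M" using bdd[of k] V by (intro mult_left_mono) auto
    finally have "E k t \<le> K" by (simp add: K_def mult_left_mono)
    moreover have "0 \<le> E k t" unfolding E_def by (rule Bochner_Integration.integral_nonneg) simp
    ultimately show ?thesis by simp
  qed
  \<comment> \<open>A crude bound that may depend on \<open>k\<close>: it only secures integrability
    on the product, as Fubini's theorem and Jensen's inequality require.\<close>
  have aC: "\<exists>C. \<forall>x\<in>ball z r. \<forall>t\<in>{0..1}. \<bar>a k x t\<bar> \<le> C" for k
  proof -
    obtain C where C: "C > 0" "\<And>x. x \<in> ball z r \<Longrightarrow> norm (grad (v k) x) \<le> C"
      using continuous_bounded_on_ball[OF gc] by blast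
    have "\<bar>a k x t\<bar> \<le> C * (2 * r) * V" if x: "x \<in> ball z r" and t: "t \<in> {0..1}" for x t
    proof -
      have fb: "norm (grad (v k) ((1 - t) *\<^sub>R c + t *\<^sub>R x) \<bullet> (x - c)) \<le> C * (2 * r)" if "c \<in> ball z r" for c
      proof -
        have "norm (grad (v k) ((1 - t) *\<^sub>R c + t *\<^sub>R x) \<bullet> (x - c)) \<le> norm (grad (v k) ((1 - t) *\<^sub>R c + t *\<^sub>R x)) * norm (x - c)"
          using Cauchy_Schwarz_ineq2 by simp
        also have "\<dots> \<le> C * (2 * r)"
          using C(1) C(2)[OF convex_comb_in_ball[OF x that]] t ball_dist_le[OF x that] by (intro mult_mono) auto
        finally show ?thesis .
      qed
      have "\<bar>a k x t\<bar> \<le> (LINT c|?N. norm (grad (v k) ((1 - t) *\<^sub>R c + t *\<^sub>R x) \<bullet> (x - c)))"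
        unfolding a_def radial_mean_def using integral_norm_bound[of ?N] by fastforce
      also have "\<dots> \<le> (LINT c|?N. C * (2 * r))"
        using C r fb by (intro integral_mono') (auto simp del: mem_ball real_norm_def)
      finally show ?thesis by (simp add: V_def measure_ball_measure mult_ac)
    qed
    then show ?thesis by blast
  qed
  have apow: "integrable (?N \<Otimes>\<^sub>M ?T) (\<lambda>(x, t). \<bar>a k x t\<bar> powr q)" for k
  proof -
    obtain C where C: "\<And>x t. x \<in> ball z r \<Longrightarrow> t \<in> {0..1} \<Longrightarrow> \<bar>a k x t\<bar> \<le> C" using aC by blast
    show ?thesis
    proof (rule PF.integrable_const_bound[where B = "C powr q"])
      show "AE p in ?N \<Otimes>\<^sub>M ?T. norm (case p of (x, t) \<Rightarrow> \<bar>a k x t\<bar> powr q) \<le> C powr q"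
        using C q by (intro AE_I2) (auto simp: space_pair_measure simp del: mem_ball intro!: powr_mono2)
      show "(\<lambda>(x, t). \<bar>a k x t\<bar> powr q) \<in> borel_measurable (?N \<Otimes>\<^sub>M ?T)"
        using am[of k] unfolding case_prod_beta by measurable
    qed
  qed
  define m where "m k = (LINT c|?N. v k c) / V" for k
  \<comment> \<open>Jensen's inequality in \<open>t\<close> costs no constant because
    \<open>unit_interval\<close> has mass 1; the factor \<open>V powr - q\<close> stems from
    dividing the representation formula by the volume.\<close>
  have main: "(LINT x|?N. \<bar>v k x - m k\<bar> powr q) \<le> V powr - q * (LINT t|?T. E k t)" for k
  proof -
    have pt: "\<bar>v k x - m k\<bar> powr q \<le> V powr - q * (LINT t|?T. \<bar>a k x t\<bar> powr q)" if x: "x \<in> ball z r" for x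
    proof -
      have "v k x - m k = (LINT t|?T. a k x t) / V"
        using radial_mean_rep[OF v x, of k] V by (simp add: m_def a_def V_def[symmetric] field_simps)
      then have "\<bar>v k x - m k\<bar> powr q = V powr - q * \<bar>LINT t|?T. a k x t\<bar> powr q"
        using V by (simp only:) (simp add: abs_divide powr_divide powr_minus divide_simps)
      also have "\<bar>LINT t|?T. a k x t\<bar> powr q \<le> (LINT t|?T. \<bar>a k x t\<bar> powr q)"
      proof -
        have m: "(\<lambda>t. a k x t) \<in> borel_measurable ?T"
          using measurable_compose[OF measurable_Pair1'[of x ?N ?T] am[of k]] x by simp
        obtain C where C: "\<And>x t. x \<in> ball z r \<Longrightarrow> t \<in> {0..1} \<Longrightarrow> \<bar>a k x t\<bar> \<le> C" using aC by blast
        have "integrable ?T (\<lambda>t. norm (a k x t) powr q)"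
          by (rule T.integrable_const_bound[where B = "C powr q"])
             (use C[OF x] q m in \<open>auto intro!: powr_mono2\<close>)
        from norm_integral_powr_le(2)[OF q finite_measure_unit_interval m this]
        show ?thesis by (simp add: measure_unit_interval)
      qed
      finally show ?thesis by (simp add: mult_left_mono)
    qed
    have "(LINT x|?N. \<bar>v k x - m k\<bar> powr q) \<le> (LINT x|?N. V powr - q * (LINT t|?T. \<bar>a k x t\<bar> powr q))"
    proof (rule integral_mono')
      show "integrable ?N (\<lambda>x. V powr - q * (LINT t|?T. \<bar>a k x t\<bar> powr q))"
        using P.integrable_fst'[OF apow[of k]] by simp
      show "0 \<le> V powr - q * (LINT t|?T. \<bar>a k x t\<bar> powr q)" for x
        by (intro mult_nonneg_nonneg Bochner_Integration.integral_nonneg) auto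
    qed (use pt in \<open>simp del: mem_ball\<close>)
    also have "\<dots> = V powr - q * (LINT x|?N. LINT t|?T. \<bar>a k x t\<bar> powr q)" by simp
    also have "(LINT x|?N. LINT t|?T. \<bar>a k x t\<bar> powr q) = (LINT t|?T. E k t)"
      unfolding E_def using P.Fubini_integral[OF apow[of k]] by simp
    finally show ?thesis .
  qed
  have "(\<lambda>k. LINT t|?T. E k t) \<longlonglongrightarrow> 0"
  proof (rule tendsto_integral_powr_unit_interval[where C = K])
    show "E k \<in> borel_measurable ?T" for k
      using P.integrable_snd[OF apow[of k]] by (simp add: E_def[abs_def])
  qed (use Eb E0 in auto)
  then have lim: "(\<lambda>k. V powr - q * (LINT t|?T. E k t)) \<longlonglongrightarrow> 0"
    by (rule tendsto_mult_right_zero)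
  have "(\<lambda>k. LINT x|?N. \<bar>v k x - m k\<bar> powr q) \<longlonglongrightarrow> 0"
    by (rule tendsto_sandwich[OF _ _ tendsto_const lim])
       (use main in \<open>auto intro!: always_eventually Bochner_Integration.integral_nonneg\<close>)
  then show ?thesis by blast
qed

subsection \<open>Weak convergence in Lebesgue spaces\<close>

lemma conj_exp_props:
  assumes "1 < p"
  shows "1 < conj_exp p" "1 / p + 1 / conj_exp p = 1"
  using assms by (auto simp: conj_exp_def field_simps)

lemma LqD:
  "f \<in> Lq q U \<Longrightarrow> f \<in> borel_measurable (lebesgue_on U)"
  "f \<in> Lq q U \<Longrightarrow> integrable (lebesgue_on U) (\<lambda>x. norm (f x) powr q)"
  by (auto simp: Lq_def)

lemma LqI:
  "f \<in> borel_measurable (lebesgue_on U) \<Longrightarrow> integrable (lebesgue_on U) (\<lambda>x. norm (f x) powr q) \<Longrightarrow> f \<in> Lq q U"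
  by (auto simp: Lq_def)

lemma Lq_add:
  fixes f g :: "'a::euclidean_space \<Rightarrow> 'b::euclidean_space"
  assumes "0 \<le> q" "f \<in> Lq q U" "g \<in> Lq q U"
  shows "(\<lambda>x. f x + g x) \<in> Lq q U"
    and "(LINT x|lebesgue_on U. norm (f x + g x) powr q) \<le>
      2 powr q * ((LINT x|lebesgue_on U. norm (f x) powr q) + (LINT x|lebesgue_on U. norm (g x) powr q))"
  using assms integrable_norm_powr_add[of q f "lebesgue_on U" g] by (auto simp: Lq_def)

lemma Lq_diff:
  fixes f g :: "'a::euclidean_space \<Rightarrow> 'b::euclidean_space"
  assumes "0 \<le> q" "f \<in> Lq q U" "g \<in> Lq q U"
  shows "(\<lambda>x. f x - g x) \<in> Lq q U"
    and "(LINT x|lebesgue_on U. norm (f x - g x) powr q) \<le>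
      2 powr q * ((LINT x|lebesgue_on U. norm (f x) powr q) + (LINT x|lebesgue_on U. norm (g x) powr q))"
  using assms integrable_norm_powr_diff[of q f "lebesgue_on U" g] by (auto simp: Lq_def)

lemma Lq_scaleR:
  fixes f :: "'a::euclidean_space \<Rightarrow> 'b::euclidean_space"
  shows "f \<in> Lq q U \<Longrightarrow> (\<lambda>x. c *\<^sub>R f x) \<in> Lq q U"
  by (auto simp: Lq_def powr_mult)

lemma Lq_bounded_scaleR:
  fixes f :: "'a::euclidean_space \<Rightarrow> 'b::euclidean_space"
  assumes f: "f \<in> Lq q U" and \<theta>: "\<theta> \<in> borel_measurable borel" "\<And>x. \<bar>\<theta> x\<bar> \<le> C" and q: "0 \<le> q"
  shows "(\<lambda>x. \<theta> x *\<^sub>R f x) \<in> Lq q U"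
    and "(LINT x|lebesgue_on U. norm (\<theta> x *\<^sub>R f x) powr q) \<le> C powr q * (LINT x|lebesgue_on U. norm (f x) powr q)"
proof -
  note [measurable] = LqD(1)[OF f] borel_measurable_lebesgue_onI[OF \<theta>(1)]
  have i: "integrable (lebesgue_on U) (\<lambda>x. C powr q * norm (f x) powr q)" using LqD(2)[OF f] by simp
  have C: "C \<ge> 0" using \<theta>(2) abs_ge_zero order_trans by blast
  have le: "norm (\<theta> x *\<^sub>R f x) powr q \<le> C powr q * norm (f x) powr q" for x
    unfolding norm_scaleR using \<theta>(2)[of x] C q
    by (subst powr_mult[symmetric]) (auto intro!: powr_mono2 mult_right_mono)
  have j: "integrable (lebesgue_on U) (\<lambda>x. norm (\<theta> x *\<^sub>R f x) powr q)"
    by (rule Bochner_Integration.integrable_bound[OF i]) (use le in auto)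
  then show "(\<lambda>x. \<theta> x *\<^sub>R f x) \<in> Lq q U" by (intro LqI) auto
  show "(LINT x|lebesgue_on U. norm (\<theta> x *\<^sub>R f x) powr q) \<le> C powr q * (LINT x|lebesgue_on U. norm (f x) powr q)"
    using integral_mono[OF j i le] by simp
qed

lemma Lq_inner:
  fixes f h :: "'a::euclidean_space \<Rightarrow> 'b::euclidean_space"
  assumes pq: "1 < p" "1 < q" "1 / p + 1 / q = 1" and f: "f \<in> Lq p U" and h: "h \<in> Lq q U"
  shows "integrable (lebesgue_on U) (\<lambda>x. f x \<bullet> h x)"
    and "\<bar>LINT x|lebesgue_on U. f x \<bullet> h x\<bar> \<le> Lq_norm p U f * Lq_norm q U h"
    and "\<bar>LINT x|lebesgue_on U. f x \<bullet> h x\<bar> \<le>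
      (LINT x|lebesgue_on U. norm (f x) powr p) powr (1/p) * (LINT x|lebesgue_on U. norm (h x) powr q) powr (1/q)"
  using Holder_inner[OF pq LqD(1)[OF f] LqD(1)[OF h] LqD(2)[OF f] LqD(2)[OF h]]
  by (auto simp: Lq_norm_def)

lemma inner_in_dual_space:
  fixes h :: "'a::euclidean_space \<Rightarrow> 'b::euclidean_space"
  assumes pq: "1 < p" "1 < q" "1 / p + 1 / q = 1" and h: "h \<in> Lq q U"
  shows "(\<lambda>f. LINT x|lebesgue_on U. f x \<bullet> h x) \<in> dual_space (Lq p U) (Lq_norm p U)"
proof -
  have "\<bar>LINT x|lebesgue_on U. f x \<bullet> h x\<bar> \<le> Lq_norm q U h * Lq_norm p U f" if "f \<in> Lq p U" for f
    using Lq_inner(2)[OF pq that h] by (simp add: mult.commute)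
  then show ?thesis unfolding dual_space_def using Lq_inner(1)[OF pq _ h]
    by (auto simp: inner_add_left)
qed

lemma weak_conv_Lq_inner:
  assumes pq: "1 < p" "1 < q" "1 / p + 1 / q = 1" and f: "weak_conv_Lq p U f finf" and h: "h \<in> Lq q U"
  shows "(\<lambda>k. LINT x|lebesgue_on U. f k x \<bullet> h x) \<longlonglongrightarrow> (LINT x|lebesgue_on U. finf x \<bullet> h x)"
proof -
  have "\<forall>l\<in>dual_space (Lq p U) (Lq_norm p U). (\<lambda>k. l (f k)) \<longlonglongrightarrow> l finf"
    using f by (simp add: weak_conv_Lq_def)
  from bspec[OF this inner_in_dual_space[OF pq h]] show ?thesis .
qed

text \<open>Pairing with the extremal function of Hoelder's inequality. If the norm of
  \<open>f\<close> is 0, the zero functional does it.\<close>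

lemma norming_functional:
  fixes f :: "'a::euclidean_space \<Rightarrow> 'b::euclidean_space"
  assumes pq: "1 < p" "1 < q" "1 / p + 1 / q = 1" and f: "f \<in> Lq p U"
  shows "\<exists>l. l \<in> dual_space (Lq p U) (Lq_norm p U) \<and> (\<forall>v\<in>Lq p U. \<bar>l v\<bar> \<le> Lq_norm p U v) \<and> l f = Lq_norm p U f"
proof -
  note [measurable] = LqD(1)[OF f]
  define A where "A = Lq_norm p U f"
  have A: "A powr p = (LINT x|lebesgue_on U. norm (f x) powr p)" "A \<ge> 0"
    using pq by (auto simp: A_def Lq_norm_powr) (simp add: Lq_norm_def)
  have qp: "(p - 1) * q = p" using pq by (simp add: field_simps)
  show ?thesis
  proof (cases "A = 0")
    case True
    have "(\<lambda>_. 0) \<in> dual_space (Lq p U) (Lq_norm p U)" unfolding dual_space_def by (auto intro: exI[of _ 0])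
    then show ?thesis using True by (intro exI[of _ "\<lambda>_. 0"]) (auto simp: A_def Lq_norm_def)
  next
    case False
    then have Ap: "A > 0" using A by simp
    \<comment> \<open>The normalisation makes \<open>norm (h x) powr q\<close> equal to
      \<open>norm (f x) powr p / A powr p\<close>, since \<open>(p - 1) * q = p\<close>; so
      \<open>h\<close> has norm 1 while its pairing with \<open>f\<close> is
      \<open>A\<close>.\<close>
    define h where "h x = (norm (f x) powr (p - 2) / A powr (p - 1)) *\<^sub>R f x" for x
    have nh: "norm (h x) = (norm (f x) / A) powr (p - 1)" for x
    proof (cases "f x = 0")
      case False
      have "norm (f x) powr (p - 2) * norm (f x) = norm (f x) powr (p - 1)"
        using norm_times_powr[of "f x" "p - 2"] by simp
      then show ?thesis using Ap by (simp add: h_def powr_divide field_simps)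
    qed (simp add: h_def)
    have nhq: "norm (h x) powr q = norm (f x) powr p / A powr p" for x
      unfolding nh powr_powr qp using Ap by (simp add: powr_divide)
    have hL: "h \<in> Lq q U"
    proof (rule LqI)
      show "h \<in> borel_measurable (lebesgue_on U)" unfolding h_def by measurable
      show "integrable (lebesgue_on U) (\<lambda>x. norm (h x) powr q)" unfolding nhq using LqD(2)[OF f] by simp
    qed
    have hn: "Lq_norm q U h = 1"
      unfolding Lq_norm_def nhq using Ap by (simp add: A(1)[symmetric])
    have fh: "f x \<bullet> h x = norm (f x) powr p / A powr (p - 1)" for x
    proof (cases "f x = 0")
      case False
      have "norm (f x) powr (p - 2) * (f x \<bullet> f x) = norm (f x) powr p"
        by (simp add: power2_norm_eq_inner[symmetric] power2_eq_square mult.assoc[symmetric] norm_times_powr)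
      then show ?thesis by (simp add: h_def)
    qed (simp add: h_def)
    have "(LINT x|lebesgue_on U. f x \<bullet> h x) = A powr p / A powr (p - 1)"
      unfolding fh by (simp add: A(1))
    also have "\<dots> = A" using Ap by (simp add: powr_diff)
    finally have "(LINT x|lebesgue_on U. f x \<bullet> h x) = Lq_norm p U f" by (simp add: A_def)
    moreover have "\<bar>LINT x|lebesgue_on U. v x \<bullet> h x\<bar> \<le> Lq_norm p U v" if "v \<in> Lq p U" for v
      using Lq_inner(2)[OF pq that hL] hn by simp
    ultimately show ?thesis using inner_in_dual_space[OF pq hL] by blast
  qed
qed

text \<open>Convergence under each functional bounds its values along the sequence, and uniform
  boundedness with the Hoelder extremals as norming functionals makes the bound common.\<close>

lemma weak_conv_Lq_bounded:
  assumes p: "1 < p" and f: "weak_conv_Lq p U f finf"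
  obtains C where "0 < C" "\<And>k. (LINT x|lebesgue_on U. norm (f k x) powr p) \<le> C"
proof -
  note pq = p conj_exp_props[OF p]
  have fL: "f k \<in> Lq p U" for k using f by (simp add: weak_conv_Lq_def)
  have "\<forall>k. \<exists>l. l \<in> dual_space (Lq p U) (Lq_norm p U) \<and> (\<forall>v\<in>Lq p U. \<bar>l v\<bar> \<le> Lq_norm p U v) \<and> l (f k) = Lq_norm p U (f k)"
    using norming_functional[OF pq fL] by blast
  then obtain l where l: "\<And>k. l k \<in> dual_space (Lq p U) (Lq_norm p U)"
    "\<And>k v. v \<in> Lq p U \<Longrightarrow> \<bar>l k v\<bar> \<le> Lq_norm p U v" "\<And>k. l k (f k) = Lq_norm p U (f k)"
    by metis
  have "\<exists>C. \<forall>k. Lq_norm p U (f k) \<le> C"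
  proof (rule uniform_boundedness_dual_space[where V = "Lq p U", OF _ fL _ _ l])
    show "bounded (range (\<lambda>k. \<Lambda> (f k)))" if "\<Lambda> \<in> dual_space (Lq p U) (Lq_norm p U)" for \<Lambda>
      using f that unfolding weak_conv_Lq_def by (blast intro: convergent_imp_bounded)
  qed (use p in \<open>auto simp: Lq_norm_def intro: Lq_add(1) Lq_scaleR\<close>)
  then obtain C where C: "\<And>k. Lq_norm p U (f k) \<le> C" by blast
  have "(LINT x|lebesgue_on U. norm (f k x) powr p) \<le> C powr p + 1" for k
  proof -
    have "Lq_norm p U (f k) powr p \<le> C powr p" using C p by (intro powr_mono2) (auto simp: Lq_norm_def)
    then show ?thesis using p by (simp add: Lq_norm_powr)
  qed
  then show ?thesis using that[of "C powr p + 1"] by (smt (verit) powr_ge_zero)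
qed

lemma Lq_imp_Lq_1:
  fixes f :: "'a::euclidean_space \<Rightarrow> 'b::euclidean_space"
  assumes "f \<in> Lq p U" "1 < p" "bounded U" "U \<in> sets lebesgue"
  shows "f \<in> Lq 1 U" "integrable (lebesgue_on U) f"
proof -
  show *: "integrable (lebesgue_on U) f"
    using norm_integral_powr_le(1)[OF assms(2) finite_measure_lebesgue_on_bounded[OF assms(3,4)]] LqD[OF assms(1)] by blast
  then show "f \<in> Lq 1 U" by (intro LqI) auto
qed


subsection \<open>The div-curl lemma on a ball\<close>

text \<open>A bounded factor times a vanishing one, in the shape in which \<open>Lq_inner(3)\<close>
  delivers the error terms of the div-curl argument.\<close>

lemma tendsto_0_if_Holder_bound:
  fixes X :: "nat \<Rightarrow> real"
  assumes bound: "\<And>k. \<bar>X k\<bar> \<le> a k powr (1/p) * b k powr (1/q)"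
    and a: "\<And>k. 0 \<le> a k" "\<And>k. a k \<le> A" and b: "b \<longlonglongrightarrow> 0" "\<And>k. 0 \<le> b k" and pq: "1 < p" "1 < q"
  shows "X \<longlonglongrightarrow> 0"
proof (rule Lim_null_comparison)
  show "\<forall>\<^sub>F k in sequentially. norm (X k) \<le> A powr (1/p) * b k powr (1/q)"
  proof (intro always_eventually allI)
    fix k
    have "a k powr (1/p) \<le> A powr (1/p)" using a pq by (intro powr_mono2) auto
    then show "norm (X k) \<le> A powr (1/p) * b k powr (1/q)"
      using bound[of k] mult_right_mono[of "a k powr (1/p)" "A powr (1/p)" "b k powr (1/q)"] by simp
  qed
  have "(\<lambda>k. A powr (1/p) * b k powr (1/q)) \<longlonglongrightarrow> A powr (1/p) * 0 powr (1/q)"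
    using b pq by (intro tendsto_mult tendsto_const tendsto_powr') auto
  then show "(\<lambda>k. A powr (1/p) * b k powr (1/q)) \<longlonglongrightarrow> 0" by simp
qed

text \<open>Nothing fractional remains: the second fields enter as limits in
  \<open>L\<^sup>q\<close> of smooth gradients on the ball, and the functionals \<open>S k\<close>
  represent the divergences through their values on test functions.\<close>

lemma div_curl_ball:
  fixes z :: "real^'n::finite" and F G :: "nat \<Rightarrow> real^'n \<Rightarrow> real^'n" and Finf Ginf :: "real^'n \<Rightarrow> real^'n"
  assumes p: "1 < p" and q_def: "q = conj_exp p" and r: "0 < r" and B_def: "B = ball z r"
    and F: "weak_conv_Lq p B F Finf" and G: "weak_conv_Lq q B G Ginf"
    and approx: "\<And>k e. 0 < e \<Longrightarrow> \<exists>v. smooth_fun v \<and> integrable (lebesgue_on B) (\<lambda>x. norm (grad v x) powr q) \<and>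
      (LINT x|lebesgue_on B. norm (grad v x - G k x) powr q) < e"
    and approx_inf: "\<And>e. 0 < e \<Longrightarrow> \<exists>v. smooth_fun v \<and> integrable (lebesgue_on B) (\<lambda>x. norm (grad v x) powr q) \<and>
      (LINT x|lebesgue_on B. norm (grad v x - Ginf x) powr q) < e"
    and S: "\<And>k. S k \<in> Wm1 p B" "Sinf \<in> Wm1 p B"
    and SF: "\<And>k \<phi>. \<phi> \<in> test_functions B \<Longrightarrow> S k \<phi> = - (LINT x|lebesgue_on B. F k x \<bullet> grad \<phi> x)"
    and SFinf: "\<And>\<phi>. \<phi> \<in> test_functions B \<Longrightarrow> Sinf \<phi> = - (LINT x|lebesgue_on B. Finf x \<bullet> grad \<phi> x)"
    and Sconv: "(\<lambda>k. Wm1_norm p B (\<lambda>u. S k u - Sinf u)) \<longlonglongrightarrow> 0"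
    and \<theta>: "\<theta> \<in> test_functions B"
  shows "(\<lambda>k. LINT x|lebesgue_on B. \<theta> x * (F k x \<bullet> G k x)) \<longlonglongrightarrow> (LINT x|lebesgue_on B. \<theta> x * (Finf x \<bullet> Ginf x))"
proof -
  let ?N = "lebesgue_on B"
  note pq = p conj_exp_props[OF p, folded q_def]
  have qp: "1 / q + 1 / p = 1" using pq by simp
  have p0: "0 \<le> p" and q0: "0 \<le> q" "0 < q" using pq by auto
  have B: "bounded B" "B \<in> sets lebesgue" by (auto simp: B_def)
  interpret N: finite_measure ?N by (rule finite_measure_lebesgue_on_bounded[OF B])
  have FL: "F k \<in> Lq p B" "Finf \<in> Lq p B" and GL: "G k \<in> Lq q B" "Ginf \<in> Lq q B" for k
    using F G by (auto simp: weak_conv_Lq_def)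

  \<comment> \<open>Differences from the weak limits and their norm bounds\<close>
  define f where "f k x = F k x - Finf x" for k x
  define g where "g k x = G k x - Ginf x" for k x
  have fL: "f k \<in> Lq p B" for k unfolding f_def by (intro Lq_diff(1) FL p0)
  have gL: "g k \<in> Lq q B" for k unfolding g_def by (intro Lq_diff(1) GL q0(1))
  obtain CF where CF: "0 < CF" "\<And>k. (LINT x|?N. norm (F k x) powr p) \<le> CF"
    using weak_conv_Lq_bounded[OF p F] by blast
  obtain CG where CG: "0 < CG" "\<And>k. (LINT x|?N. norm (G k x) powr q) \<le> CG"
    using weak_conv_Lq_bounded[OF pq(2) G] by blast
  define Mf where "Mf = 2 powr p * (CF + (LINT x|?N. norm (Finf x) powr p))"
  define Mg where "Mg = 2 powr q * (CG + (LINT x|?N. norm (Ginf x) powr q))"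
  have Mf: "(LINT x|?N. norm (f k x) powr p) \<le> Mf" for k
  proof -
    have "(LINT x|?N. norm (f k x) powr p) \<le> 2 powr p * ((LINT x|?N. norm (F k x) powr p) + (LINT x|?N. norm (Finf x) powr p))"
      unfolding f_def by (intro Lq_diff(2) p0 FL)
    also have "\<dots> \<le> Mf" unfolding Mf_def using CF(2)[of k] by (intro mult_left_mono) auto
    finally show ?thesis .
  qed
  have Mg: "(LINT x|?N. norm (g k x) powr q) \<le> Mg" for k
  proof -
    have "(LINT x|?N. norm (g k x) powr q) \<le> 2 powr q * ((LINT x|?N. norm (G k x) powr q) + (LINT x|?N. norm (Ginf x) powr q))"
      unfolding g_def by (intro Lq_diff(2) q0(1) GL)
    also have "\<dots> \<le> Mg" unfolding Mg_def using CG(2)[of k] by (intro mult_left_mono) auto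
    finally show ?thesis .
  qed

  \<comment> \<open>Smooth gradients approximating the differences \<open>g k\<close>\<close>
  define e where "e k = inverse (real (Suc k))" for k
  have e: "0 < e k" "e k \<le> 1" for k by (auto simp: e_def field_simps)
  have e0: "e \<longlonglongrightarrow> 0" unfolding e_def by (rule LIMSEQ_inverse_real_of_nat)
  have ex: "\<exists>v. smooth_fun v \<and> grad v \<in> Lq q B \<and> (LINT x|?N. norm (grad v x - g k x) powr q) \<le> e k" for k
  proof -
    \<comment> \<open>An approximant of \<open>G k\<close> minus one of \<open>Ginf\<close>
      approximates \<open>g k\<close>; the two errors and the constant \<open>2 powr q\<close> are
      compensated here.\<close>
    define \<epsilon> where "\<epsilon> = e k / (2 * 2 powr q)"
    have \<epsilon>: "\<epsilon> > 0" using e by (simp add: \<epsilon>_def)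
    obtain v1 where v1: "smooth_fun v1" "integrable ?N (\<lambda>x. norm (grad v1 x) powr q)"
      "(LINT x|?N. norm (grad v1 x - G k x) powr q) < \<epsilon>" using approx[OF \<epsilon>] by blast
    obtain v2 where v2: "smooth_fun v2" "integrable ?N (\<lambda>x. norm (grad v2 x) powr q)"
      "(LINT x|?N. norm (grad v2 x - Ginf x) powr q) < \<epsilon>" using approx_inf[OF \<epsilon>] by blast
    have L: "grad v1 \<in> Lq q B" "grad v2 \<in> Lq q B"
      using v1 v2 by (auto intro!: LqI borel_measurable_lebesgue_onI borel_measurable_grad)
    have eq: "grad (\<lambda>x. v1 x - v2 x) x = grad v1 x - grad v2 x" for x by (rule grad_diff[OF v1(1) v2(1)])
    have "(LINT x|?N. norm ((grad v1 x - G k x) - (grad v2 x - Ginf x)) powr q) \<le>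
      2 powr q * ((LINT x|?N. norm (grad v1 x - G k x) powr q) + (LINT x|?N. norm (grad v2 x - Ginf x) powr q))"
      by (intro Lq_diff q0(1) L GL)
    also have "\<dots> \<le> 2 powr q * (\<epsilon> + \<epsilon>)" using v1 v2 by (intro mult_left_mono) auto
    also have "\<dots> = e k" by (simp add: \<epsilon>_def)
    finally have "(LINT x|?N. norm (grad (\<lambda>x. v1 x - v2 x) x - g k x) powr q) \<le> e k"
      by (simp add: eq g_def algebra_simps)
    moreover have "grad (\<lambda>x. v1 x - v2 x) \<in> Lq q B"
      using Lq_diff(1)[OF q0(1) L] ext[of "grad (\<lambda>x. v1 x - v2 x)", OF eq] by simp
    ultimately show ?thesis using smooth_fun_diff[OF v1(1) v2(1)] by blast
  qed
  have "\<exists>v. \<forall>k. smooth_fun (v k) \<and> grad (v k) \<in> Lq q B \<and>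
      (LINT x|?N. norm (grad (v k) x - g k x) powr q) \<le> e k"
    by (intro choice allI ex)
  then obtain v where vv: "\<forall>k. smooth_fun (v k) \<and> grad (v k) \<in> Lq q B \<and>
      (LINT x|?N. norm (grad (v k) x - g k x) powr q) \<le> e k"
    by (elim exE) (rule that)
  then have v: "\<And>k. smooth_fun (v k)" "\<And>k. grad (v k) \<in> Lq q B"
    "\<And>k. (LINT x|?N. norm (grad (v k) x - g k x) powr q) \<le> e k" by auto
  define M where "M = 2 powr q * (1 + Mg)"
  have M: "(LINT x|?N. norm (grad (v k) x) powr q) \<le> M" for k
  proof -
    have "(LINT x|?N. norm ((grad (v k) x - g k x) + g k x) powr q) \<le>
      2 powr q * ((LINT x|?N. norm (grad (v k) x - g k x) powr q) + (LINT x|?N. norm (g k x) powr q))"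
      by (intro Lq_add(2) Lq_diff(1) q0(1) v gL)
    also have "\<dots> \<le> M" unfolding M_def using v(3)[of k] e(2)[of k] Mg[of k] by (intro mult_left_mono) auto
    finally show ?thesis by simp
  qed
  have dlim: "(\<lambda>k. LINT x|?N. norm (grad (v k) x - g k x) powr q) \<longlonglongrightarrow> 0"
    by (rule tendsto_sandwich[OF _ _ tendsto_const e0])
       (use v(3) in \<open>auto intro!: always_eventually Bochner_Integration.integral_nonneg\<close>)

  \<comment> \<open>Strong convergence of the mean-free potentials\<close>
  have "\<exists>m. (\<lambda>k. LINT x|ball_measure z r. \<bar>v k x - m k\<bar> powr q) \<longlonglongrightarrow> 0"
  proof (rule weak_grad_imp_strong_conv[OF pq(2) r v(1)])
    have [measurable]: "grad (v k) \<in> borel_measurable borel" for k by (rule borel_measurable_grad[OF v(1)])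
    show "(LINT x|ball_measure z r. norm (grad (v k) x) powr q) \<le> M" for k
      using M[of k] unfolding B_def by (subst lebesgue_on_ball[symmetric]) auto
    fix b :: "real^'n \<Rightarrow> real^'n" and C
    assume b [measurable]: "b \<in> borel_measurable borel" and C: "\<And>y. norm (b y) \<le> C"
    \<comment> \<open>On a set of finite measure a bounded field lies in \<open>L\<^sup>p\<close>,
      so weak convergence of \<open>G k\<close> may be tested with it.\<close>
    have bL: "b \<in> Lq p B"
    proof (rule LqI)
      show "integrable ?N (\<lambda>x. norm (b x) powr p)"
        by (rule N.integrable_const_bound[where B = "C powr p"])
           (use C p in \<open>auto intro!: powr_mono2 borel_measurable_lebesgue_onI\<close>)
    qed (use b borel_measurable_lebesgue_onI in blast)
    have "(\<lambda>k. LINT x|?N. b x \<bullet> (grad (v k) x - g k x)) \<longlonglongrightarrow> 0"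
    proof (rule tendsto_0_if_Holder_bound[OF _ _ order_refl dlim])
      show "\<bar>LINT x|?N. b x \<bullet> (grad (v k) x - g k x)\<bar> \<le>
        (LINT x|?N. norm (b x) powr p) powr (1/p) * (LINT x|?N. norm (grad (v k) x - g k x) powr q) powr (1/q)" for k
        by (intro Lq_inner(3)[OF pq] bL Lq_diff(1) v gL q0(1))
    qed (use pq in \<open>auto intro!: Bochner_Integration.integral_nonneg\<close>)
    moreover have "(\<lambda>k. LINT x|?N. b x \<bullet> g k x) \<longlonglongrightarrow> 0"
    proof -
      have "(\<lambda>k. (LINT x|?N. G k x \<bullet> b x) - (LINT x|?N. Ginf x \<bullet> b x)) \<longlonglongrightarrow> (LINT x|?N. Ginf x \<bullet> b x) - (LINT x|?N. Ginf x \<bullet> b x)"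
        by (intro tendsto_diff weak_conv_Lq_inner[OF pq(2,1) qp G bL] tendsto_const)
      moreover have "(LINT x|?N. b x \<bullet> g k x) = (LINT x|?N. G k x \<bullet> b x) - (LINT x|?N. Ginf x \<bullet> b x)" for k
        using Lq_inner(1)[OF pq(2,1) qp GL(1)[of k] bL] Lq_inner(1)[OF pq(2,1) qp GL(2) bL]
        by (simp add: g_def inner_diff_right inner_commute[of "b _"])
      ultimately show ?thesis by simp
    qed
    ultimately have "(\<lambda>k. (LINT x|?N. b x \<bullet> (grad (v k) x - g k x)) + (LINT x|?N. b x \<bullet> g k x)) \<longlonglongrightarrow> 0 + 0"
      by (rule tendsto_add)
    moreover have "(LINT x|?N. b x \<bullet> (grad (v k) x - g k x)) + (LINT x|?N. b x \<bullet> g k x) = (LINT x|ball_measure z r. b x \<bullet> grad (v k) x)" for k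
    proof -
      have "(LINT x|?N. b x \<bullet> (grad (v k) x - g k x)) + (LINT x|?N. b x \<bullet> g k x)
        = (LINT x|?N. b x \<bullet> (grad (v k) x - g k x) + b x \<bullet> g k x)"
        by (intro Bochner_Integration.integral_add[symmetric] Lq_inner(1)[OF pq bL] Lq_diff(1) v gL q0(1))
      also have "\<dots> = (LINT x|?N. b x \<bullet> grad (v k) x)" by (simp add: inner_diff_right)
      also have "\<dots> = (LINT x|ball_measure z r. b x \<bullet> grad (v k) x)"
        unfolding B_def by (rule lebesgue_on_ball) measurable
      finally show ?thesis .
    qed
    ultimately show "(\<lambda>k. LINT x|ball_measure z r. b x \<bullet> grad (v k) x) \<longlonglongrightarrow> 0" by simp
  qed
  then obtain m where m: "(\<lambda>k. LINT x|ball_measure z r. \<bar>v k x - m k\<bar> powr q) \<longlonglongrightarrow> 0" by blast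
  define u where "u k x = v k x - m k" for k x
  have us: "smooth_fun (u k)" for k unfolding u_def by (intro smooth_fun_diff v smooth_fun_const)
  have gu: "grad (u k) x = grad (v k) x" for k x
    unfolding u_def using grad_diff[OF v(1) smooth_fun_const, of k "m k" x] by (simp add: grad_const)
  have um [measurable]: "u k \<in> borel_measurable borel" for k by (rule borel_measurable_smooth_fun[OF us])
  have ulim: "(\<lambda>k. LINT x|?N. norm (u k x) powr q) \<longlonglongrightarrow> 0"
  proof -
    have "(LINT x|?N. norm (u k x) powr q) = (LINT x|ball_measure z r. \<bar>v k x - m k\<bar> powr q)" for k
      unfolding B_def by (subst lebesgue_on_ball) (auto simp: u_def[symmetric])
    then show ?thesis using m by simp
  qed
  have uL: "u k \<in> Lq q B" for k
  proof (rule LqI)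
    obtain C where C: "C > 0" "\<And>x. x \<in> ball z r \<Longrightarrow> norm (u k x) \<le> C"
      using continuous_bounded_on_ball[OF smooth_fun_continuous[OF us]] by blast
    show "integrable ?N (\<lambda>x. norm (u k x) powr q)"
      by (rule N.integrable_const_bound[where B = "C powr q"])
         (use C q0 in \<open>auto intro!: powr_mono2 borel_measurable_lebesgue_onI simp: B_def simp del: mem_ball\<close>)
  qed (intro borel_measurable_lebesgue_onI um)
  obtain U where U: "\<And>k. (LINT x|?N. norm (u k x) powr q) \<le> U"
    using convergent_imp_Bseq[OF convergentI[OF ulim]] unfolding Bseq_def by (metis abs_le_D1 real_norm_def)

  \<comment> \<open>The test functions \<open>T k\<close> and their Sobolev norms\<close>
  obtain C0 where C0: "C0 > 0" "\<And>x. \<bar>\<theta> x\<bar> \<le> C0" using test_functions_bounded[OF \<theta>] by blast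
  obtain C1 where C1: "C1 > 0" "\<And>x. norm (grad \<theta> x) \<le> C1" using test_functions_grad_bounded[OF \<theta>] by blast
  have \<theta>s: "smooth_fun \<theta>" by (rule test_functions_smooth[OF \<theta>])
  have \<theta>m [measurable]: "\<theta> \<in> borel_measurable borel" "grad \<theta> \<in> borel_measurable borel"
    using \<theta>s by (auto intro: borel_measurable_smooth_fun borel_measurable_grad)
  note \<theta>L = Lq_bounded_scaleR[OF _ \<theta>m(1) C0(2)]
  have ugL: "(\<lambda>x. u k x *\<^sub>R grad \<theta> x) \<in> Lq q B"
    and ugn: "(LINT x|?N. norm (u k x *\<^sub>R grad \<theta> x) powr q) \<le> C1 powr q * (LINT x|?N. norm (u k x) powr q)" for k
  proof -
    note A = Lq_bounded_scaleR[OF uL[of k], of "\<lambda>x. norm (grad \<theta> x)" C1]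
    have "(\<lambda>x. norm (grad \<theta> x) *\<^sub>R u k x) \<in> Lq q B" using C1 q0 by (intro A) auto
    then show "(\<lambda>x. u k x *\<^sub>R grad \<theta> x) \<in> Lq q B"
      by (auto simp: Lq_def mult.commute abs_mult intro!: borel_measurable_lebesgue_onI)
    show "(LINT x|?N. norm (u k x *\<^sub>R grad \<theta> x) powr q) \<le> C1 powr q * (LINT x|?N. norm (u k x) powr q)"
      using A(2) C1 q0 by (simp add: mult.commute abs_mult)
  qed
  define T where "T k x = \<theta> x * u k x" for k x
  have Tt: "T k \<in> test_functions B" for k unfolding T_def by (rule test_functions_mult[OF \<theta> us])
  have Tg: "grad (T k) x = u k x *\<^sub>R grad \<theta> x + \<theta> x *\<^sub>R grad (v k) x" for k x
    unfolding T_def using grad_mult[OF \<theta>s us, of k x] by (simp add: gu)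
  have Tn: "(LINT x|?N. norm (T k x) powr q) \<le> C0 powr q * U" for k
  proof -
    have "(LINT x|?N. norm (T k x) powr q) \<le> C0 powr q * (LINT x|?N. norm (u k x) powr q)"
      unfolding T_def using \<theta>L(2)[OF uL[of k] q0(1)] by simp
    also have "\<dots> \<le> C0 powr q * U" using U by (intro mult_left_mono) auto
    finally show ?thesis .
  qed
  have TgL: "grad (T k) \<in> Lq q B" for k
    by (rule test_functions_Lq(4)[OF Tt q0(2) B(2)])
  have Tgn: "(LINT x|?N. norm (grad (T k) x) powr q) \<le> 2 powr q * (C1 powr q * U + C0 powr q * M)" for k
  proof -
    have "(LINT x|?N. norm (grad (T k) x) powr q) \<le>
      2 powr q * ((LINT x|?N. norm (u k x *\<^sub>R grad \<theta> x) powr q) + (LINT x|?N. norm (\<theta> x *\<^sub>R grad (v k) x) powr q))"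
      unfolding Tg by (intro Lq_add(2) q0(1) ugL \<theta>L(1) v)
    also have "\<dots> \<le> 2 powr q * (C1 powr q * U + C0 powr q * M)"
    proof (intro mult_left_mono add_mono)
      show "(LINT x|?N. norm (u k x *\<^sub>R grad \<theta> x) powr q) \<le> C1 powr q * U"
        using ugn[of k] mult_left_mono[OF U[of k], of "C1 powr q"] by simp
      show "(LINT x|?N. norm (\<theta> x *\<^sub>R grad (v k) x) powr q) \<le> C0 powr q * M"
        using \<theta>L(2)[OF v(2)[of k] q0(1)] mult_left_mono[OF M[of k], of "C0 powr q"] by simp
    qed simp
    finally show ?thesis .
  qed
  define A where "A = C0 powr q * U + 2 powr q * (C1 powr q * U + C0 powr q * M)"
  \<comment> \<open>\<open>A\<close> bounds the \<open>q\<close>-th power of the Sobolev norm of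
    every \<open>T k\<close>; adding 1 keeps \<open>R\<close> positive, and \<open>T k\<close>
    divided by \<open>R\<close> is admissible in the dual norm.\<close>
  define R where "R = (A + 1) powr (1 / q)"
  \<comment> \<open>\<open>U\<close> and \<open>M\<close> were obtained as mere upper bounds; that
    \<open>A\<close> is nonnegative is read off from the integrals it dominates, at index 0.\<close>
  have Tnn: "0 \<le> (LINT x|?N. norm (T 0 x) powr q)" "0 \<le> (LINT x|?N. norm (grad (T 0) x) powr q)"
    by (intro Bochner_Integration.integral_nonneg; simp)+
  have A0: "A \<ge> 0" unfolding A_def
    by (rule add_nonneg_nonneg[OF order_trans[OF Tnn(1) Tn] order_trans[OF Tnn(2) Tgn]])
  have R: "R > 0" "R powr q = A + 1" using A0 q0 by (auto simp: R_def powr_powr)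
  have loc: "(LINT x|lborel. norm (w x) powr q) = (LINT x|?N. norm (w x) powr q)"
    if "w \<in> borel_measurable borel" "\<And>x. x \<notin> B \<Longrightarrow> w x = 0" for w :: "real^'n \<Rightarrow> 'c::euclidean_space"
  proof -
    have "(LINT x|lborel. norm (w x) powr q) = (LINT x|lebesgue_on UNIV. norm (w x) powr q)"
      using that by (simp add: lebesgue_on_UNIV_eq integral_completion)
    also have "\<dots> = (LINT x|?N. norm (w x) powr q)" using that B by (intro lebesgue_on_support(1)) auto
    finally show ?thesis .
  qed
  have T0: "T k x = 0" "grad (T k) x = 0" if "x \<notin> B" for k x
  proof -
    obtain K where K: "smooth_fun (T k)" "compact K" "K \<subseteq> B" "\<And>x. x \<notin> K \<Longrightarrow> T k x = 0"
      by (rule test_functionsE[OF Tt]) blast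
    show "T k x = 0" "grad (T k) x = 0"
      using K that partial_eq_0_outside[of K "T k" x] by (auto simp: vec_eq_iff compact_imp_closed)
  qed
  have W: "W1_norm q (\<lambda>x. (1/R) * T k x) \<le> 1" for k
  proof -
    have Ts: "smooth_fun (T k)" by (rule test_functions_smooth[OF Tt])
    have t: "(\<lambda>x. (1/R) * T k x) \<in> test_functions UNIV"
      using test_functions_mono[OF test_functions_mult[OF Tt smooth_fun_const, of k "1/R"]] by (simp add: mult.commute)
    have "W1_norm q (\<lambda>x. (1/R) * T k x) = ((LINT x|lborel. \<bar>(1/R) * T k x\<bar> powr q)
        + (LINT x|lborel. norm (grad (\<lambda>x. (1/R) * T k x) x) powr q)) powr (1/q)"
      by (rule W1_norm_test[OF t q0(2)])
    also have "(LINT x|lborel. \<bar>(1/R) * T k x\<bar> powr q) = (LINT x|?N. norm (T k x) powr q) / (A + 1)"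
      using R loc[OF borel_measurable_smooth_fun[OF Ts] T0(1)] by (simp add: abs_mult powr_divide)
    also have "(LINT x|lborel. norm (grad (\<lambda>x. (1/R) * T k x) x) powr q) = (LINT x|?N. norm (grad (T k) x) powr q) / (A + 1)"
    proof -
      have gR: "norm (grad (\<lambda>x. (1/R) * T k x) x) powr q = norm (grad (T k) x) powr q / (A + 1)" for x
        unfolding grad_cmult[OF Ts] using R by (simp add: powr_divide)
      show ?thesis unfolding gR using loc[OF borel_measurable_grad[OF Ts] T0(2)] by simp
    qed
    also have "((LINT x|?N. norm (T k x) powr q) / (A + 1) + (LINT x|?N. norm (grad (T k) x) powr q) / (A + 1)) powr (1/q) \<le> 1 powr (1/q)"
    proof (rule powr_mono2)
      show "(LINT x|?N. norm (T k x) powr q) / (A + 1) + (LINT x|?N. norm (grad (T k) x) powr q) / (A + 1) \<le> 1"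
        using Tn[of k] Tgn[of k] A0 by (simp add: add_divide_distrib[symmetric] A_def)
      show "0 \<le> (LINT x|?N. norm (T k x) powr q) / (A + 1) + (LINT x|?N. norm (grad (T k) x) powr q) / (A + 1)"
        using A0 by (intro add_nonneg_nonneg divide_nonneg_nonneg Bochner_Integration.integral_nonneg) auto
    qed (use q0 in simp)
    finally show ?thesis by simp
  qed

  \<comment> \<open>The three terms of the product of differences\<close>
  have I1: "(\<lambda>k. LINT x|?N. f k x \<bullet> grad (T k) x) \<longlonglongrightarrow> 0"
  proof (rule Lim_null_comparison)
    show "(\<lambda>k. R * Wm1_norm p B (\<lambda>u. S k u - Sinf u)) \<longlonglongrightarrow> 0"
      using tendsto_mult_right_zero[OF Sconv] by simp
    have "\<bar>LINT x|?N. f k x \<bullet> grad (T k) x\<bar> \<le> R * Wm1_norm p B (\<lambda>u. S k u - Sinf u)" for k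
    proof -
      let ?w = "\<lambda>x. (1/R) * T k x"
      have w: "?w \<in> test_functions B"
        using test_functions_mult[OF Tt smooth_fun_const, of k "1/R"] by (simp add: mult.commute)
      have gw: "grad ?w x = (1/R) *\<^sub>R grad (T k) x" for x
        by (rule grad_cmult[OF test_functions_smooth[OF Tt]])
      \<comment> \<open>The integral is \<open>- R\<close> times this pairing, and the pairing is at
        most the dual norm of the difference of the divergences. This is where their strong
        convergence enters.\<close>
      define \<Delta> where "\<Delta> = S k ?w - Sinf ?w"
      have "\<Delta> = - (1/R) * (LINT x|?N. f k x \<bullet> grad (T k) x)"
        using Lq_inner(1)[OF pq FL(1)[of k] TgL[of k]] Lq_inner(1)[OF pq FL(2) TgL[of k]]
        unfolding \<Delta>_def SF[OF w] SFinf[OF w] gw f_def inner_diff_left by (simp add: diff_divide_distrib)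
      then have "(LINT x|?N. f k x \<bullet> grad (T k) x) = - (R * \<Delta>)" using R by (simp add: field_simps)
      then have "\<bar>LINT x|?N. f k x \<bullet> grad (T k) x\<bar> = R * \<bar>\<Delta>\<bar>" using R by (simp add: abs_mult)
      moreover have "\<bar>\<Delta>\<bar> \<le> Wm1_norm p B (\<lambda>u. S k u - Sinf u)"
        unfolding \<Delta>_def using W[of k] q0(2) by (intro Wm1_norm_bound[OF S(1) S(2) w]) (auto simp: q_def)
      ultimately show ?thesis using R by (simp add: mult_left_mono)
    qed
    then show "\<forall>\<^sub>F k in sequentially. norm (LINT x|?N. f k x \<bullet> grad (T k) x) \<le> R * Wm1_norm p B (\<lambda>u. S k u - Sinf u)"
      by simp
  qed
  have I2: "(\<lambda>k. LINT x|?N. f k x \<bullet> (u k x *\<^sub>R grad \<theta> x)) \<longlonglongrightarrow> 0"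
  proof (rule tendsto_0_if_Holder_bound[OF _ _ Mf])
    show "\<bar>LINT x|?N. f k x \<bullet> (u k x *\<^sub>R grad \<theta> x)\<bar> \<le>
      (LINT x|?N. norm (f k x) powr p) powr (1/p) * (LINT x|?N. norm (u k x *\<^sub>R grad \<theta> x) powr q) powr (1/q)" for k
      by (intro Lq_inner(3)[OF pq] fL ugL)
    show "(\<lambda>k. LINT x|?N. norm (u k x *\<^sub>R grad \<theta> x) powr q) \<longlonglongrightarrow> 0"
      by (rule tendsto_sandwich[OF _ _ tendsto_const tendsto_mult_right_zero[OF ulim]])
         (use ugn in \<open>auto intro!: always_eventually Bochner_Integration.integral_nonneg simp del: norm_scaleR\<close>)
  qed (use pq in \<open>auto intro!: Bochner_Integration.integral_nonneg\<close>)
  have I3: "(\<lambda>k. LINT x|?N. (\<theta> x *\<^sub>R f k x) \<bullet> (grad (v k) x - g k x)) \<longlonglongrightarrow> 0"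
  proof (rule tendsto_0_if_Holder_bound[OF _ _ _ dlim])
    show "\<bar>LINT x|?N. (\<theta> x *\<^sub>R f k x) \<bullet> (grad (v k) x - g k x)\<bar> \<le>
      (LINT x|?N. norm (\<theta> x *\<^sub>R f k x) powr p) powr (1/p) * (LINT x|?N. norm (grad (v k) x - g k x) powr q) powr (1/q)" for k
      by (intro Lq_inner(3)[OF pq] fL gL \<theta>L(1) Lq_diff(1) v p0 q0(1))
    show "(LINT x|?N. norm (\<theta> x *\<^sub>R f k x) powr p) \<le> C0 powr p * Mf" for k
      using \<theta>L(2)[OF fL[of k] p0] mult_left_mono[OF Mf[of k], of "C0 powr p"] by simp
  qed (use pq in \<open>auto intro!: Bochner_Integration.integral_nonneg\<close>)
  \<comment> \<open>The product rule gives \<open>\<theta> grad (v k)\<close> as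
    \<open>grad (T k)\<close> minus \<open>u k\<close> times the gradient of
    \<open>\<theta>\<close>, and \<open>g k\<close> is \<open>grad (v k)\<close> minus the
    approximation error; hence the three terms.\<close>
  have fg: "(\<lambda>k. LINT x|?N. \<theta> x * (f k x \<bullet> g k x)) \<longlonglongrightarrow> 0"
  proof -
    have "(LINT x|?N. \<theta> x * (f k x \<bullet> g k x)) = (LINT x|?N. f k x \<bullet> grad (T k) x)
      - (LINT x|?N. f k x \<bullet> (u k x *\<^sub>R grad \<theta> x)) - (LINT x|?N. (\<theta> x *\<^sub>R f k x) \<bullet> (grad (v k) x - g k x))" for k
    proof -
      have "\<theta> x * (f k x \<bullet> g k x) = f k x \<bullet> grad (T k) x - f k x \<bullet> (u k x *\<^sub>R grad \<theta> x)
        - (\<theta> x *\<^sub>R f k x) \<bullet> (grad (v k) x - g k x)" for x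
        by (simp add: Tg inner_add_right inner_diff_right right_diff_distrib)
      then have "(LINT x|?N. \<theta> x * (f k x \<bullet> g k x)) = (LINT x|?N. f k x \<bullet> grad (T k) x - f k x \<bullet> (u k x *\<^sub>R grad \<theta> x)
        - (\<theta> x *\<^sub>R f k x) \<bullet> (grad (v k) x - g k x))" by presburger
      also have "\<dots> = (LINT x|?N. f k x \<bullet> grad (T k) x)
        - (LINT x|?N. f k x \<bullet> (u k x *\<^sub>R grad \<theta> x)) - (LINT x|?N. (\<theta> x *\<^sub>R f k x) \<bullet> (grad (v k) x - g k x))"
        using Lq_inner(1)[OF pq fL TgL, of k k] Lq_inner(1)[OF pq fL ugL, of k k]
          Lq_inner(1)[OF pq \<theta>L(1)[OF fL p0] Lq_diff(1)[OF q0(1) v(2) gL], of k k k]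
        by (subst Bochner_Integration.integral_diff) (auto simp del: inner_scaleR_left inner_scaleR_right)
      finally show ?thesis .
    qed
    then show ?thesis using tendsto_diff[OF tendsto_diff[OF I1 I2] I3] by simp
  qed

  \<comment> \<open>Recombination with the weak limits\<close>
  have l1: "(\<lambda>k. LINT x|?N. F k x \<bullet> (\<theta> x *\<^sub>R Ginf x)) \<longlonglongrightarrow> (LINT x|?N. Finf x \<bullet> (\<theta> x *\<^sub>R Ginf x))"
    by (intro weak_conv_Lq_inner[OF pq F] \<theta>L(1) GL q0(1))
  have l2: "(\<lambda>k. LINT x|?N. G k x \<bullet> (\<theta> x *\<^sub>R Finf x)) \<longlonglongrightarrow> (LINT x|?N. Ginf x \<bullet> (\<theta> x *\<^sub>R Finf x))"
    by (intro weak_conv_Lq_inner[OF pq(2,1) qp G] \<theta>L(1) FL p0)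
  let ?I = "LINT x|?N. \<theta> x * (Finf x \<bullet> Ginf x)"
  \<comment> \<open>Expansion around the weak limits: each mixed term is linear in one weakly
    convergent sequence, and the constant term is counted twice, hence subtracted once.\<close>
  have "(LINT x|?N. \<theta> x * (F k x \<bullet> G k x)) = (LINT x|?N. \<theta> x * (f k x \<bullet> g k x))
    + (LINT x|?N. F k x \<bullet> (\<theta> x *\<^sub>R Ginf x)) + (LINT x|?N. G k x \<bullet> (\<theta> x *\<^sub>R Finf x)) - ?I" for k
  proof -
    have eq: "\<theta> x * (F k x \<bullet> G k x) = \<theta> x * (f k x \<bullet> g k x) + F k x \<bullet> (\<theta> x *\<^sub>R Ginf x)
      + G k x \<bullet> (\<theta> x *\<^sub>R Finf x) - \<theta> x * (Finf x \<bullet> Ginf x)" for x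
      by (simp add: f_def g_def inner_diff_left inner_diff_right inner_commute algebra_simps)
    have i1: "integrable ?N (\<lambda>x. \<theta> x * (f k x \<bullet> g k x))"
      using Lq_inner(1)[OF pq \<theta>L(1)[OF fL p0] gL, of k k] by simp
    have i2: "integrable ?N (\<lambda>x. F k x \<bullet> (\<theta> x *\<^sub>R Ginf x))"
      by (intro Lq_inner(1)[OF pq] FL \<theta>L(1) GL q0(1))
    have i3: "integrable ?N (\<lambda>x. G k x \<bullet> (\<theta> x *\<^sub>R Finf x))"
      by (intro Lq_inner(1)[OF pq(2,1) qp] FL \<theta>L(1) GL p0)
    have i4: "integrable ?N (\<lambda>x. \<theta> x * (Finf x \<bullet> Ginf x))"
      using Lq_inner(1)[OF pq \<theta>L(1)[OF FL(2) p0] GL(2)] by simp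
    show ?thesis unfolding eq using i1 i2 i3 i4
      by (simp del: inner_scaleR_left inner_scaleR_right)
  qed
  moreover have "(\<lambda>k. (LINT x|?N. \<theta> x * (f k x \<bullet> g k x)) + (LINT x|?N. F k x \<bullet> (\<theta> x *\<^sub>R Ginf x))
    + (LINT x|?N. G k x \<bullet> (\<theta> x *\<^sub>R Finf x)) - ?I) \<longlonglongrightarrow> 0 + (LINT x|?N. Finf x \<bullet> (\<theta> x *\<^sub>R Ginf x))
    + (LINT x|?N. Ginf x \<bullet> (\<theta> x *\<^sub>R Finf x)) - ?I"
    by (intro tendsto_add tendsto_diff fg l1 l2 tendsto_const)
  moreover have "(LINT x|?N. Finf x \<bullet> (\<theta> x *\<^sub>R Ginf x)) = ?I" "(LINT x|?N. Ginf x \<bullet> (\<theta> x *\<^sub>R Finf x)) = ?I"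
    by (simp_all add: inner_commute)
  ultimately show ?thesis by simp
qed

subsection \<open>From balls to open sets\<close>

text \<open>Besides a relatively compact neighbourhood it yields a radius that is uniform over
  \<open>K\<close>; this radius fixes the size of the small balls in the averaging argument.\<close>

lemma compact_open_neighbourhood:
  fixes K :: "'a::euclidean_space set"
  assumes K: "compact K" and \<Omega>: "open \<Omega>" "K \<subseteq> \<Omega>"
  obtains e U where "0 < e" "open U" "K \<subseteq> U" "bounded U" "compactly_in U \<Omega>"
    "\<And>x. x \<in> K \<Longrightarrow> cball x e \<subseteq> \<Omega>"
proof -
  obtain e where e: "e > 0" "(\<Union>x\<in>K. cball x e) \<subseteq> \<Omega>"
    using compact_subset_open_imp_cball_epsilon_subset[OF K \<Omega>] by blast
  define U where "U = (\<Union>x\<in>K. ball x e)"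
  define C where "C = {x + y |x y. x \<in> K \<and> y \<in> cball 0 e}"
  have C: "compact C" unfolding C_def by (intro compact_sums K compact_cball)
  have UC: "U \<subseteq> C"
  proof
    fix y assume "y \<in> U"
    then obtain x where x: "x \<in> K" "dist x y < e" by (auto simp: U_def)
    then have "y = x + (y - x)" "y - x \<in> cball 0 e" by (auto simp: dist_norm norm_minus_commute)
    then show "y \<in> C" using x unfolding C_def by blast
  qed
  have CO: "C \<subseteq> \<Omega>"
  proof
    fix y assume "y \<in> C"
    then obtain x w where "y = x + w" "x \<in> K" "norm w \<le> e" by (auto simp: C_def)
    then have "x \<in> K" "y \<in> cball x e" by (auto simp: dist_norm)
    then show "y \<in> \<Omega>" using e by blast
  qed
  show ?thesis
  proof (rule that[of e U])
    show "open U" by (auto simp: U_def)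
    show "K \<subseteq> U" using e(1) by (auto simp: U_def)
    show "bounded U" using UC C bounded_subset compact_imp_bounded by blast
    show "compactly_in U \<Omega>" unfolding compactly_in_def using UC C CO by blast
    show "cball x e \<subseteq> \<Omega>" if "x \<in> K" for x using e(2) that by blast
  qed (rule e)
qed

lemma test_times_locally_integrable:
  fixes P :: "real^'n::finite \<Rightarrow> real"
  assumes \<Omega>: "open \<Omega>" and P: "\<And>U. open U \<Longrightarrow> compactly_in U \<Omega> \<Longrightarrow> integrable (lebesgue_on U) P"
    and \<phi>: "\<phi> \<in> test_functions \<Omega>"
  shows "integrable (lebesgue_on \<Omega>) (\<lambda>x. \<phi> x * P x)"
proof -
  obtain K where K: "smooth_fun \<phi>" "compact K" "K \<subseteq> \<Omega>" "\<And>x. x \<notin> K \<Longrightarrow> \<phi> x = 0"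
    by (rule test_functionsE[OF \<phi>]) blast
  obtain e U where U: "open U" "K \<subseteq> U" "bounded U" "compactly_in U \<Omega>"
    using compact_open_neighbourhood[OF K(2) \<Omega> K(3)] by metis
  obtain C where C: "\<And>x. \<bar>\<phi> x\<bar> \<le> C" using test_functions_bounded[OF \<phi>] by blast
  have sub: "U \<subseteq> \<Omega>" using U(4) by (auto simp: compactly_in_def)
  have "integrable (lebesgue_on U) (\<lambda>x. \<phi> x *\<^sub>R P x)"
    by (rule integrable_bounded_scaleR[OF P[OF U(1,4)] _ C])
       (intro borel_measurable_lebesgue_onI borel_measurable_smooth_fun K(1))
  moreover have "\<phi> x * P x = 0" if "x \<in> \<Omega> - U" for x using that U K(4) by auto
  ultimately show ?thesis
    using sub \<Omega> U by (subst lebesgue_on_support(2)[where V = U]) auto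
qed

text \<open>A distribution of order 0: the seminorm estimate holds with \<open>N = 0\<close>, and
  its constant is the integral of \<open>\<bar>P\<bar>\<close> over a relatively compact
  neighbourhood of \<open>K\<close>.\<close>

lemma distr_of_in_distributions:
  fixes P :: "real^'n::finite \<Rightarrow> real"
  assumes \<Omega>: "open \<Omega>" and P: "\<And>U. open U \<Longrightarrow> compactly_in U \<Omega> \<Longrightarrow> integrable (lebesgue_on U) P"
  shows "distr_of \<Omega> P \<in> distributions \<Omega>"
proof -
  note int = test_times_locally_integrable[OF \<Omega> P]
  have "\<exists>C N. \<forall>\<phi>\<in>test_functions \<Omega>. {x. \<phi> x \<noteq> 0} \<subseteq> K \<longrightarrow>
      \<bar>distr_of \<Omega> P \<phi>\<bar> \<le> C * (\<Sum>js\<in>{js. length js \<le> N}. SUP x. \<bar>partials js \<phi> x\<bar>)"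
    if K: "compact K" "K \<subseteq> \<Omega>" for K
  proof -
    obtain e U where U: "open U" "K \<subseteq> U" "bounded U" "compactly_in U \<Omega>"
      using compact_open_neighbourhood[OF K(1) \<Omega> K(2)] by metis
    have sub: "U \<subseteq> \<Omega>" using U(4) by (auto simp: compactly_in_def)
    define C where "C = (LINT x|lebesgue_on U. \<bar>P x\<bar>)"
    have "\<bar>distr_of \<Omega> P \<phi>\<bar> \<le> C * (\<Sum>js\<in>{js. length js \<le> 0}. SUP x. \<bar>partials js \<phi> x\<bar>)"
      if \<phi>: "\<phi> \<in> test_functions \<Omega>" and supp: "{x. \<phi> x \<noteq> 0} \<subseteq> K" for \<phi>
    proof -
      define s where "s = (SUP x. \<bar>\<phi> x\<bar>)"
      obtain C' where C': "\<And>x. \<bar>\<phi> x\<bar> \<le> C'" using test_functions_bounded[OF \<phi>] by blast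
      have s: "\<bar>\<phi> x\<bar> \<le> s" for x unfolding s_def by (intro cSUP_upper bdd_aboveI2[of _ _ C'] C') auto
      have z: "\<phi> x * P x = 0" if "x \<in> \<Omega> - U" for x using that U supp by auto
      have i: "integrable (lebesgue_on U) (\<lambda>x. \<phi> x * P x)"
        using int[OF _ _ \<phi>] lebesgue_on_support(2)[of \<Omega> U "\<lambda>x. \<phi> x * P x"] \<Omega> U sub z by auto
      have iP: "integrable (lebesgue_on U) (\<lambda>x. s * \<bar>P x\<bar>)" using P[OF U(1,4)] by simp
      have "distr_of \<Omega> P \<phi> = (LINT x|lebesgue_on U. \<phi> x * P x)"
        unfolding distr_of_def using \<Omega> U sub z by (intro lebesgue_on_support(1)) auto
      also have "\<bar>\<dots>\<bar> \<le> (LINT x|lebesgue_on U. \<bar>\<phi> x * P x\<bar>)"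
        using integral_norm_bound[of "lebesgue_on U" "\<lambda>x. \<phi> x * P x"] by simp
      also have "\<dots> \<le> (LINT x|lebesgue_on U. s * \<bar>P x\<bar>)"
        using s by (intro integral_mono[OF integrable_abs[OF i] iP]) (auto simp: abs_mult intro!: mult_right_mono)
      also have "\<dots> = C * s" by (simp add: C_def)
      finally show ?thesis by (simp add: s_def partials_def)
    qed
    then show ?thesis by blast
  qed
  then show ?thesis unfolding distributions_def
    using int by (auto simp: distr_of_def distrib_right mult.assoc)
qed

lemma integral_reflect_translate:
  fixes \<eta> :: "real^'n::finite \<Rightarrow> real"
  assumes "\<eta> \<in> borel_measurable borel"
  shows "(LINT c|lborel. \<eta> (x - c)) = (LINT y|lborel. \<eta> y)"
    and "integrable lborel (\<lambda>c. \<eta> (x - c)) \<longleftrightarrow> integrable lborel \<eta>"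
  using lborel_integral_affine[OF assms, of "-1" x] by simp_all

text \<open>Averaging over the translates of a bump function replaces a partition of unity.\<close>

lemma integral_average_translates:
  fixes P \<phi> \<eta> :: "real^'n::finite \<Rightarrow> real"
  assumes U: "bounded U" "U \<in> sets lebesgue" and P: "integrable (lebesgue_on U) (\<lambda>x. \<phi> x * P x)"
    and \<eta>: "\<eta> \<in> borel_measurable borel" "integrable lborel \<eta>" "\<And>x. 0 \<le> \<eta> x"
  shows "(LINT c|lborel. LINT x|lebesgue_on U. \<phi> x * \<eta> (x - c) * P x) =
      (LINT y|lborel. \<eta> y) * (LINT x|lebesgue_on U. \<phi> x * P x)"
    and "(\<lambda>c. LINT x|lebesgue_on U. \<phi> x * \<eta> (x - c) * P x) \<in> borel_measurable lborel"
proof -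
  let ?N = "lebesgue_on U"
  note [measurable] = \<eta>(1)
  interpret N: finite_measure ?N by (rule finite_measure_lebesgue_on_bounded[OF U])
  interpret PS: pair_sigma_finite ?N lborel ..
  have id: "(\<lambda>x. x) \<in> borel_measurable ?N" by (rule borel_measurable_lebesgue_onI) simp
  have [measurable]: "fst \<in> borel_measurable (?N \<Otimes>\<^sub>M lborel)"
    by (rule measurable_compose[OF measurable_fst id])
  have [measurable]: "snd \<in> borel_measurable (?N \<Otimes>\<^sub>M lborel)"
    using measurable_snd[of ?N lborel] by simp
  have pm: "(\<lambda>p. \<phi> (fst p) * P (fst p)) \<in> borel_measurable (?N \<Otimes>\<^sub>M lborel)"
    by (rule measurable_compose[OF measurable_fst borel_measurable_integrable[OF P]])
  have fm: "(\<lambda>(x, c). (\<phi> x * P x) * \<eta> (x - c)) \<in> borel_measurable (?N \<Otimes>\<^sub>M lborel)"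
    unfolding case_prod_beta by (intro borel_measurable_times pm) measurable
  have fi: "integrable (?N \<Otimes>\<^sub>M lborel) (\<lambda>(x, c). (\<phi> x * P x) * \<eta> (x - c))"
  proof (rule PS.Fubini_integrable[OF fm])
    have "(LINT c|lborel. norm (case (x, c) of (x, c) \<Rightarrow> (\<phi> x * P x) * \<eta> (x - c))) = norm (\<phi> x * P x) * (LINT y|lborel. \<eta> y)" for x
      using \<eta>(3) by (simp add: abs_mult integral_reflect_translate[OF \<eta>(1)])
    then show "integrable ?N (\<lambda>x. LINT c|lborel. norm (case (x, c) of (x, c) \<Rightarrow> (\<phi> x * P x) * \<eta> (x - c)))"
      using integrable_norm[OF P] by simp
    show "AE x in ?N. integrable lborel (\<lambda>c. case (x, c) of (x, c) \<Rightarrow> (\<phi> x * P x) * \<eta> (x - c))"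
      using \<eta>(2) by (simp add: integral_reflect_translate[OF \<eta>(1)])
  qed
  have eq: "\<phi> x * \<eta> (x - c) * P x = (\<phi> x * P x) * \<eta> (x - c)" for x c by simp
  have "(LINT c|lborel. LINT x|?N. (\<phi> x * P x) * \<eta> (x - c)) = (LINT x|?N. LINT c|lborel. (\<phi> x * P x) * \<eta> (x - c))"
    by (rule PS.Fubini_integral[OF fi])
  also have "\<dots> = (LINT y|lborel. \<eta> y) * (LINT x|?N. \<phi> x * P x)"
    by (simp add: integral_reflect_translate[OF \<eta>(1)])
  finally show "(LINT c|lborel. LINT x|?N. \<phi> x * \<eta> (x - c) * P x) = (LINT y|lborel. \<eta> y) * (LINT x|?N. \<phi> x * P x)"
    unfolding eq .
  show "(\<lambda>c. LINT x|?N. \<phi> x * \<eta> (x - c) * P x) \<in> borel_measurable lborel"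
    unfolding eq using PS.integrable_snd[OF fi] by simp
qed

lemma exists_bump:
  assumes "0 < r"
  obtains \<eta> :: "real^'n::finite \<Rightarrow> real" where "smooth_fun \<eta>" "\<And>x. 0 \<le> \<eta> x" "\<And>x. \<eta> x \<le> 1"
    "\<And>x. norm x > r \<Longrightarrow> \<eta> x = 0" "integrable lborel \<eta>" "0 < (LINT x|lborel. \<eta> x)"
proof -
  \<comment> \<open>Half the side of a cube; with \<open>r\<close> divided by the dimension, the
    bound of the norm by the sum of the coordinates puts the cube inside the ball of radius
    \<open>r\<close>.\<close>
  define d :: "real^'n" where "d = (\<chi> i. r / real CARD('n))"
  let ?\<eta> = "box_bump 1 (- d) d"
  have t: "?\<eta> \<in> test_functions UNIV" by (rule box_bump_test_function) auto
  have out: "?\<eta> x = 0" if "norm x > r" for x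
  proof (rule box_bump_outside)
    show "x \<notin> box (- d) d"
    proof
      assume "x \<in> box (- d) d"
      then have x: "\<bar>x $ i\<bar> \<le> r / real CARD('n)" for i
        by (auto simp: mem_box_cart d_def abs_le_iff less_imp_le) (smt (verit))
      have "norm x \<le> (\<Sum>i\<in>UNIV. \<bar>x $ i\<bar>)" by (rule norm_le_l1_cart)
      also have "\<dots> \<le> (\<Sum>i\<in>(UNIV::'n set). r / real CARD('n))" by (intro sum_mono x)
      finally show False using that by simp
    qed
  qed simp
  have i: "integrable lborel ?\<eta>"
    using test_functions_Lq(1)[OF t, of 1] box_bump_bounds(1)[of 1 "-d" d] by simp
  \<comment> \<open>The bump is positive on an open box, so a vanishing integral would make a
    nonempty open set null.\<close>
  have "(LINT x|lborel. ?\<eta> x) \<noteq> 0"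
  proof
    assume "(LINT x|lborel. ?\<eta> x) = 0"
    then have "AE x in lborel. ?\<eta> x = 0"
      using integral_nonneg_eq_0_iff_AE[OF i AE_I2[OF box_bump_bounds(1)]] by simp
    then have "AE x in lborel. x \<notin> box (- d) d"
    proof eventually_elim
      case (elim x)
      then show ?case using box_bump_inside[of 1 x "-d" d] by auto
    qed
    then have "emeasure lborel (box (- d) d) = 0"
      by (subst (asm) AE_iff_measurable[of "box (-d) d"]) auto
    moreover have "0 \<in> box (- d) d" using assms by (auto simp: mem_box_cart d_def)
    then have "box (- d) d \<noteq> {}" by blast
    ultimately show False
      using open_not_negligible[OF open_box, of "-d" d] by (simp add: negligible_iff_null_sets null_sets_def)
  qed
  moreover have "0 \<le> (LINT x|lborel. ?\<eta> x)" by (intro Bochner_Integration.integral_nonneg box_bump_bounds)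
  ultimately have pos: "0 < (LINT x|lborel. ?\<eta> x)" by linarith
  show ?thesis
  proof (rule that[of ?\<eta>])
    show "?\<eta> x = 0" if "norm x > r" for x by (rule out[OF that])
  qed (rule smooth_fun_box_bump box_bump_bounds i pos)+
qed

theorem theorem5:
  fixes \<Omega> :: "(real^'n::finite) set"
    and p s :: real
    and F :: "nat \<Rightarrow> real^'n \<Rightarrow> real^'n" and Finf :: "real^'n \<Rightarrow> real^'n"
    and w :: "nat \<Rightarrow> real^'n \<Rightarrow> real" and winf :: "real^'n \<Rightarrow> real"
  assumes "CARD('n) \<ge> 2"
    and "open \<Omega>"
    and "1 < p"
    and "0 < s" and "s < 1"
    and "\<And>k. F k \<in> Lq_loc p \<Omega>" and "Finf \<in> Lq_loc p \<Omega>"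
    and "\<And>k. w k \<in> Hsq s (conj_exp p)" and "winf \<in> Hsq s (conj_exp p)"
    and "weak_conv_Lq_loc p \<Omega> F Finf"
    and "weak_conv_Lq_loc (conj_exp p) \<Omega>
           (\<lambda>k. frac_grad s (conj_exp p) (w k)) (frac_grad s (conj_exp p) winf)"
    and "strong_conv_Wm1_loc p \<Omega> (\<lambda>k. distr_div \<Omega> (F k)) (distr_div \<Omega> Finf)"
  shows "weak_star_conv_distr \<Omega>
           (\<lambda>k. distr_of \<Omega> (\<lambda>x. F k x \<bullet> frac_grad s (conj_exp p) (w k) x))
           (distr_of \<Omega> (\<lambda>x. Finf x \<bullet> frac_grad s (conj_exp p) winf x))"
proof -
  note n = assms(1) and \<Omega> = assms(2) and p = assms(3) and s = assms(4,5)
  define q where "q = conj_exp p"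
  define G where "G k = frac_grad s q (w k)" for k
  define Ginf where "Ginf = frac_grad s q winf"
  note pq = p conj_exp_props[OF p, folded q_def]
  have Fw: "weak_conv_Lq p U F Finf" if "open U" "compactly_in U \<Omega>" for U
    using assms(10) that by (simp add: weak_conv_Lq_loc_def)
  have Gw: "weak_conv_Lq q U G Ginf" if "open U" "compactly_in U \<Omega>" for U
    using assms(11) that by (simp add: weak_conv_Lq_loc_def q_def[symmetric] G_def[abs_def] Ginf_def)
  have FL: "F k \<in> Lq p U" "Finf \<in> Lq p U" and GL: "G k \<in> Lq q U" "Ginf \<in> Lq q U"
    if "open U" "compactly_in U \<Omega>" for U k
    using Fw[OF that] Gw[OF that] by (auto simp: weak_conv_Lq_def)
  define P where "P k x = F k x \<bullet> G k x" for k x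
  define Pinf where "Pinf x = Finf x \<bullet> Ginf x" for x
  have Pi: "integrable (lebesgue_on U) (P k)" "integrable (lebesgue_on U) Pinf"
    if "open U" "compactly_in U \<Omega>" for U k
    using Lq_inner(1)[OF pq FL(1)[OF that] GL(1)[OF that]] Lq_inner(1)[OF pq FL(2)[OF that] GL(2)[OF that]]
    by (auto simp: P_def[abs_def] Pinf_def[abs_def])
  \<comment> \<open>Test functions supported in a ball whose closure lies in
    \<open>\<Omega>\<close>. The strong convergence supplies functionals on exactly this ball, and
    \<open>distr_div_test\<close> expresses them by the fields.\<close>
  have local: "(\<lambda>k. LINT x|lebesgue_on (ball z r). \<theta> x * P k x) \<longlonglongrightarrow> (LINT x|lebesgue_on (ball z r). \<theta> x * Pinf x)"
    if r: "0 < r" "cball z r \<subseteq> \<Omega>" and \<theta>: "\<theta> \<in> test_functions (ball z r)" for z r \<theta>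
  proof -
    let ?B = "ball z r"
    have B: "open ?B" "compactly_in ?B \<Omega>" "bounded ?B" "?B \<in> sets lebesgue" "?B \<subseteq> \<Omega>"
      using r by (auto simp: compactly_in_def intro!: exI[of _ "cball z r"])
    obtain S Sinf where S: "\<And>k. Wm1_extends p ?B (distr_div \<Omega> (F k)) (S k)" "Wm1_extends p ?B (distr_div \<Omega> Finf) Sinf"
      "(\<lambda>k. Wm1_norm p ?B (\<lambda>u. S k u - Sinf u)) \<longlonglongrightarrow> 0"
      using assms(12) B(1,2) unfolding strong_conv_Wm1_loc_def by blast
    have \<Omega>': "\<Omega> \<in> sets lebesgue" using \<Omega> by auto
    note FL1 = Lq_imp_Lq_1(1)[OF _ p B(3,4)]
    show ?thesis unfolding P_def Pinf_def
    proof (rule div_curl_ball[OF p q_def r(1) refl Fw[OF B(1,2)] Gw[OF B(1,2)] _ _ _ _ _ _ S(3) \<theta>])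
      show "S k \<in> Wm1 p ?B" "Sinf \<in> Wm1 p ?B" for k
        using S by (auto simp: Wm1_extends_def)
      show "S k \<phi> = - (LINT x|lebesgue_on ?B. F k x \<bullet> grad \<phi> x)" if "\<phi> \<in> test_functions ?B" for k \<phi>
        using S(1)[of k] that distr_div_test(1)[OF FL1[OF FL(1)[OF B(1,2)]] B(4) \<Omega>' B(5) that, of k]
        by (simp add: Wm1_extends_def)
      show "Sinf \<phi> = - (LINT x|lebesgue_on ?B. Finf x \<bullet> grad \<phi> x)" if "\<phi> \<in> test_functions ?B" for \<phi>
        using S(2) that distr_div_test(1)[OF FL1[OF FL(2)[OF B(1,2)]] B(4) \<Omega>' B(5) that]
        by (simp add: Wm1_extends_def)
    next
      fix k and e :: real assume e: "0 < e"
      show "\<exists>v. smooth_fun v \<and> integrable (lebesgue_on ?B) (\<lambda>x. norm (grad v x) powr q) \<and>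
        (LINT x|lebesgue_on ?B. norm (grad v x - G k x) powr q) < e"
        unfolding G_def using assms(8) by (intro frac_grad_approx_grad n s pq B(3,4) e) (simp add: q_def)
    next
      fix e :: real assume e: "0 < e"
      show "\<exists>v. smooth_fun v \<and> integrable (lebesgue_on ?B) (\<lambda>x. norm (grad v x) powr q) \<and>
        (LINT x|lebesgue_on ?B. norm (grad v x - Ginf x) powr q) < e"
        unfolding Ginf_def using assms(9) by (intro frac_grad_approx_grad n s pq B(3,4) e) (simp add: q_def)
    qed
  qed
  have conv: "(\<lambda>k. distr_of \<Omega> (P k) \<phi>) \<longlonglongrightarrow> distr_of \<Omega> Pinf \<phi>" if \<phi>: "\<phi> \<in> test_functions \<Omega>" for \<phi>
  proof -
    obtain K where K: "smooth_fun \<phi>" "compact K" "K \<subseteq> \<Omega>" "\<And>x. x \<notin> K \<Longrightarrow> \<phi> x = 0"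
      by (rule test_functionsE[OF \<phi>]) blast
    obtain e U where e: "0 < e" and U: "open U" "K \<subseteq> U" "bounded U" "compactly_in U \<Omega>"
      and cb: "\<And>x. x \<in> K \<Longrightarrow> cball x e \<subseteq> \<Omega>"
      using compact_open_neighbourhood[OF K(2) \<Omega> K(3)] by metis
    have UL: "U \<in> sets lebesgue" "U \<subseteq> \<Omega>" "\<Omega> \<in> sets lebesgue" using U \<Omega> by (auto simp: compactly_in_def)
    \<comment> \<open>If a point of \<open>K\<close> lies within distance \<open>r\<close> of a
      centre, the ball of radius \<open>2 * r\<close> about that centre lies within distance
      \<open>3 * r = e\<close> of the point, hence in \<open>\<Omega>\<close>.\<close>
    define r where "r = e / 3"
    have r: "r > 0" using e by (simp add: r_def)
    obtain \<eta> :: "real^'n \<Rightarrow> real" where \<eta>: "smooth_fun \<eta>" "\<And>x. 0 \<le> \<eta> x" "\<And>x. \<eta> x \<le> 1"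
      "\<And>x. norm x > r \<Longrightarrow> \<eta> x = 0" "integrable lborel \<eta>" "0 < (LINT x|lborel. \<eta> x)"
      using exists_bump[OF r] by blast
    define I0 where "I0 = (LINT x|lborel. \<eta> x)"
    have \<eta>m: "\<eta> \<in> borel_measurable borel" by (rule borel_measurable_smooth_fun[OF \<eta>(1)])
    have \<phi>0: "\<phi> x = 0" if "x \<notin> U" for x using that U K(4) by blast
    have onU: "distr_of \<Omega> Q \<psi> = (LINT x|lebesgue_on U. \<psi> x * Q x)" if "\<And>x. x \<notin> U \<Longrightarrow> \<psi> x = 0" for Q \<psi>
      unfolding distr_of_def using UL that by (intro lebesgue_on_support(1)) auto
    \<comment> \<open>The piece of \<open>\<phi>\<close> near the centre \<open>c\<close>.
      Integrated over \<open>c\<close> the pieces give \<open>\<phi>\<close> times the integral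
      \<open>I0\<close> of the bump.\<close>
    define \<theta> where "\<theta> c x = \<phi> x * \<eta> (x - c)" for c x
    have \<theta>0: "\<theta> c x = 0" if "x \<notin> U" for c x using \<phi>0[OF that] by (simp add: \<theta>_def)
    have \<theta>K: "\<theta> c x = 0" if "x \<notin> K \<inter> cball c r" for c x
      using that K(4)[of x] \<eta>(4)[of "x - c"] by (auto simp: \<theta>_def dist_norm norm_minus_commute)
    have \<theta>s: "smooth_fun (\<theta> c)" for c
      unfolding \<theta>_def using smooth_fun_translate[OF \<eta>(1), of "- c"] by (intro smooth_fun_mult K(1)) simp
    have c_conv: "(\<lambda>k. distr_of \<Omega> (P k) (\<theta> c)) \<longlonglongrightarrow> distr_of \<Omega> Pinf (\<theta> c)" for c
    proof (cases "K \<inter> cball c r = {}")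
      case True
      then have "\<theta> c x = 0" for x using \<theta>K by blast
      then show ?thesis by (simp add: distr_of_def)
    next
      case False
      then obtain x where x: "x \<in> K" "dist c x \<le> r" by auto
      have "cball c (2 * r) \<subseteq> cball x e"
      proof
        fix y assume "y \<in> cball c (2 * r)"
        then show "y \<in> cball x e"
          using x(2) dist_triangle[of x y c] by (simp add: r_def dist_commute)
      qed
      then have sub: "cball c (2 * r) \<subseteq> \<Omega>" using cb[OF x(1)] by blast
      \<comment> \<open>The radius is doubled so that the closed ball of radius \<open>r\<close>,
        which confines the support, is a compact part of the open ball.\<close>
      have t: "\<theta> c \<in> test_functions (ball c (2 * r))"
      proof (rule test_functionsI[OF \<theta>s])
        show "compact (K \<inter> cball c r)" using K(2) by (intro compact_Int_closed) auto
        show "K \<inter> cball c r \<subseteq> ball c (2 * r)" using r by auto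
      qed (rule \<theta>K)
      have onB: "distr_of \<Omega> Q (\<theta> c) = (LINT x|lebesgue_on (ball c (2 * r)). \<theta> c x * Q x)" for Q
        unfolding distr_of_def
      proof (rule lebesgue_on_support(1))
        show "ball c (2 * r) \<subseteq> \<Omega>" using sub by auto
        show "\<theta> c x * Q x = 0" if "x \<in> \<Omega> - ball c (2 * r)" for x using that \<theta>K[of x c] r by auto
      qed (use UL in auto)
      show ?thesis unfolding onB using r by (intro local sub t) auto
    qed
    obtain A where A: "A > 0" "\<And>x. \<bar>\<phi> x\<bar> \<le> A" using test_functions_bounded[OF \<phi>] by blast
    have \<theta>A: "\<bar>\<theta> c x\<bar> \<le> A" for c x
    proof -
      have "\<bar>\<theta> c x\<bar> \<le> A * 1" unfolding \<theta>_def abs_mult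
        using A(2)[of x] A(1) \<eta>(2,3)[of "x - c"] by (intro mult_mono) auto
      then show ?thesis by simp
    qed
    obtain CF where CF: "0 < CF" "\<And>k. (LINT x|lebesgue_on U. norm (F k x) powr p) \<le> CF"
      using weak_conv_Lq_bounded[OF p Fw[OF U(1,4)]] by blast
    obtain CG where CG: "0 < CG" "\<And>k. (LINT x|lebesgue_on U. norm (G k x) powr q) \<le> CG"
      using weak_conv_Lq_bounded[OF pq(2) Gw[OF U(1,4)]] by blast
    define D where "D = (A powr p * CF) powr (1/p) * CG powr (1/q)"
    \<comment> \<open>Only the maximum of \<open>\<phi>\<close> and the norms over \<open>U\<close>
      enter, so the bound is uniform in \<open>k\<close> and in the centre, as dominated convergence
      over \<open>c\<close> requires.\<close>
    have D: "\<bar>distr_of \<Omega> (P k) (\<theta> c)\<bar> \<le> D" for k c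
    proof -
      note A' = Lq_bounded_scaleR[OF FL(1)[OF U(1,4)] borel_measurable_smooth_fun[OF \<theta>s] \<theta>A]
      have p0: "0 \<le> p" using p by simp
      have "distr_of \<Omega> (P k) (\<theta> c) = (LINT x|lebesgue_on U. (\<theta> c x *\<^sub>R F k x) \<bullet> G k x)"
        using onU[of "\<theta> c" "P k", OF \<theta>0] by (simp add: P_def)
      also have "\<bar>\<dots>\<bar> \<le> (LINT x|lebesgue_on U. norm (\<theta> c x *\<^sub>R F k x) powr p) powr (1/p)
          * (LINT x|lebesgue_on U. norm (G k x) powr q) powr (1/q)"
        by (intro Lq_inner(3)[OF pq] A'(1) p0 GL(1) U)
      also have "\<dots> \<le> D" unfolding D_def
      proof (intro mult_mono powr_mono2)
        show "(LINT x|lebesgue_on U. norm (\<theta> c x *\<^sub>R F k x) powr p) \<le> A powr p * CF"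
          by (rule order_trans[OF A'(2)[OF p0] mult_left_mono[OF CF(2)]]) simp
      qed (use CG(2) pq in \<open>auto intro!: Bochner_Integration.integral_nonneg\<close>)
      finally show ?thesis .
    qed
    obtain R where R: "\<And>x. x \<in> K \<Longrightarrow> norm x \<le> R"
      using compact_imp_bounded[OF K(2)] by (auto simp: bounded_iff)
    \<comment> \<open>Distant centres do not meet the support of \<open>\<phi>\<close>; this gives
      the dominating constant a bounded support in \<open>c\<close>.\<close>
    have far: "distr_of \<Omega> Q (\<theta> c) = 0" if "c \<notin> cball 0 (R + r)" for Q c
    proof -
      have "\<theta> c x = 0" for x
      proof (rule \<theta>K)
        show "x \<notin> K \<inter> cball c r"
        proof
          assume "x \<in> K \<inter> cball c r"
          then have "norm x \<le> R" "norm (c - x) \<le> r" using R by (auto simp: dist_norm)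
          then have "norm c \<le> R + r" using norm_triangle_ineq[of x "c - x"] by simp
          then show False using that by simp
        qed
      qed
      then show ?thesis by (simp add: distr_of_def)
    qed
    have avg: "(LINT c|lborel. distr_of \<Omega> Q (\<theta> c)) = I0 * distr_of \<Omega> Q \<phi>"
      and avg_m: "(\<lambda>c. distr_of \<Omega> Q (\<theta> c)) \<in> borel_measurable lborel"
      if Q: "\<And>U. open U \<Longrightarrow> compactly_in U \<Omega> \<Longrightarrow> integrable (lebesgue_on U) Q" for Q
    proof -
      have i: "integrable (lebesgue_on U) (\<lambda>x. \<phi> x * Q x)"
        using test_times_locally_integrable[OF \<Omega> Q \<phi>] lebesgue_on_support(2)[of \<Omega> U "\<lambda>x. \<phi> x * Q x"] UL \<phi>0
        by auto
      show "(LINT c|lborel. distr_of \<Omega> Q (\<theta> c)) = I0 * distr_of \<Omega> Q \<phi>"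
        using integral_average_translates(1)[OF U(3) UL(1) i \<eta>m \<eta>(5,2)]
        by (simp add: onU[OF \<theta>0] onU[OF \<phi>0] I0_def \<theta>_def)
      show "(\<lambda>c. distr_of \<Omega> Q (\<theta> c)) \<in> borel_measurable lborel"
        using integral_average_translates(2)[OF U(3) UL(1) i \<eta>m \<eta>(5,2)]
        by (simp add: onU[OF \<theta>0] \<theta>_def)
    qed
    have "(\<lambda>k. LINT c|lborel. distr_of \<Omega> (P k) (\<theta> c)) \<longlonglongrightarrow> (LINT c|lborel. distr_of \<Omega> Pinf (\<theta> c))"
    proof (rule integral_dominated_convergence[where w = "\<lambda>c. D * indicator (cball 0 (R + r)) c"])
      show "integrable lborel (\<lambda>c::real^'n. D * indicator (cball 0 (R + r)) c)"
        by (intro integrable_mult_right integrable_real_indicator) (auto simp: emeasure_lborel_cball_less_top)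
      show "AE c in lborel. (\<lambda>k. distr_of \<Omega> (P k) (\<theta> c)) \<longlonglongrightarrow> distr_of \<Omega> Pinf (\<theta> c)"
        using c_conv by simp
      show "AE c in lborel. norm (distr_of \<Omega> (P k) (\<theta> c)) \<le> D * indicator (cball 0 (R + r)) c" for k
      proof (rule AE_I2)
        fix c
        show "norm (distr_of \<Omega> (P k) (\<theta> c)) \<le> D * indicator (cball 0 (R + r)) c"
          using D[of k c] far[of c "P k"] by (cases "c \<in> cball 0 (R + r)") auto
      qed
    qed (use avg_m Pi in auto)
    then have "(\<lambda>k. I0 * distr_of \<Omega> (P k) \<phi>) \<longlonglongrightarrow> I0 * distr_of \<Omega> Pinf \<phi>"
      by (simp add: avg Pi)
    then have "(\<lambda>k. inverse I0 * (I0 * distr_of \<Omega> (P k) \<phi>)) \<longlonglongrightarrow> inverse I0 * (I0 * distr_of \<Omega> Pinf \<phi>)"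
      by (rule tendsto_mult_left)
    then show ?thesis using \<eta>(6) by (simp add: I0_def mult.assoc[symmetric])
  qed
  have "distr_of \<Omega> (P k) \<in> distributions \<Omega>" "distr_of \<Omega> Pinf \<in> distributions \<Omega>" for k
    using Pi by (auto intro!: distr_of_in_distributions \<Omega>)
  then have "weak_star_conv_distr \<Omega> (\<lambda>k. distr_of \<Omega> (P k)) (distr_of \<Omega> Pinf)"
    unfolding weak_star_conv_distr_def using conv by blast
  then show ?thesis by (simp add: P_def[abs_def] Pinf_def[abs_def] G_def Ginf_def q_def)
qed

end
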